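(* Let $\Gamma\subset\mathbb{Q}$ be a dense additive subgroup with $1\in\Gamma$. Let $(k(n))_{n\in\mathbb{N}}$ be a strictly increasing sequence of natural numbers such that $k(n)\mid k(n+1)$ for all $n$ and $\{1/k(n)\}_{n}$ is a generating set of $\Gamma$. Then $\Gamma\ltimes_\alpha[0_+,1_-]$ is isomorphic, as a topological groupoid, to the UHF groupoid associated with the Bratteli diagram $$k(1)\xrightarrow{k(2)/k(1)}k(2)\xrightarrow{k(3)/k(2)}k(3)\xrightarrow{k(4)/k(3)}\cdots$$ This limit is independent of the choice of such a generating set; therefore the corresponding inductive limits of symmetric groups $\varinjlim S_{k(n)}$ (respectively of alternating groups $\varinjlim A_{k(n)}$) are classified up to isomorphism by their supernatural numbers $\prod_{i=1}^\infty k_i$, where $k_1=k(1)$ and $k_i=k(i)/k(i-1)$ for $i\ge2$.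
   Context: Let $\mathbb{R}_\Gamma=(\mathbb{R}\setminus\Gamma)\sqcup\{a_+,a_-:a\in\Gamma\}$, with $q:\mathbb{R}_\Gamma\to\mathbb{R}$, $q(t)=t$, $q(a_\pm)=a$. Totally order $\mathbb{R}_\Gamma$ by $x<y$ if $q(x)<q(y)$, and $a_-<a_+$ for $a\in\Gamma$, and give it the order topology. $\Gamma$ acts on $\mathbb{R}_\Gamma$ by $\alpha_c(t)=t+c$ and $\alpha_c(a_\pm)=(a+c)_\pm$. Let $[0_+,1_-]=\{z\in\mathbb{R}_\Gamma:0_+\le z\le 1_-\}$. $\Gamma\ltimes_\alpha[0_+,1_-]=\{(c,x): c\in\Gamma,\ x,\alpha_c(x)\in[0_+,1_-]\}$ is the restriction of the transformation groupoid $\Gamma\ltimes\mathbb{R}_\Gamma$, with the subspace topology. UHF groupoid: let $\mathcal{R}_k$ be the full equivalence relation on $\{0,\dots,k-1\}$. For $k\mid k'$ there is an inclusion $\mathcal{R}_k\to\mathcal{R}_{k'}$ sending the arrow $i\mapsto j$ to the collection of arrows $i(k'/k)+m\mapsto j(k'/k)+m$, $0\le m<k'/k$. The UHF groupoid of the diagram is the resulting inductive limit $\bigcup_n\mathcal{R}_{k(n)}$; concretely, it is the tail-equivalence relation on $\prod_{i\ge1}\{0,\dots,k_i-1\}$ (two sequences are equivalent iff they agree from some index on), with the inductive limit topology. The same block formula defines the inclusions $S_{k(n)}\to S_{k(n+1)}$ (a permutation $\pi$ goes to $i(k(n+1)/k(n))+m\mapsto \pi(i)(k(n+1)/k(n))+m$),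 under which $A_{k(n)}$ maps into $A_{k(n+1)}$. *)

theory Defs
  imports
    "HOL-Analysis.Analysis"
    "HOL-Algebra.Sym_Groups"
    "HOL-Computational_Algebra.Group_Closure"
    "HOL-Computational_Algebra.Primes"
begin

section \<open>Topological groupoids\<close>

text \<open>
  A groupoid is represented by its arrows alone: units are identified with identity arrows, and
  \<open>gsrc\<close>, \<open>grng\<close> are the maps \<open>g \<mapsto> g\<inverse>g\<close> and \<open>g \<mapsto> gg\<inverse>\<close>. The product
  \<open>gmult G g h\<close> (first \<open>h\<close>, then \<open>g\<close>) is only meaningful when \<open>gsrc G g = grng G h\<close>.
  The set of arrows is \<open>topspace (gtop G)\<close>.
\<close>

record 'a groupoid_struct =
  gtop :: "'a topology"
  gsrc :: "'a \<Rightarrow> 'a"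
  grng :: "'a \<Rightarrow> 'a"
  gmult :: "'a \<Rightarrow> 'a \<Rightarrow> 'a"
  ginv :: "'a \<Rightarrow> 'a"

definition arrows :: "('a, 'm) groupoid_struct_scheme \<Rightarrow> 'a set" where
  "arrows G = topspace (gtop G)"

definition composable :: "('a, 'm) groupoid_struct_scheme \<Rightarrow> ('a \<times> 'a) set" where
  "composable G = {(g, h). g \<in> arrows G \<and> h \<in> arrows G \<and> gsrc G g = grng G h}"

definition groupoid :: "('a, 'm) groupoid_struct_scheme \<Rightarrow> bool" where
  "groupoid G \<longleftrightarrow>
     (\<forall>g \<in> arrows G. gsrc G g \<in> arrows G \<and> grng G g \<in> arrows G \<and> ginv G g \<in> arrows G) \<and>
     (\<forall>g \<in> arrows G. gsrc G (gsrc G g) = gsrc G g \<and> grng G (gsrc G g) = gsrc G g \<and>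
                     gsrc G (grng G g) = grng G g \<and> grng G (grng G g) = grng G g) \<and>
     (\<forall>(g, h) \<in> composable G. gmult G g h \<in> arrows G \<and>
                     gsrc G (gmult G g h) = gsrc G h \<and> grng G (gmult G g h) = grng G g) \<and>
     (\<forall>g h k. (g, h) \<in> composable G \<longrightarrow> (h, k) \<in> composable G \<longrightarrow>
                     gmult G (gmult G g h) k = gmult G g (gmult G h k)) \<and>
     (\<forall>g \<in> arrows G. gmult G g (gsrc G g) = g \<and> gmult G (grng G g) g = g) \<and>
     (\<forall>g \<in> arrows G. gsrc G (ginv G g) = grng G g \<and> grng G (ginv G g) = gsrc G g \<and>
                     gmult G (ginv G g) g = gsrc G g \<and> gmult G g (ginv G g) = grng G g)"

definition topological_groupoid :: "('a, 'm) groupoid_struct_scheme \<Rightarrow> bool" where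
  "topological_groupoid G \<longleftrightarrow> groupoid G \<and>
     continuous_map (subtopology (prod_topology (gtop G) (gtop G)) (composable G)) (gtop G)
       (\<lambda>(g, h). gmult G g h) \<and>
     continuous_map (gtop G) (gtop G) (ginv G)"

definition topological_groupoid_iso ::
    "('a, 'm) groupoid_struct_scheme \<Rightarrow> ('b, 'n) groupoid_struct_scheme \<Rightarrow> ('a \<Rightarrow> 'b) \<Rightarrow> bool" where
  "topological_groupoid_iso G H f \<longleftrightarrow>
     homeomorphic_map (gtop G) (gtop H) f \<and>
     (\<forall>g \<in> arrows G. \<forall>h \<in> arrows G. (f g, f h) \<in> composable H \<longleftrightarrow> (g, h) \<in> composable G) \<and>
     (\<forall>(g, h) \<in> composable G. f (gmult G g h) = gmult H (f g) (f h))"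

definition isomorphic_topological_groupoids ::
    "('a, 'm) groupoid_struct_scheme \<Rightarrow> ('b, 'n) groupoid_struct_scheme \<Rightarrow> bool" where
  "isomorphic_topological_groupoids G H \<longleftrightarrow>
     topological_groupoid G \<and> topological_groupoid H \<and> (\<exists>f. topological_groupoid_iso G H f)"


section \<open>The space \<open>\<real>\<^sub>\<Gamma>\<close> and the groupoid \<open>\<Gamma> \<ltimes> [0\<^sub>+, 1\<^sub>-]\<close>\<close>

text \<open>\<open>Minus a\<close> and \<open>Plus a\<close> stand for \<open>a\<^sub>-\<close> and \<open>a\<^sub>+\<close>.\<close>

datatype cut_real = Pt real | Minus real | Plus real

fun cut_q :: "cut_real \<Rightarrow> real" where
  "cut_q (Pt t) = t"
| "cut_q (Minus a) = a"
| "cut_q (Plus a) = a"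

definition cut_line :: "real set \<Rightarrow> cut_real set" where
  "cut_line \<Gamma> = Pt ` (- \<Gamma>) \<union> Minus ` \<Gamma> \<union> Plus ` \<Gamma>"

definition cut_less :: "cut_real \<Rightarrow> cut_real \<Rightarrow> bool" where
  "cut_less x y \<longleftrightarrow> cut_q x < cut_q y \<or> (\<exists>a. x = Minus a \<and> y = Plus a)"

definition cut_le :: "cut_real \<Rightarrow> cut_real \<Rightarrow> bool" where
  "cut_le x y \<longleftrightarrow> cut_less x y \<or> x = y"

text \<open>The order topology, with the open rays as a subbase.\<close>

definition cut_topology :: "real set \<Rightarrow> cut_real topology" where
  "cut_topology \<Gamma> = topology_generated_by
     ({{y \<in> cut_line \<Gamma>. cut_less x y} | x. x \<in> cut_line \<Gamma>} \<union>
      {{y \<in> cut_line \<Gamma>. cut_less y x} | x. x \<in> cut_line \<Gamma>})"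

fun cut_shift :: "real \<Rightarrow> cut_real \<Rightarrow> cut_real" where
  "cut_shift c (Pt t) = Pt (t + c)"
| "cut_shift c (Minus a) = Minus (a + c)"
| "cut_shift c (Plus a) = Plus (a + c)"

definition cut_unit_interval :: "real set \<Rightarrow> cut_real set" where
  "cut_unit_interval \<Gamma> = {z \<in> cut_line \<Gamma>. cut_le (Plus 0) z \<and> cut_le z (Minus 1)}"

text \<open>
  The arrow \<open>(c, x)\<close> goes from \<open>x\<close> to \<open>\<alpha>\<^sub>c(x)\<close>; the unit at \<open>x\<close> is \<open>(0, x)\<close>.
  The group \<open>\<Gamma>\<close> is discrete.
\<close>

definition cut_groupoid :: "real set \<Rightarrow> (real \<times> cut_real) groupoid_struct" where
  "cut_groupoid \<Gamma> = \<lparr>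
     gtop = subtopology (prod_topology (discrete_topology \<Gamma>) (cut_topology \<Gamma>))
              {(c, x). c \<in> \<Gamma> \<and> x \<in> cut_unit_interval \<Gamma> \<and> cut_shift c x \<in> cut_unit_interval \<Gamma>},
     gsrc = (\<lambda>(c, x). (0, x)),
     grng = (\<lambda>(c, x). (0, cut_shift c x)),
     gmult = (\<lambda>(d, y) (c, x). (d + c, x)),
     ginv = (\<lambda>(c, x). (- c, cut_shift c x)) \<rparr>"


section \<open>The UHF groupoid\<close>

text \<open>
  Sequences \<open>(k(n))\<close> are indexed from \<open>0\<close>: \<open>k 0\<close> is the first term \<open>k(1)\<close>, and
  \<open>factor k i\<close> is the factor \<open>k\<^sub>i\<^sub>+\<^sub>1\<close>, so that \<open>k n = (\<Prod>i\<le>n. factor k i)\<close> for divisibility chains.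
\<close>

definition factor :: "(nat \<Rightarrow> nat) \<Rightarrow> nat \<Rightarrow> nat" where
  "factor k i = (case i of 0 \<Rightarrow> k 0 | Suc j \<Rightarrow> k (Suc j) div k j)"

definition path_space :: "(nat \<Rightarrow> nat) \<Rightarrow> (nat \<Rightarrow> nat) topology" where
  "path_space k = product_topology (\<lambda>i. discrete_topology {..<factor k i}) UNIV"

text \<open>
  The copy of \<open>\<R>\<^sub>k\<^sub>(\<^sub>n\<^sub>)\<close> in the tail equivalence relation: pairs which may only differ in the
  coordinates \<open>0, \<dots>, n\<close>.
\<close>

definition tail_rel_stage :: "(nat \<Rightarrow> nat) \<Rightarrow> nat \<Rightarrow> ((nat \<Rightarrow> nat) \<times> (nat \<Rightarrow> nat)) set" where
  "tail_rel_stage k n =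
     {(x, y). x \<in> topspace (path_space k) \<and> y \<in> topspace (path_space k) \<and> (\<forall>i>n. x i = y i)}"

definition tail_rel :: "(nat \<Rightarrow> nat) \<Rightarrow> ((nat \<Rightarrow> nat) \<times> (nat \<Rightarrow> nat)) set" where
  "tail_rel k = (\<Union>n. tail_rel_stage k n)"

definition tail_topology :: "(nat \<Rightarrow> nat) \<Rightarrow> ((nat \<Rightarrow> nat) \<times> (nat \<Rightarrow> nat)) topology" where
  "tail_topology k = topology (\<lambda>U. U \<subseteq> tail_rel k \<and>
     (\<forall>n. openin (subtopology (prod_topology (path_space k) (path_space k)) (tail_rel_stage k n))
            (U \<inter> tail_rel_stage k n)))"

lemma openin_tail_topology:
  "openin (tail_topology k) U \<longleftrightarrow> U \<subseteq> tail_rel k \<and>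
     (\<forall>n. openin (subtopology (prod_topology (path_space k) (path_space k)) (tail_rel_stage k n))
            (U \<inter> tail_rel_stage k n))"
proof -
  have "istopology (\<lambda>U. U \<subseteq> tail_rel k \<and>
     (\<forall>n. openin (subtopology (prod_topology (path_space k) (path_space k)) (tail_rel_stage k n))
            (U \<inter> tail_rel_stage k n)))" (is "istopology ?P")
    unfolding istopology_def
  proof (intro conjI allI impI)
    fix S T assume "?P S" "?P T"
    then show "S \<inter> T \<subseteq> tail_rel k" by blast
    fix n
    have "S \<inter> T \<inter> tail_rel_stage k n = (S \<inter> tail_rel_stage k n) \<inter> (T \<inter> tail_rel_stage k n)"
      by blast
    with \<open>?P S\<close> \<open>?P T\<close>
    show "openin (subtopology (prod_topology (path_space k) (path_space k)) (tail_rel_stage k n))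
            (S \<inter> T \<inter> tail_rel_stage k n)"
      by (metis openin_Int)
  next
    fix K assume K: "\<forall>S\<in>K. ?P S"
    then show "\<Union>K \<subseteq> tail_rel k" by blast
    fix n
    have "\<Union>K \<inter> tail_rel_stage k n = (\<Union>S\<in>K. S \<inter> tail_rel_stage k n)" by blast
    moreover have "openin (subtopology (prod_topology (path_space k) (path_space k)) (tail_rel_stage k n))
        (\<Union>S\<in>K. S \<inter> tail_rel_stage k n)"
      by (rule openin_Union) (use K in blast)
    ultimately show "openin (subtopology (prod_topology (path_space k) (path_space k)) (tail_rel_stage k n))
            (\<Union>K \<inter> tail_rel_stage k n)"
      by simp
  qed
  then show ?thesis
    unfolding tail_topology_def by (simp add: topology_inverse')
qed

text \<open>The arrow \<open>(x, y)\<close> goes from \<open>y\<close> to \<open>x\<close>; the unit at \<open>x\<close> is \<open>(x, x)\<close>.\<close>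

definition uhf_groupoid :: "(nat \<Rightarrow> nat) \<Rightarrow> ((nat \<Rightarrow> nat) \<times> (nat \<Rightarrow> nat)) groupoid_struct" where
  "uhf_groupoid k = \<lparr>
     gtop = tail_topology k,
     gsrc = (\<lambda>(x, y). (y, y)),
     grng = (\<lambda>(x, y). (x, x)),
     gmult = (\<lambda>(x, y) (y', z). (x, z)),
     ginv = (\<lambda>(x, y). (y, x)) \<rparr>"


section \<open>Inductive limits of symmetric and alternating groups\<close>

text \<open>
  The inductive limit of \<open>G 0 \<rightarrow> G 1 \<rightarrow> \<dots>\<close> with connecting maps \<open>f n : G n \<rightarrow> G (n + 1)\<close>:
  the disjoint union modulo eventual equality. \<open>transport f n m\<close> is the composite
  \<open>G n \<rightarrow> G m\<close> for \<open>n \<le> m\<close>.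
\<close>

definition transport :: "(nat \<Rightarrow> 'a \<Rightarrow> 'a) \<Rightarrow> nat \<Rightarrow> nat \<Rightarrow> 'a \<Rightarrow> 'a" where
  "transport f n m = fold f [n..<m]"

definition limit_rel ::
    "(nat \<Rightarrow> ('a, 'm) monoid_scheme) \<Rightarrow> (nat \<Rightarrow> 'a \<Rightarrow> 'a) \<Rightarrow> ((nat \<times> 'a) \<times> (nat \<times> 'a)) set" where
  "limit_rel G f = {((n, g), (m, h)). g \<in> carrier (G n) \<and> h \<in> carrier (G m) \<and>
     (\<exists>l \<ge> max n m. transport f n l g = transport f m l h)}"

definition inductive_limit ::
    "(nat \<Rightarrow> ('a, 'm) monoid_scheme) \<Rightarrow> (nat \<Rightarrow> 'a \<Rightarrow> 'a) \<Rightarrow> (nat \<times> 'a) set monoid" where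
  "inductive_limit G f = \<lparr>
     carrier = (SIGMA n:UNIV. carrier (G n)) // limit_rel G f,
     mult = (\<lambda>A B. \<Union>(n, g)\<in>A. \<Union>(m, h)\<in>B. limit_rel G f ``
              {(max n m, transport f n (max n m) g \<otimes>\<^bsub>G (max n m)\<^esub> transport f m (max n m) h)}),
     one = limit_rel G f `` {(0, \<one>\<^bsub>G 0\<^esub>)} \<rparr>"

text \<open>
  The block inclusion \<open>S\<^sub>k \<rightarrow> S\<^sub>k\<^sub>'\<close> for \<open>k\<close> dividing \<open>k'\<close>. As \<^const>\<open>sym_group\<close> permutes
  \<open>{1..k}\<close> rather than \<open>{0, \<dots>, k - 1}\<close>, the rule \<open>i (k'/k) + m \<mapsto> \<pi>(i) (k'/k) + m\<close> is
  conjugated by the shift \<open>i \<mapsto> i + 1\<close>.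
\<close>

definition block_inclusion :: "nat \<Rightarrow> nat \<Rightarrow> (nat \<Rightarrow> nat) \<Rightarrow> nat \<Rightarrow> nat" where
  "block_inclusion k k' \<pi> = (\<lambda>j. if j \<in> {1..k'}
     then (\<pi> ((j - 1) div (k' div k) + 1) - 1) * (k' div k) + (j - 1) mod (k' div k) + 1
     else j)"

definition sym_limit :: "(nat \<Rightarrow> nat) \<Rightarrow> (nat \<times> (nat \<Rightarrow> nat)) set monoid" where
  "sym_limit k = inductive_limit (\<lambda>n. sym_group (k n)) (\<lambda>n. block_inclusion (k n) (k (Suc n)))"

definition alt_limit :: "(nat \<Rightarrow> nat) \<Rightarrow> (nat \<times> (nat \<Rightarrow> nat)) set monoid" where
  "alt_limit k = inductive_limit (\<lambda>n. alt_group (k n)) (\<lambda>n. block_inclusion (k n) (k (Suc n)))"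


section \<open>Supernatural numbers and generating sequences\<close>

text \<open>
  A supernatural number is the function assigning to each prime its exponent in
  \<open>\<nat> \<union> {\<infinity>}\<close> (and \<open>0\<close> to each non-prime).
\<close>

definition supernatural_prod :: "(nat \<Rightarrow> nat) \<Rightarrow> nat \<Rightarrow> enat" where
  "supernatural_prod a p =
     (if prime p then (SUP n. \<Sum>i\<le>n. enat (multiplicity p (a i))) else 0)"

text \<open>Positivity of the terms follows: \<open>0\<close> divides only itself.\<close>

definition divisibility_chain :: "(nat \<Rightarrow> nat) \<Rightarrow> bool" where
  "divisibility_chain k \<longleftrightarrow> strict_mono k \<and> (\<forall>n. k n dvd k (Suc n))"

definition generating_chain :: "real set \<Rightarrow> (nat \<Rightarrow> nat) \<Rightarrow> bool" where
  "generating_chain \<Gamma> k \<longleftrightarrow>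
     divisibility_chain k \<and> group_closure (range (\<lambda>n. 1 / real (k n))) = \<Gamma>"

end

theory Submission
  imports Defs
begin

text \<open>
  Write the points of \<open>[0\<^sub>+, 1\<^sub>-]\<close> in the mixed radix system with bases \<open>factor k\<close>. The two points \<open>a\<^sub>+\<close>
  and \<open>a\<^sub>-\<close> over \<open>a \<in> \<Gamma>\<close> account for the two expansions of \<open>a\<close>, so the digit map is a homeomorphism
  onto the path space, and translation by \<open>c \<in> 1/k(n) \<int>\<close> changes only the digits up to \<open>n\<close>; it
  therefore carries \<open>\<Gamma> \<ltimes> [0\<^sub>+, 1\<^sub>-]\<close> onto tail equivalence.

  Permutations of \<open>{1..k n}\<close> act on \<open>[0, 1)\<close> by permuting subintervals of length \<open>1/k n\<close>, compatibly with
  the block inclusions, so the inductive limits are groups of transformations of \<open>[0, 1)\<close>. If the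
  supernatural numbers agree, these groups coincide. Conversely, the measure of the support is a
  conjugation invariant length. Up to a bounded error, the ratio of the lengths of \<open>g\<close> and \<open>s\<close>, both of
  order 3, is the number of conjugates of \<open>s\<close> needed to write \<open>g\<close>, for any such length; so an isomorphism
  preserves the length of elements of order 3. These lengths are the numbers \<open>3 a / k n\<close>, which
  recovers divisibility between the two chains.
\<close>

section \<open>Divisibility chains and supernatural numbers\<close>

text \<open>An abstract isomorphism of the limit groups need not come from a map of [0, 1), and no
  spatial reconstruction is attempted. What survives transport is that a length is subadditive and
  conjugation invariant, and these two properties yield the counting bound. Order 3 is chosen for
  two reasons: such elements are automatically even, so S and A share one argument under the flag
  \<open>ev\<close>; and the square of f is its inverse, which lets a short remainder be absorbed in
  two conjugates. The counting error is a constant number of conjugates of s, hence proportional to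
  the length of s, and vanishes as s shrinks.

  On the topological side a point z is replaced by the integers \<open>lev (k n) z\<close>. Order,
  topology, translation and digits can all be read off from these, so that both directions of the
  digit homeomorphism reduce to clopen sets and cylinders.\<close>

lemma divisibility_chain_pos:
  assumes "divisibility_chain k"
  shows "0 < k n"
proof -
  have "k n < k (Suc n)" "k n dvd k (Suc n)"
    using assms by (auto simp: divisibility_chain_def strict_mono_Suc_iff)
  then show ?thesis by (cases "k n = 0") auto
qed

lemma divisibility_chain_dvd:
  assumes "divisibility_chain k" "n \<le> m"
  shows "k n dvd k m"
  using assms(2)
proof (induction rule: dec_induct)
  case (step m)
  then show ?case using assms(1) dvd_trans unfolding divisibility_chain_def by blast
qed simp

lemma chain_unbounded: "divisibility_chain k \<Longrightarrow> n \<le> k n"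
  unfolding divisibility_chain_def using strict_mono_imp_increasing by blast

text \<open>The product of the factors telescopes to \<open>k n\<close>, so the partial sums in
  \<open>supernatural_prod\<close> are multiplicities in the terms of the chain.\<close>

lemma sum_multiplicity_factor:
  assumes k: "divisibility_chain k" and p: "prime p"
  shows "(\<Sum>i\<le>n. enat (multiplicity p (factor k i))) = enat (multiplicity p (k n))"
proof (induction n)
  case 0
  then show ?case by (simp add: factor_def)
next
  case (Suc n)
  have pos: "k n \<noteq> 0" "k (Suc n) \<noteq> 0"
    using divisibility_chain_pos[OF k, of n] divisibility_chain_pos[OF k, of "Suc n"] by auto
  have e: "k (Suc n) = k n * factor k (Suc n)"
    using k by (simp add: divisibility_chain_def factor_def)
  then have "multiplicity p (k (Suc n)) = multiplicity p (k n) + multiplicity p (factor k (Suc n))"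
    using pos p by (metis mult_eq_0_iff prime_elem_multiplicity_mult_distrib prime_imp_prime_elem)
  then show ?case using Suc by simp
qed

text \<open>Every multiplicity in \<open>k n\<close> is finite, hence is reached by some term of the
  other chain and not only in the limit. Only finitely many primes divide \<open>k n\<close>, so one
  late term serves them all.\<close>

lemma supernatural_eq_imp_dvd:
  assumes k: "divisibility_chain k" and l: "divisibility_chain l"
    and eq: "supernatural_prod (factor k) = supernatural_prod (factor l)"
  shows "\<exists>m. k n dvd l m"
proof -
  have ex: "\<exists>m. multiplicity p (k n) \<le> multiplicity p (l m)" if p: "prime p" for p
  proof (cases "multiplicity p (k n)")
    case (Suc j)
    \<comment> \<open>Going down to j makes the comparison with the supremum strict, which yields a
      single term above j, that is, at least \<open>Suc j\<close>.\<close>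
    have "enat j < enat (multiplicity p (k n))" using Suc by simp
    also have "\<dots> \<le> (SUP n. enat (multiplicity p (k n)))" by (rule SUP_upper) simp
    also have "\<dots> = supernatural_prod (factor l) p"
      using p unfolding eq[symmetric] supernatural_prod_def sum_multiplicity_factor[OF k p] by simp
    also have "\<dots> = (SUP m. enat (multiplicity p (l m)))"
      using p unfolding supernatural_prod_def sum_multiplicity_factor[OF l p] by simp
    finally obtain m where "enat j < enat (multiplicity p (l m))" by (auto simp: less_SUP_iff)
    then show ?thesis using Suc by (intro exI[of _ m]) simp
  qed auto
  then obtain M where M: "\<And>p. prime p \<Longrightarrow> multiplicity p (k n) \<le> multiplicity p (l (M p))" by metis
  \<comment> \<open>The extra 0 covers \<open>k n = 1\<close>, which has no prime factors.\<close>
  define m where "m = Max (insert 0 (M ` prime_factors (k n)))"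
  have "multiplicity p (k n) \<le> multiplicity p (l m)" if p: "prime p" for p
  proof (cases "p \<in> prime_factors (k n)")
    case True
    then have "M p \<le> m" by (simp add: m_def)
    then have "l (M p) dvd l m" by (rule divisibility_chain_dvd[OF l])
    then have "multiplicity p (l (M p)) \<le> multiplicity p (l m)"
      using divisibility_chain_pos[OF l, of m] by (intro dvd_imp_multiplicity_le) auto
    then show ?thesis using M[OF p] by linarith
  next
    case False
    then have "multiplicity p (k n) = 0"
      using p divisibility_chain_pos[OF k, of n] by (auto simp: prime_factors_multiplicity)
    then show ?thesis by simp
  qed
  then have "k n dvd l m"
    using divisibility_chain_pos[OF k, of n] divisibility_chain_pos[OF l, of m]
    by (intro multiplicity_le_imp_dvd) auto
  then show ?thesis by blast
qed

lemma supernatural_mono: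
  assumes k: "divisibility_chain k" and l: "divisibility_chain l" and "\<And>n. \<exists>m. k n dvd l m"
  shows "supernatural_prod (factor k) p \<le> supernatural_prod (factor l) p"
proof (cases "prime p")
  case True
  have "(SUP n. enat (multiplicity p (k n))) \<le> (SUP m. enat (multiplicity p (l m)))"
  proof (rule SUP_mono)
    fix n
    obtain m where "k n dvd l m" using assms(3) by blast
    then have "multiplicity p (k n) \<le> multiplicity p (l m)"
      using divisibility_chain_pos[OF l, of m] by (intro dvd_imp_multiplicity_le) auto
    then show "\<exists>m\<in>UNIV. enat (multiplicity p (k n)) \<le> enat (multiplicity p (l m))" by auto
  qed
  then show ?thesis
    using True unfolding supernatural_prod_def sum_multiplicity_factor[OF k True]
      sum_multiplicity_factor[OF l True] by simp
qed (simp add: supernatural_prod_def)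

section \<open>Permutations of order 3\<close>

text \<open>Bijectivity comes for free from f^3 = id (\<open>cubic_on_permutes\<close>). The
  identity is included, so elements can be cut into pieces without side conditions.\<close>

definition cubic_on :: "'a set \<Rightarrow> ('a \<Rightarrow> 'a) set" where
  "cubic_on S = {f. (\<forall>x. f (f (f x)) = x) \<and> (\<forall>x. x \<notin> S \<longrightarrow> f x = x)}"

definition supp :: "('a \<Rightarrow> 'a) \<Rightarrow> 'a set" where
  "supp f = {x. f x \<noteq> x}"

text \<open>The flag \<open>ev\<close> lets symmetric and alternating groups be treated in one
  go.\<close>

definition perms :: "bool \<Rightarrow> 'a set \<Rightarrow> ('a \<Rightarrow> 'a) set" where
  "perms ev S = {p. p permutes S \<and> (ev \<longrightarrow> evenperm p)}"

lemma cubic_onD: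
  assumes "f \<in> cubic_on S"
  shows "f (f (f x)) = x" and "x \<notin> S \<Longrightarrow> f x = x"
  using assms by (auto simp: cubic_on_def)

lemma cubic_inj: "f \<in> cubic_on S \<Longrightarrow> f x = f y \<longleftrightarrow> x = y"
  by (metis cubic_onD(1))

lemma cubic_supp_subset: "f \<in> cubic_on S \<Longrightarrow> supp f \<subseteq> S"
  using cubic_onD(2) by (fastforce simp: supp_def)

lemma cubic_supp_closed: "f \<in> cubic_on S \<Longrightarrow> f x \<in> supp f \<longleftrightarrow> x \<in> supp f"
  by (simp add: supp_def cubic_inj)

lemma cubic_on_permutes:
  assumes "f \<in> cubic_on S"
  shows "f permutes S"
proof -
  have "\<exists>!x. f x = y" for y
    by (rule ex1I[of _ "f (f y)"]) (auto simp: cubic_onD[OF assms])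
  then show ?thesis
    using assms by (auto simp: permutes_def cubic_on_def)
qed

text \<open>f and its cube have the same sign, so an element of order 3 is even and lies in the
  alternating group as well.\<close>

lemma cubic_on_perms:
  assumes "f \<in> cubic_on S" "finite S"
  shows "f \<in> perms ev S"
proof -
  have p: "f permutes S" by (rule cubic_on_permutes[OF assms(1)])
  then have perm: "permutation f"
    using assms(2) permutation_permutes by blast
  have "f \<circ> f \<circ> f = id"
    using cubic_onD(1)[OF assms(1)] by (auto simp: fun_eq_iff)
  then have "evenperm (f \<circ> f \<circ> f)" by simp
  then have "evenperm f"
    using perm by (simp add: evenperm_comp permutation_compose)
  then show ?thesis
    using p by (simp add: perms_def)
qed

lemma permutes_cubic_on:
  assumes "f permutes S" "\<And>x. f (f (f x)) = x"
  shows "f \<in> cubic_on S"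
  using assms by (auto simp: cubic_on_def permutes_def)

text \<open>In the coordinates (i, j), with i naming an orbit and j a power of f, applying f only
  adds 1 to j modulo 3; matching coordinates is how conjugating maps are built.\<close>

lemma cubic_orbits:
  assumes f: "f \<in> cubic_on S" and "finite T" "T \<subseteq> supp f" "\<And>x. x \<in> T \<Longrightarrow> f x \<in> T"
  shows "\<exists>m r. bij_betw (\<lambda>(i, j). (f ^^ j) (r i)) ({..<m::nat} \<times> {..<3::nat}) T"
  using assms(2-)
proof (induction T rule: finite_psubset_induct)
  case (psubset T)
  show ?case
  proof (cases "T = {}")
    case True
    then show ?thesis by (intro exI[of _ 0]) (auto simp: bij_betw_def)
  next
    case False
    then obtain x where x: "x \<in> T" by blast
    let ?O = "{x, f x, f (f x)}"
    have ne: "f x \<noteq> x" "f (f x) \<noteq> f x" "f (f x) \<noteq> x"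
      using x psubset.prems(1) cubic_onD(1)[OF f, of x] by (auto simp: supp_def cubic_inj[OF f])
    have O: "?O \<subseteq> T" using x psubset.prems(2) by blast
    have cl: "f y \<in> T - ?O" if "y \<in> T - ?O" for y
      using that psubset.prems(2) cubic_onD(1)[OF f, of y] cubic_onD(1)[OF f, of x]
        cubic_inj[OF f] by (metis Diff_iff empty_iff insert_iff)
    have "T - ?O \<subset> T" using x by blast
    moreover have "T - ?O \<subseteq> supp f" using psubset.prems(1) by blast
    ultimately obtain m r where mr:
      "bij_betw (\<lambda>(i, j). (f ^^ j) (r i)) ({..<m::nat} \<times> {..<3::nat}) (T - ?O)"
      using psubset.IH[of "T - ?O"] cl by blast
    \<comment> \<open>Index m is outside the range enumerated so far, so the old orbits keep their
      representatives.\<close>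
    define r' where "r' = r(m := x)"
    have "bij_betw (\<lambda>(i, j). (f ^^ j) (r' i)) ({..<m} \<times> {..<3}) (T - ?O)"
      using mr by (subst bij_betw_cong[of _ _ "\<lambda>(i, j). (f ^^ j) (r i)"]) (auto simp: r'_def)
    moreover have three: "{..<3::nat} = {0, 1, 2}" by auto
    have "bij_betw (\<lambda>(i, j). (f ^^ j) (r' i)) ({m} \<times> {..<3}) ?O"
      unfolding three using ne by (auto simp: bij_betw_def r'_def inj_on_def numeral_2_eq_2)
    ultimately have "bij_betw (\<lambda>(i, j). (f ^^ j) (r' i))
        ({..<m} \<times> {..<3} \<union> {m} \<times> {..<3}) ((T - ?O) \<union> ?O)"
      by (rule bij_betw_combine) blast
    moreover have "{..<m} \<times> {..<3::nat} \<union> {m} \<times> {..<3} = {..<Suc m} \<times> {..<3}"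
      by (auto simp: less_Suc_eq)
    moreover have "(T - ?O) \<union> ?O = T" using O by blast
    ultimately show ?thesis by metis
  qed
qed

lemma cubic_enum:
  assumes "f \<in> cubic_on S" "finite S"
  obtains m r where "bij_betw (\<lambda>(i, j). (f ^^ j) (r i)) ({..<m::nat} \<times> {..<3::nat}) (supp f)"
    and "card (supp f) = 3 * m"
proof -
  have fin: "finite (supp f)"
    using assms cubic_supp_subset finite_subset by metis
  obtain m r where
    b: "bij_betw (\<lambda>(i, j). (f ^^ j) (r i)) ({..<m::nat} \<times> {..<3::nat}) (supp f)"
    using cubic_orbits[OF assms(1) fin order_refl] cubic_supp_closed[OF assms(1)] by blast
  moreover have "card (supp f) = 3 * m"
    using bij_betw_same_card[OF b] by (simp add: card_cartesian_product)
  ultimately show thesis using that by blast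
qed

lemma cubic_pow_step:
  assumes "f \<in> cubic_on S" "j < 3"
  shows "f ((f ^^ j) x) = (f ^^ (Suc j mod 3)) x"
proof -
  have "j = 0 \<or> j = 1 \<or> j = 2" using assms(2) by auto
  then show ?thesis
    using cubic_onD(1)[OF assms(1)] by (auto simp: numeral_2_eq_2)
qed

text \<open>Supports of equal size contain equally many 3-cycles. Matching the orbit coordinates
  intertwines f and g on the supports, and any bijection of the fixed points inside S completes the
  conjugator.\<close>

lemma cubic_conjugate:
  assumes f: "f \<in> cubic_on S" and g: "g \<in> cubic_on S" and fin: "finite S"
    and c: "card (supp f) = card (supp g)"
  obtains h where "h permutes S" "\<And>x. h (f x) = g (h x)"
proof -
  obtain m r where fe: "bij_betw (\<lambda>(i, j). (f ^^ j) (r i)) ({..<m::nat} \<times> {..<3::nat}) (supp f)"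
    and fm: "card (supp f) = 3 * m" using cubic_enum[OF f fin] by blast
  obtain m' s where ge: "bij_betw (\<lambda>(i, j). (g ^^ j) (s i)) ({..<m'::nat} \<times> {..<3::nat}) (supp g)"
    and gm: "card (supp g) = 3 * m'" using cubic_enum[OF g fin] by blast
  have [simp]: "m' = m" using c fm gm by simp
  define a where "a = (\<lambda>(i, j). (f ^^ j) (r i))"
  define b where "b = (\<lambda>(i, j). (g ^^ j) (s i))"
  define u where "u = b \<circ> inv_into ({..<m} \<times> {..<3}) a"
  have a: "bij_betw a ({..<m} \<times> {..<3}) (supp f)" using fe by (simp add: a_def)
  have b: "bij_betw b ({..<m} \<times> {..<3}) (supp g)" using ge by (simp add: b_def)
  have u: "bij_betw u (supp f) (supp g)"
    unfolding u_def using bij_betw_trans[OF bij_betw_inv_into[OF a] b] .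
  have ua: "u (a p) = b p" if "p \<in> {..<m} \<times> {..<3}" for p
    using a that by (simp add: u_def bij_betw_inv_into_left)
  have uf: "u (f x) = g (u x)" if "x \<in> supp f" for x
  proof -
    have "x \<in> a ` ({..<m} \<times> {..<3})" using that bij_betw_imp_surj_on[OF a] by simp
    then obtain i j where ij: "i < m" "j < 3" "x = a (i, j)" by blast
    have "f x = a (i, Suc j mod 3)"
      using ij cubic_pow_step[OF f] by (simp add: a_def)
    then have "u (f x) = b (i, Suc j mod 3)" using ua ij by simp
    also have "\<dots> = g (b (i, j))" using ij cubic_pow_step[OF g] by (simp add: b_def)
    finally show ?thesis using ua ij by simp
  qed
  have subs: "supp f \<subseteq> S" "supp g \<subseteq> S" using f g cubic_supp_subset by auto
  then have "card (S - supp f) = card (S - supp g)"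
    using c fin by (simp add: card_Diff_subset finite_subset)
  then obtain w where w: "bij_betw w (S - supp f) (S - supp g)"
    using finite_same_card_bij[of "S - supp f" "S - supp g"] fin by auto
  define h where "h x = (if x \<in> supp f then u x else if x \<in> S then w x else x)" for x
  have "bij_betw h (supp f) (supp g)"
    using u by (subst bij_betw_cong[of _ _ u]) (auto simp: h_def)
  moreover have "bij_betw h (S - supp f) (S - supp g)"
    using w by (subst bij_betw_cong[of _ _ w]) (auto simp: h_def)
  ultimately have "bij_betw h (supp f \<union> (S - supp f)) (supp g \<union> (S - supp g))"
    by (rule bij_betw_combine) blast
  then have "bij_betw h S S" using subs by (simp add: Un_absorb1)
  moreover have "h x = x" if "x \<notin> S" for x using that subs by (auto simp: h_def)
  ultimately have "h permutes S" using bij_imp_permutes by blast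
  moreover have "h (f x) = g (h x)" for x
  proof (cases "x \<in> supp f")
    case True
    then show ?thesis using uf cubic_supp_closed[OF f] by (simp add: h_def)
  next
    case False
    then have "f x = x" by (simp add: supp_def)
    moreover have "g (h x) = h x"
    proof (cases "x \<in> S")
      case True
      then have "w x \<in> S - supp g" using w False by (auto simp: bij_betw_def)
      then show ?thesis using True False by (simp add: h_def supp_def)
    next
      case False
      then show ?thesis using subs cubic_onD(2)[OF g] by (auto simp: h_def)
    qed
    ultimately show ?thesis by simp
  qed
  ultimately show thesis using that by blast
qed

text \<open>Two orbits of the same order-3 permutation can be exchanged by an odd permutation that
  commutes with it, so that the conjugating permutation may be chosen even.\<close>

lemma cubic_odd_centralizer:
  assumes f: "f \<in> cubic_on S" and fin: "finite S" and c: "card (supp f) \<ge> 6"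
  obtains t where "t permutes S" "\<not> evenperm t" "\<And>x. t (f x) = f (t x)"
proof -
  obtain m r where fe: "bij_betw (\<lambda>(i, j). (f ^^ j) (r i)) ({..<m::nat} \<times> {..<3::nat}) (supp f)"
    and fm: "card (supp f) = 3 * m" using cubic_enum[OF f fin] by blast
  have m: "0 < m" "1 < m" using c fm by auto
  have inj: "(f ^^ j) (r i) = (f ^^ j') (r i') \<longleftrightarrow> i = i' \<and> j = j'"
    if "i < m" "i' < m" "j < 3" "j' < 3" for i j i' j'
    using inj_on_eq_iff[OF bij_betw_imp_inj_on[OF fe], of "(i, j)" "(i', j')"] that by auto
  define a b where "a = r 0" and "b = r 1"
  have d: "distinct [a, f a, f (f a), b, f b, f (f b)]"
    using m inj[of 0 0 0 1] inj[of 0 0 0 2] inj[of 0 0 1 2] inj[of 1 1 0 1] inj[of 1 1 0 2] inj[of 1 1 1 2]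
      inj[of 0 1 0 0] inj[of 0 1 0 1] inj[of 0 1 0 2] inj[of 0 1 1 0] inj[of 0 1 1 1] inj[of 0 1 1 2]
      inj[of 0 1 2 0] inj[of 0 1 2 1] inj[of 0 1 2 2]
    by (simp add: a_def b_def numeral_2_eq_2)
  have "a \<in> supp f" "b \<in> supp f"
    using d by (auto simp: supp_def)
  then have S: "{a, f a, f (f a), b, f b, f (f b)} \<subseteq> S"
    using cubic_supp_subset[OF f] cubic_supp_closed[OF f] by auto
  \<comment> \<open>Swapping two orbits of length 3 takes three transpositions, an odd
    number.\<close>
  define t where "t = Transposition.transpose a b \<circ> Transposition.transpose (f a) (f b) \<circ>
    Transposition.transpose (f (f a)) (f (f b))"
  have perm: "t permutes S"
    unfolding t_def using S by (intro permutes_compose permutes_swap_id) auto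
  have odd: "\<not> evenperm t"
    unfolding t_def using d
    by (simp add: evenperm_comp evenperm_swap permutation_swap_id permutation_compose)
  have six: "(Transposition.transpose p q \<circ> Transposition.transpose p' q' \<circ>
      Transposition.transpose p'' q'') x =
      (if x = p then q else if x = q then p else if x = p' then q' else if x = q' then p'
       else if x = p'' then q'' else if x = q'' then p'' else x)"
    if "distinct [p, p', p'', q, q', q'']" for p p' p'' q q' q'' x :: 'a
    using that[simplified] by (elim conjE) (simp add: Transposition.transpose_def)
  have tv: "t a = b \<and> t b = a \<and> t (f a) = f b \<and> t (f b) = f a \<and> t (f (f a)) = f (f b) \<and>
      t (f (f b)) = f (f a)"
    using d[simplified] unfolding t_def six[OF d] by (elim conjE) simp
  have tx: "t x = x" if "x \<notin> {a, f a, f (f a), b, f b, f (f b)}" for x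
    using that by (simp add: t_def Transposition.transpose_def)
  have "t (f x) = f (t x)" for x
  proof (cases "x \<in> {a, f a, f (f a), b, f b, f (f b)}")
    case True
    then show ?thesis using tv cubic_onD(1)[OF f] by auto
  next
    case False
    have "f x \<notin> {a, f a, f (f a), b, f b, f (f b)}"
    proof
      assume "f x \<in> {a, f a, f (f a), b, f b, f (f b)}"
      then have "f (f (f x)) \<in> (\<lambda>y. f (f y)) ` {a, f a, f (f a), b, f b, f (f b)}" by blast
      then show False using False cubic_onD(1)[OF f] by simp
    qed
    then show ?thesis using False tx by simp
  qed
  with perm odd show thesis using that by blast
qed

text \<open>An odd conjugator is corrected by the odd element commuting with f. The bound 6 provides
  two orbits; in A_3 and A_4 a single 3-cycle is not conjugate to its inverse.\<close>

lemma cubic_conjugate_perms: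
  assumes f: "f \<in> cubic_on S" and g: "g \<in> cubic_on S" and fin: "finite S"
    and c: "card (supp f) = card (supp g)" and c6: "card (supp f) \<ge> 6"
  obtains h where "h \<in> perms ev S" "\<And>x. h (f x) = g (h x)"
proof -
  obtain h where h: "h permutes S" "\<And>x. h (f x) = g (h x)"
    using cubic_conjugate[OF f g fin c] by blast
  obtain t where t: "t permutes S" "\<not> evenperm t" "\<And>x. t (f x) = f (t x)"
    using cubic_odd_centralizer[OF f fin c6] by blast
  have "evenperm (h \<circ> t) \<longleftrightarrow> \<not> evenperm h"
    using h t fin permutes_imp_permutation by (metis evenperm_comp)
  moreover have "h \<circ> t permutes S" using h t permutes_compose by blast
  moreover have "(h \<circ> t) (f x) = g ((h \<circ> t) x)" for x using h t by simp
  ultimately show thesis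
    using that[of h] that[of "h \<circ> t"] h by (cases "evenperm h") (auto simp: perms_def)
qed

lemma ex_cubic_on:
  assumes "finite U" "card U = 3 * m"
  obtains f where "f \<in> cubic_on U" "supp f = U"
proof -
  have "card ({..<m} \<times> {..<3::nat}) = card U"
    using assms by (simp add: card_cartesian_product)
  then obtain e where e: "bij_betw e ({..<m} \<times> {..<3::nat}) U"
    using finite_same_card_bij[of "{..<m} \<times> {..<3::nat}" U] assms by auto
  define f where "f x = (if x \<in> U then (case inv_into ({..<m} \<times> {..<3}) e x of
      (i, j) \<Rightarrow> e (i, Suc j mod 3)) else x)" for x
  have fe: "f (e (i, j)) = e (i, Suc j mod 3)" if "i < m" "j < 3" for i j
    using that bij_betw_apply[OF e, of "(i, j)"] bij_betw_inv_into_left[OF e, of "(i, j)"]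
    by (simp add: f_def)
  have "f (f (f x)) = x \<and> f x \<noteq> x" if "x \<in> U" for x
  proof -
    obtain i j where ij: "i < m" "j < 3" "x = e (i, j)"
      using e \<open>x \<in> U\<close> by (auto simp: bij_betw_def)
    have j: "Suc (Suc (Suc j mod 3) mod 3) mod 3 = j" "Suc j mod 3 \<noteq> j"
      using ij(2) by presburger+
    have "e (i, Suc j mod 3) \<noteq> e (i, j)"
      using inj_on_eq_iff[OF bij_betw_imp_inj_on[OF e], of "(i, Suc j mod 3)" "(i, j)"] ij j(2)
      by simp
    then show ?thesis using ij j fe by simp
  qed
  then have in_U: "f (f (f x)) = x" "f x \<noteq> x" if "x \<in> U" for x
    using that by auto
  have out_U: "f x = x" if "x \<notin> U" for x using that by (simp add: f_def)
  have "f (f (f x)) = x" for x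
    by (cases "x \<in> U") (simp_all only: in_U out_U not_False_eq_True)
  then have "f \<in> cubic_on U"
    using out_U unfolding cubic_on_def by blast
  moreover have "supp f = U"
    using in_U(2) out_U unfolding supp_def by blast
  ultimately show thesis using that by blast
qed

text \<open>A length function counts, up to a bounded error, how many conjugates of \<open>s\<close> are needed to
  write \<open>f\<close>: orbits are split off in groups of \<open>b\<close>, and the remainder is a product of two
  conjugates \<open>x f\<inverse>\<close> and \<open>x\<inverse> f\<inverse>\<close> since \<open>f\<inverse> f\<inverse> = f\<close>.\<close>

lemma cubic_length_bound:
  fixes lam :: "('a \<Rightarrow> 'a) \<Rightarrow> real"
  assumes fin: "finite S"
    and sub: "\<And>x y. x \<in> perms ev S \<Longrightarrow> y \<in> perms ev S \<Longrightarrow> lam (x \<circ> y) \<le> lam x + lam y"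
    and conj: "\<And>x y h. x \<in> perms ev S \<Longrightarrow> y \<in> perms ev S \<Longrightarrow> h \<in> perms ev S \<Longrightarrow>
      (\<And>z. h (x z) = y (h z)) \<Longrightarrow> lam x = lam y"
    and s: "s \<in> cubic_on S" "card (supp s) = 3 * b" and b: "b \<ge> 2"
    and f: "f \<in> cubic_on S" "card (supp f) = 3 * a"
  shows "lam f \<le> (real (a div b) + 2) * lam s"
  using f
proof (induction a arbitrary: f rule: less_induct)
  case (less a)
  note f = less.prems(1)
  \<comment> \<open>Any two elements with b orbits are conjugate, so \<open>lam\<close> cannot tell
    them from s.\<close>
  have eq: "lam t = lam s" if t: "t \<in> cubic_on S" "card (supp t) = 3 * b" for t
  proof -
    have "card (supp t) \<ge> 6" using t(2) b by simp
    then obtain h where "h \<in> perms ev S" "\<And>x. h (t x) = s (h x)"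
      using cubic_conjugate_perms[OF t(1) s(1) fin] t(2) s(2) by metis
    then show ?thesis
      using conj cubic_on_perms fin s(1) t(1) by blast
  qed
  show ?case
  proof (cases "b \<le> a")
    case True
    obtain m r where fe: "bij_betw (\<lambda>(i, j). (f ^^ j) (r i)) ({..<m::nat} \<times> {..<3::nat}) (supp f)"
      and "card (supp f) = 3 * m" using cubic_enum[OF f fin] by blast
    then have ma: "m = a" using less.prems(2) by simp
    \<comment> \<open>A is the union of the first b orbits, so f splits into an element with b
      orbits, conjugate to s, and one with a - b orbits, left to the induction.\<close>
    define A where "A = (\<lambda>(i, j). (f ^^ j) (r i)) ` ({..<b} \<times> {..<3::nat})"
    have sub': "{..<b} \<times> {..<3::nat} \<subseteq> {..<m} \<times> {..<3}" using True ma by auto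
    then have A: "A \<subseteq> supp f"
      unfolding A_def bij_betw_imp_surj_on[OF fe, symmetric] by (rule image_mono)
    have cA: "card A = 3 * b"
      unfolding A_def using inj_on_subset[OF bij_betw_imp_inj_on[OF fe] sub']
      by (simp add: card_image card_cartesian_product)
    have fA: "f x \<in> A" if xA: "x \<in> A" for x
    proof -
      obtain i j where ij: "i < b" "j < 3" "x = (f ^^ j) (r i)" using xA by (auto simp: A_def)
      show ?thesis
        using ij cubic_pow_step[OF f] by (auto simp: A_def intro!: image_eqI[of _ _ "(i, Suc j mod 3)"])
    qed
    have fA': "f x \<in> A \<longleftrightarrow> x \<in> A" for x
      using fA cubic_onD(1)[OF f] by metis
    define g where "g x = (if x \<in> A then f x else x)" for x
    define h where "h x = (if x \<in> A then x else f x)" for x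
    have g: "g \<in> cubic_on S" and h: "h \<in> cubic_on S"
      using cubic_onD[OF f] by (auto simp: cubic_on_def g_def h_def fA')
    have "supp g = A" "supp h = supp f - A"
      using A by (auto simp: supp_def g_def h_def)
    moreover have "card (supp f - A) = 3 * (a - b)"
      using A less.prems(2) cA finite_subset[OF cubic_supp_subset[OF f] fin]
      by (simp add: card_Diff_subset finite_subset algebra_simps)
    ultimately have cards: "card (supp g) = 3 * b" "card (supp h) = 3 * (a - b)"
      using cA by auto
    have "f = g \<circ> h" by (auto simp: fun_eq_iff g_def h_def fA')
    then have "lam f \<le> lam g + lam h"
      using sub cubic_on_perms[OF g fin] cubic_on_perms[OF h fin] by metis
    also have "lam g = lam s" using eq g cards by blast
    also have "lam h \<le> (real ((a - b) div b) + 2) * lam s"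
      using less.IH[of "a - b" h] True b h cards by auto
    also have "(a - b) div b = a div b - 1" using True b by (simp add: le_div_geq)
    finally have "lam f \<le> lam s + (real (a div b - 1) + 2) * lam s" by simp
    moreover have "a div b \<ge> 1" using True b by (simp add: div_greater_zero_iff Suc_leI)
    ultimately show ?thesis by (simp add: algebra_simps of_nat_diff)
  next
    case False
    \<comment> \<open>s itself fits into S with b orbits, so b - a further orbits have room outside
      the support of f.\<close>
    have "card (S - supp f) = card S - 3 * a"
      using less.prems(2) cubic_supp_subset[OF f] fin by (simp add: card_Diff_subset finite_subset)
    moreover have "3 * b \<le> card S"
      using s cubic_supp_subset fin card_mono by metis
    ultimately have "3 * (b - a) \<le> card (S - supp f)" by (simp add: algebra_simps)
    then obtain U where U: "U \<subseteq> S - supp f" "card U = 3 * (b - a)" "finite U"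
      using obtain_subset_with_card_n by metis
    obtain x where x: "x \<in> cubic_on U" "supp x = U" using ex_cubic_on U by blast
    have xU: "x z \<in> U \<longleftrightarrow> z \<in> U" for z
      using cubic_supp_closed x by metis
    have fU: "f z \<in> U \<longleftrightarrow> z \<in> U" for z
    proof -
      have "z \<in> U \<Longrightarrow> f z = z" for z using U(1) by (auto simp: supp_def)
      then show ?thesis using cubic_inj[OF f] by metis
    qed
    have fix_f: "z \<in> U \<Longrightarrow> f z = z" for z using U(1) by (auto simp: supp_def)
    \<comment> \<open>On U these act as x and its inverse x^2; on the support of f both act as f^2,
      the inverse of f. Padding by U brings each up to exactly b orbits, and U cancels in the
      product.\<close>
    define g where "g z = (if z \<in> U then x z else f (f z))" for z
    define h where "h z = (if z \<in> U then x (x z) else f (f z))" for z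
    have g: "g \<in> cubic_on S" and h: "h \<in> cubic_on S"
      using cubic_onD[OF f] cubic_onD[OF x(1)] U(1)
      by (auto simp: cubic_on_def g_def h_def xU fU)
    have ff: "f (f z) = z \<longleftrightarrow> f z = z" for z
      by (metis cubic_onD(1)[OF f])
    have xx: "x (x z) = z \<longleftrightarrow> x z = z" for z
      by (metis cubic_onD(1)[OF x(1)])
    have "supp g = U \<union> supp f" "supp h = U \<union> supp f"
      using U(1) x(2) by (auto simp: supp_def g_def h_def ff xx)
    moreover have "card (U \<union> supp f) = 3 * b"
      using U less.prems(2) False finite_subset[OF cubic_supp_subset[OF f] fin]
      by (subst card_Un_disjoint) auto
    ultimately have "lam g = lam s" "lam h = lam s" using eq g h by auto
    moreover have "f = g \<circ> h"
      using cubic_onD(1)[OF f] cubic_onD(1)[OF x(1)]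
      by (auto simp: fun_eq_iff g_def h_def xU fU fix_f)
    then have "lam f \<le> lam g + lam h"
      using sub cubic_on_perms[OF g fin] cubic_on_perms[OF h fin] by metis
    ultimately show ?thesis using False by simp
  qed
qed

section \<open>Permutations of {1..n}, even or arbitrary\<close>

lemma perms_sym: "carrier (sym_group n) = perms False {1..n}"
  by (auto simp: perms_def sym_group_def)

lemma perms_alt: "carrier (alt_group n) = perms True {1..n}"
  by (auto simp: perms_def alt_group_def)

lemma perms_permutation: "p \<in> perms ev S \<Longrightarrow> finite S \<Longrightarrow> permutation p"
  by (auto simp: perms_def intro: permutes_imp_permutation)

lemma perms_id: "id \<in> perms ev S"
  by (simp add: perms_def permutes_id)

lemma perms_comp:
  assumes "p \<in> perms ev S" "q \<in> perms ev S" "finite S"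
  shows "p \<circ> q \<in> perms ev S"
  using assms perms_permutation[OF assms(1,3)] perms_permutation[OF assms(2,3)]
  by (auto simp: perms_def permutes_compose evenperm_comp)

lemma perms_inv:
  assumes "p \<in> perms ev S" "finite S"
  shows "inv' p \<in> perms ev S"
  using assms perms_permutation[OF assms]
  by (auto simp: perms_def permutes_inv evenperm_inv)

lemma perms_closed: "p \<in> perms ev S \<Longrightarrow> i \<in> S \<Longrightarrow> p i \<in> S"
  by (simp add: perms_def permutes_in_image)

lemma perms_supp: "p \<in> perms ev S \<Longrightarrow> supp p \<subseteq> S"
  unfolding perms_def supp_def using permutes_not_in by fastforce

lemma perms_fix: "p \<in> perms ev S \<Longrightarrow> i \<notin> S \<Longrightarrow> p i = i"
  unfolding perms_def using permutes_not_in by fastforce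


section \<open>Permutations acting by subintervals\<close>

text \<open>For x in [0, 1) this numbers the half-open subinterval of length 1/N containing x,
  starting from 1 because the permutations act on {1..N}.\<close>

definition cell :: "nat \<Rightarrow> real \<Rightarrow> nat" where
  "cell N x = nat \<lfloor>real N * x\<rfloor> + 1"

text \<open>The interval exchange that slides subinterval number i rigidly onto number p i. Being
  total on the reals, these maps have one type and one identity for all N, so groups of different
  levels can be compared as sets.\<close>

definition block_perm :: "nat \<Rightarrow> (nat \<Rightarrow> nat) \<Rightarrow> real \<Rightarrow> real" where
  "block_perm N p x = (if x \<in> {0..<1} then x + (real (p (cell N x)) - real (cell N x)) / real N else x)"

lemma cell_eq_iff:
  assumes "0 < N" "0 \<le> x"
  shows "cell N x = i \<longleftrightarrow> real i - 1 \<le> real N * x \<and> real N * x < real i"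
proof -
  have "0 \<le> real N * x" using assms by simp
  then have "0 \<le> \<lfloor>real N * x\<rfloor>" by simp
  then have "cell N x = i \<longleftrightarrow> \<lfloor>real N * x\<rfloor> = int i - 1"
    unfolding cell_def by linarith
  then show ?thesis by (auto simp: floor_eq_iff)
qed

lemma cell_bounds:
  assumes "0 < N" "0 \<le> x"
  shows "real (cell N x) - 1 \<le> real N * x" "real N * x < real (cell N x)"
  using cell_eq_iff[OF assms, of "cell N x"] by auto

lemma cell_range:
  assumes "0 < N" "x \<in> {0..<1}"
  shows "cell N x \<in> {1..N}"
proof -
  have "real N * x < real N" using assms by simp
  then have "real (cell N x) - 1 < real N"
    using cell_bounds[of N x] assms by (auto simp: intro: le_less_trans)
  then show ?thesis by (simp add: cell_def)
qed

lemma cell_left_end: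
  assumes "0 < N" "i \<in> {1..N}"
  shows "cell N ((real i - 1) / real N) = i" "(real i - 1) / real N \<in> {0..<1}"
  using assms by (auto simp: cell_eq_iff)

lemma block_perm_unit:
  assumes "0 < N" "x \<in> {0..<1}" and p: "\<And>i. i \<in> {1..N} \<Longrightarrow> p i \<in> {1..N}"
  shows "block_perm N p x \<in> {0..<1}" "cell N (block_perm N p x) = p (cell N x)"
proof -
  have r: "p (cell N x) \<in> {1..N}" using assms cell_range by blast
  have e: "real N * block_perm N p x = real N * x + real (p (cell N x)) - real (cell N x)"
    using assms by (simp add: block_perm_def distrib_left)
  have b: "real (p (cell N x)) - 1 \<le> real N * block_perm N p x"
       "real N * block_perm N p x < real (p (cell N x))"
    using cell_bounds[of N x] assms(1,2) unfolding e by auto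
  have "1 \<le> real (p (cell N x))" "real (p (cell N x)) \<le> real N" using r by simp_all
  then have nn: "0 \<le> real N * block_perm N p x" "real N * block_perm N p x < real N * 1"
    using b by linarith+
  then have bp: "0 \<le> block_perm N p x" "block_perm N p x < 1"
    using assms(1) by (simp_all add: zero_le_mult_iff mult_less_cancel_left)
  then show "block_perm N p x \<in> {0..<1}" by simp
  show "cell N (block_perm N p x) = p (cell N x)"
    using cell_eq_iff[OF assms(1) bp(1)] b by blast
qed

lemma block_perm_comp:
  assumes "0 < N" "\<And>i. i \<in> {1..N} \<Longrightarrow> p i \<in> {1..N}"
  shows "block_perm N (q \<circ> p) = block_perm N q \<circ> block_perm N p"
proof
  fix x
  show "block_perm N (q \<circ> p) x = (block_perm N q \<circ> block_perm N p) x"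
  proof (cases "x \<in> {0..<1}")
    case True
    have "block_perm N q (block_perm N p x) =
        block_perm N p x + (real (q (p (cell N x))) - real (p (cell N x))) / real N"
      using block_perm_unit[OF assms(1) True assms(2)] by (simp add: block_perm_def[of N q])
    then show ?thesis using True by (simp add: block_perm_def[of _ "q \<circ> p"] block_perm_def[of N p x] diff_divide_distrib)
  qed (auto simp: block_perm_def)
qed

lemma block_perm_id: "block_perm N id = id"
  by (auto simp: block_perm_def fun_eq_iff)

text \<open>Left endpoints of subintervals serve as sample points: the displacement there reveals p
  i.\<close>

lemma block_perm_inject:
  assumes "0 < N" "block_perm N p = block_perm N q" "i \<in> {1..N}"
  shows "p i = q i"
proof -
  have "block_perm N p ((real i - 1) / real N) = block_perm N q ((real i - 1) / real N)"
    using assms(2) by simp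
  then show ?thesis
    using cell_left_end[OF assms(1,3)] assms(1) by (simp add: block_perm_def)
qed

lemma block_perm_eq_iff:
  assumes "0 < N" "p \<in> perms ev {1..N}" "q \<in> perms ev' {1..N}"
  shows "block_perm N p = block_perm N q \<longleftrightarrow> p = q"
proof
  assume "block_perm N p = block_perm N q"
  then have "p i = q i" for i
    using block_perm_inject[OF assms(1)] perms_fix[OF assms(2)] perms_fix[OF assms(3)]
    by (cases "i \<in> {1..N}") auto
  then show "p = q" by blast
qed simp

lemma block_perm_comp_perms:
  assumes "0 < N" "p \<in> perms ev {1..N}"
  shows "block_perm N (q \<circ> p) = block_perm N q \<circ> block_perm N p"
  using block_perm_comp[OF assms(1)] perms_closed[OF assms(2)] by blast

section \<open>Block inclusions as refinements of the subdivision\<close>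

lemma block_inclusion_range:
  assumes "0 < N" "0 < r" and p: "\<And>i. i \<in> {1..N} \<Longrightarrow> p i \<in> {1..N}" and j: "j \<in> {1..N * r}"
  shows "block_inclusion N (N * r) p j \<in> {1..N * r}"
proof -
  let ?i = "(j - 1) div r + 1"
  have "(j - 1) div r < N" using j assms by (auto simp: less_mult_imp_div_less)
  then have "p ?i \<in> {1..N}" using p by simp
  then have "(p ?i - 1) * r + (j - 1) mod r < (p ?i - 1) * r + r" "p ?i - 1 + 1 \<le> N"
    using assms by auto
  then have "(p ?i - 1) * r + (j - 1) mod r < N * r"
    by (metis add.commute add_mult_distrib less_le_trans mult_le_mono1 nat_mult_1)
  then show ?thesis using assms j by (simp add: block_inclusion_def)
qed

text \<open>A block inclusion moves the r parts of a subinterval in parallel, which is the same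
  rigid motion of the whole; this turns the connecting maps into inclusions of sets of
  transformations.\<close>

lemma block_perm_refine:
  assumes "0 < N" "0 < r" and p: "\<And>i. i \<in> {1..N} \<Longrightarrow> p i \<in> {1..N}"
  shows "block_perm (N * r) (block_inclusion N (N * r) p) = block_perm N p"
proof
  fix x
  show "block_perm (N * r) (block_inclusion N (N * r) p) x = block_perm N p x"
  proof (cases "x \<in> {0..<1}")
    case True
    let ?j = "cell (N * r) x" and ?i = "cell N x"
    have j: "?j \<in> {1..N * r}" using cell_range[of "N * r" x] True assms by simp
    have "real (?j - 1) \<le> real (N * r) * x" "real (N * r) * x < real ?j"
      using cell_bounds[of "N * r" x] True assms j by auto
    moreover have "real r * (real ?i - 1) \<le> real r * (real N * x)" "real r * (real N * x) < real r * real ?i"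
      using cell_bounds[of N x] True assms by auto
    ultimately have "real (r * (?i - 1)) < real ?j" "real (?j - 1) < real (r * ?i)"
      by (simp_all add: cell_def algebra_simps)
    \<comment> \<open>With cells numbered from 1, the fine cell j lies in the coarse cell i exactly
      when (j - 1) div r = i - 1.\<close>
    then have "r * (?i - 1) \<le> ?j - 1" "?j - 1 < r * Suc (?i - 1)"
      unfolding of_nat_less_iff using cell_def by auto
    then have d: "(?j - 1) div r = ?i - 1"
      by (intro div_nat_eqI) (auto simp: mult.commute)
    have i: "?i \<in> {1..N}" using cell_range True assms by blast
    then have i1: "?i - 1 + 1 = ?i" by simp
    have pi: "p ?i \<ge> 1" using p[OF i] by simp
    have "block_inclusion N (N * r) p ?j = (p ?i - 1) * r + (?j - 1) mod r + 1"
      using j d i1 assms by (simp add: block_inclusion_def)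
    moreover have "?j = (?i - 1) * r + (?j - 1) mod r + 1"
      using div_mult_mod_eq[of "?j - 1" r] j unfolding d by simp
    then have "real ?j = real ((?i - 1) * r + (?j - 1) mod r + 1)" by (rule arg_cong)
    ultimately have "real (block_inclusion N (N * r) p ?j) - real ?j = (real (p ?i) - real ?i) * real r"
      using i pi by (simp add: of_nat_diff left_diff_distrib)
    then show ?thesis using True assms by (simp add: block_perm_def)
  qed (auto simp: block_perm_def)
qed

text \<open>Verified on [0, 1), where both sides give the same composite transformation; injectivity
  of the action brings the identity back to permutations without computing with div and mod.\<close>

lemma block_inclusion_comp:
  assumes "0 < N" "0 < r" and p: "p \<in> perms ev {1..N}" and q: "q \<in> perms ev' {1..N}"
  shows "block_inclusion N (N * r) (q \<circ> p) = block_inclusion N (N * r) q \<circ> block_inclusion N (N * r) p"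
proof
  fix j
  let ?B = "block_inclusion N (N * r)"
  note cl = perms_closed[OF p] perms_closed[OF q]
  show "?B (q \<circ> p) j = (?B q \<circ> ?B p) j"
  proof (cases "j \<in> {1..N * r}")
    case True
    have "block_perm (N * r) (?B (q \<circ> p)) = block_perm N (q \<circ> p)"
      using cl by (intro block_perm_refine[OF assms(1,2)]) (simp only: o_apply)
    also have "\<dots> = block_perm N q \<circ> block_perm N p"
      using block_perm_comp_perms assms(1) p by blast
    also have "\<dots> = block_perm (N * r) (?B q) \<circ> block_perm (N * r) (?B p)"
      using block_perm_refine[OF assms(1,2) cl(1)] block_perm_refine[OF assms(1,2) cl(2)] by simp
    also have "\<dots> = block_perm (N * r) (?B q \<circ> ?B p)"
      using block_perm_comp[of "N * r" "?B p"] block_inclusion_range[OF assms(1,2) cl(1)] assms(1,2)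
      by simp
    finally have eq: "block_perm (N * r) (?B (q \<circ> p)) = block_perm (N * r) (?B q \<circ> ?B p)" .
    show ?thesis
      by (rule block_perm_inject[OF _ eq True]) (use assms(1,2) in simp)
  next
    case False
    then show ?thesis unfolding block_inclusion_def o_apply by presburger
  qed
qed

lemma block_inclusion_id:
  assumes "0 < N" "0 < r"
  shows "block_inclusion N (N * r) id = id"
  using assms by (auto simp: block_inclusion_def fun_eq_iff)

text \<open>The block inclusion of the inverse permutation is a two-sided inverse.\<close>

lemma block_inclusion_permutes:
  assumes "0 < N" "0 < r" and p: "p \<in> perms ev {1..N}"
  shows "block_inclusion N (N * r) p permutes {1..N * r}"
proof (rule bij_imp_permutes)
  let ?B = "block_inclusion N (N * r)"
  have q: "inv' p \<in> perms ev {1..N}" using p perms_inv by blast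
  have pp: "p permutes {1..N}" using p by (simp add: perms_def)
  have "?B p \<circ> ?B (inv' p) = id" "?B (inv' p) \<circ> ?B p = id"
    using block_inclusion_comp[OF assms(1,2) p q] block_inclusion_comp[OF assms(1,2) q p]
      permutes_inv_o[OF pp] block_inclusion_id[OF assms(1,2)] by auto
  then show "bij_betw (?B p) {1..N * r} {1..N * r}"
    using block_inclusion_range[OF assms(1,2) perms_closed[OF p]]
      block_inclusion_range[OF assms(1,2) perms_closed[OF q]]
    by (intro bij_betw_byWitness[of _ "?B (inv' p)"]) (auto simp: fun_eq_iff)
qed (auto simp: block_inclusion_def)

lemma three_cycle_cubic: "p \<in> three_cycles N \<Longrightarrow> p \<in> cubic_on {1..N}"
proof -
  assume "p \<in> three_cycles N"
  then obtain cs where cs: "p = cycle_of_list cs" "cycle cs" "length cs = 3" "set cs \<subseteq> {1..N}"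
    by auto
  obtain a b c where abc: "cs = [a, b, c]" using stupid_lemma[OF cs(3)] by auto
  have d: "a \<noteq> b" "a \<noteq> c" "b \<noteq> c" using cs(2) abc by auto
  have "p x = (if x = a then b else if x = b then c else if x = c then a else x)" for x
    using d unfolding cs(1) abc by (simp add: Transposition.transpose_def)
  moreover have "a \<in> {1..N}" "b \<in> {1..N}" "c \<in> {1..N}" using cs(4) abc by auto
  ultimately show ?thesis using d by (auto simp: cubic_on_def)
qed

text \<open>The alternating group is generated by 3-cycles, whose images again cube to the identity
  and are therefore even; evenness then passes to inverses and products by the homomorphism
  property.\<close>

lemma block_inclusion_evenperm:
  assumes "0 < N" "0 < r" and p: "p \<in> perms True {1..N}"
  shows "evenperm (block_inclusion N (N * r) p)"
proof -
  let ?B = "block_inclusion N (N * r)"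
  have perm: "permutation (?B q)" if "q \<in> perms ev {1..N}" for q ev
    using block_inclusion_permutes[OF assms(1,2) that] permutes_imp_permutation by blast
  have cubic: "evenperm (?B q)" if "q \<in> cubic_on {1..N}" for q
  proof -
    have q: "q \<in> perms True {1..N}" using cubic_on_perms[OF that] by simp
    have "?B (q \<circ> (q \<circ> q)) = ?B q \<circ> (?B q \<circ> ?B q)"
      using block_inclusion_comp[OF assms(1,2) perms_comp[OF q q] q]
        block_inclusion_comp[OF assms(1,2) q q] by simp
    moreover have "q \<circ> (q \<circ> q) = id" using cubic_onD(1)[OF that] by auto
    ultimately have "evenperm (?B q \<circ> (?B q \<circ> ?B q))"
      using block_inclusion_id[OF assms(1,2)] by simp
    then show ?thesis using perm[OF q] by (simp add: evenperm_comp permutation_compose)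
  qed
  have "p \<in> generate (alt_group N) (three_cycles N)"
    using p perms_alt alt_group_carrier_as_three_cycles by blast
  then have "p \<in> perms True {1..N} \<and> evenperm (?B p)"
  proof (induction rule: generate.induct)
    case one
    show ?case
      unfolding alt_group_one block_inclusion_id[OF assms(1,2)] using perms_id evenperm_id by blast
  next
    case (incl h)
    then show ?case using three_cycle_cubic cubic cubic_on_perms by blast
  next
    case (inv h)
    then have h: "h \<in> cubic_on {1..N}" using three_cycle_cubic by blast
    then have h': "h \<in> perms True {1..N}" using cubic_on_perms by blast
    have e: "inv\<^bsub>alt_group N\<^esub> h = inv' h"
      using alt_group_inv_equality h' perms_alt by blast
    have "inv' h = h \<circ> h"
      using cubic_onD(1)[OF h] by (intro inv_equality) auto
    then have "evenperm (?B (inv' h)) = evenperm (?B h \<circ> ?B h)"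
      using block_inclusion_comp[OF assms(1,2) h' h'] by simp
    then show ?case unfolding e using h' perms_inv perm[OF h'] by (auto simp: evenperm_comp)
  next
    case (eng h1 h2)
    then have h: "h1 \<in> perms True {1..N}" "h2 \<in> perms True {1..N}"
      and ev: "evenperm (?B h1 \<circ> ?B h2)"
      using perm[of h1 True] perm[of h2 True] by (auto simp: evenperm_comp)
    then have "evenperm (?B (h1 \<circ> h2))"
      unfolding block_inclusion_comp[OF assms(1,2) h(2,1)] by blast
    then show ?case unfolding alt_group_mult using perms_comp[OF h] by blast
  qed
  then show ?thesis by blast
qed

lemma block_inclusion_perms:
  assumes "0 < N" "N dvd M" "0 < M" and p: "p \<in> perms ev {1..N}"
  shows "block_inclusion N M p \<in> perms ev {1..M}"
    and "block_perm M (block_inclusion N M p) = block_perm N p"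
proof -
  obtain r where r: "M = N * r" "0 < r" using assms by (auto elim!: dvdE)
  have "ev \<Longrightarrow> p \<in> perms True {1..N}" using p by (cases ev) auto
  then show "block_inclusion N M p \<in> perms ev {1..M}"
    using block_inclusion_permutes[OF assms(1) r(2) p] block_inclusion_evenperm[OF assms(1) r(2)]
    unfolding r by (auto simp: perms_def)
  show "block_perm M (block_inclusion N M p) = block_perm N p"
    using block_perm_refine[OF assms(1) r(2) perms_closed[OF p]] r by simp
qed

section \<open>The inductive limits as groups of interval exchanges\<close>

definition cell_group :: "bool \<Rightarrow> (nat \<Rightarrow> nat) \<Rightarrow> (real \<Rightarrow> real) monoid" where
  "cell_group ev k = \<lparr>carrier = (\<Union>n. block_perm (k n) ` perms ev {1..k n}), mult = (\<circ>), one = id\<rparr>"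

lemma transport_Suc: "n \<le> m \<Longrightarrow> transport f n (Suc m) g = f m (transport f n m g)"
  by (simp add: transport_def)

text \<open>When the terms act faithfully and compatibly with the connecting maps, eventual equality
  of representatives means equality of the transformations. The classes are thus the fibres of the
  action, and the limit is the union of the images.\<close>

lemma inductive_limit_iso:
  fixes G :: "nat \<Rightarrow> ('a, 'm) monoid_scheme" and e :: "nat \<Rightarrow> 'a \<Rightarrow> 'b \<Rightarrow> 'b"
  assumes f: "\<And>n g. g \<in> carrier (G n) \<Longrightarrow> f n g \<in> carrier (G (Suc n))"
    and ef: "\<And>n g. g \<in> carrier (G n) \<Longrightarrow> e (Suc n) (f n g) = e n g"
    and inj: "\<And>n g h. g \<in> carrier (G n) \<Longrightarrow> h \<in> carrier (G n) \<Longrightarrow> e n g = e n h \<Longrightarrow> g = h"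
    and closed: "\<And>n g h. g \<in> carrier (G n) \<Longrightarrow> h \<in> carrier (G n) \<Longrightarrow> g \<otimes>\<^bsub>G n\<^esub> h \<in> carrier (G n)"
    and mult: "\<And>n g h. g \<in> carrier (G n) \<Longrightarrow> h \<in> carrier (G n) \<Longrightarrow> e n (g \<otimes>\<^bsub>G n\<^esub> h) = e n g \<circ> e n h"
  shows "\<lparr>carrier = (\<Union>n. e n ` carrier (G n)), mult = (\<circ>), one = id\<rparr> \<cong> inductive_limit G f"
proof -
  have tr: "transport f n m g \<in> carrier (G m) \<and> e m (transport f n m g) = e n g"
    if "n \<le> m" "g \<in> carrier (G n)" for n m g
    using that(1)
  proof (induction rule: dec_induct)
    case base
    then show ?case using that by (simp add: transport_def)
  next
    case (step m)
    then show ?case using f ef by (simp add: transport_Suc)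
  qed
  have rel: "((n, g), (m, h)) \<in> limit_rel G f \<longleftrightarrow>
      g \<in> carrier (G n) \<and> h \<in> carrier (G m) \<and> e n g = e m h" for n g m h
  proof
    assume "((n, g), (m, h)) \<in> limit_rel G f"
    then obtain l where "g \<in> carrier (G n)" "h \<in> carrier (G m)" "l \<ge> max n m"
      "transport f n l g = transport f m l h" by (auto simp: limit_rel_def)
    then show "g \<in> carrier (G n) \<and> h \<in> carrier (G m) \<and> e n g = e m h"
      using tr[of n l g] tr[of m l h] by auto
  next
    assume a: "g \<in> carrier (G n) \<and> h \<in> carrier (G m) \<and> e n g = e m h"
    then have "transport f n (max n m) g = transport f m (max n m) h"
      using tr[of n "max n m" g] tr[of m "max n m" h] inj by auto
    then show "((n, g), (m, h)) \<in> limit_rel G f"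
      using a unfolding limit_rel_def by blast
  qed
  \<comment> \<open>All pairs acting as x; this is one equivalence class when such a pair
    exists.\<close>
  define F where "F x = {(n, g). g \<in> carrier (G n) \<and> e n g = x}" for x
  let ?C = "\<Union>n. e n ` carrier (G n)"
  have cls: "limit_rel G f `` {(n, g)} = F (e n g)" if "g \<in> carrier (G n)" for n g
    using that by (auto simp: F_def rel)
  have "carrier (inductive_limit G f) =
      (\<Union>p \<in> (SIGMA n:UNIV. carrier (G n)). {limit_rel G f `` {p}})"
    by (simp add: inductive_limit_def quotient_def)
  also have "\<dots> = (\<Union>p \<in> (SIGMA n:UNIV. carrier (G n)). {F (e (fst p) (snd p))})"
  proof (intro SUP_cong refl)
    fix p assume "p \<in> (SIGMA n:UNIV. carrier (G n))"
    then show "{limit_rel G f `` {p}} = {F (e (fst p) (snd p))}"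
      using cls[of "snd p" "fst p"] by (cases p) simp
  qed
  also have "\<dots> = F ` ?C" by (force simp: image_iff)
  finally have carr: "carrier (inductive_limit G f) = F ` ?C" .
  have "inj_on F ?C"
  proof (rule inj_onI)
    fix x y assume "x \<in> ?C" "y \<in> ?C" and eq: "F x = F y"
    then obtain n g where "g \<in> carrier (G n)" "x = e n g" by blast
    then have "(n, g) \<in> F x" by (simp add: F_def)
    then have "(n, g) \<in> F y" using eq by simp
    then show "x = y" using \<open>x = e n g\<close> by (simp add: F_def)
  qed
  then have "bij_betw F ?C (carrier (inductive_limit G f))"
    unfolding carr by (rule inj_on_imp_bij_betw)
  moreover have "F (x \<circ> y) = F x \<otimes>\<^bsub>inductive_limit G f\<^esub> F y" if xy: "x \<in> ?C" "y \<in> ?C" for x y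
  proof -
    have *: "limit_rel G f `` {(max n m, transport f n (max n m) g \<otimes>\<^bsub>G (max n m)\<^esub> transport f m (max n m) h)}
        = F (x \<circ> y)" if "(n, g) \<in> F x" "(m, h) \<in> F y" for n g m h
      using that tr[of n "max n m" g] tr[of m "max n m" h] closed mult by (simp add: F_def cls)
    \<comment> \<open>The product in the limit is a union over all representatives. Each contributes
      the same class, and nonemptiness lets the constant union collapse.\<close>
    have "F x \<noteq> {}" "F y \<noteq> {}" using xy by (auto simp: F_def)
    have "(\<Union>(n, g)\<in>F x. \<Union>(m, h)\<in>F y. limit_rel G f `` {(max n m,
        transport f n (max n m) g \<otimes>\<^bsub>G (max n m)\<^esub> transport f m (max n m) h)}) =
        (\<Union>p\<in>F x. \<Union>q\<in>F y. F (x \<circ> y))"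
    proof (intro SUP_cong refl)
      fix p assume p: "p \<in> F x"
      show "(case p of (n, g) \<Rightarrow> \<Union>(m, h)\<in>F y. limit_rel G f `` {(max n m,
          transport f n (max n m) g \<otimes>\<^bsub>G (max n m)\<^esub> transport f m (max n m) h)}) =
          (\<Union>q\<in>F y. F (x \<circ> y))"
        unfolding case_prod_beta
      proof (intro SUP_cong refl)
        fix q assume "q \<in> F y"
        then show "limit_rel G f `` {(max (fst p) (fst q),
            transport f (fst p) (max (fst p) (fst q)) (snd p) \<otimes>\<^bsub>G (max (fst p) (fst q))\<^esub>
            transport f (fst q) (max (fst p) (fst q)) (snd q))} = F (x \<circ> y)"
          using *[of "fst p" "snd p" "fst q" "snd q"] p by simp
      qed
    qed
    also have "\<dots> = F (x \<circ> y)" using \<open>F x \<noteq> {}\<close> \<open>F y \<noteq> {}\<close> by simp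
    finally have "(\<Union>(n, g)\<in>F x. \<Union>(m, h)\<in>F y. limit_rel G f `` {(max n m,
        transport f n (max n m) g \<otimes>\<^bsub>G (max n m)\<^esub> transport f m (max n m) h)}) = F (x \<circ> y)" .
    then show ?thesis by (simp add: inductive_limit_def)
  qed
  moreover have "F x \<in> carrier (inductive_limit G f)" if "x \<in> ?C" for x
    using that carr by blast
  ultimately have "F \<in> iso \<lparr>carrier = ?C, mult = (\<circ>), one = id\<rparr> (inductive_limit G f)"
    by (auto simp: iso_def hom_def)
  then show ?thesis by (auto simp: is_iso_def)
qed

lemma cell_group_iso_limits:
  assumes "divisibility_chain k"
  shows "cell_group False k \<cong> sym_limit k" "cell_group True k \<cong> alt_limit k"
proof -
  note pos = divisibility_chain_pos[OF assms]
  have dvd: "k n dvd k (Suc n)" for n using assms by (simp add: divisibility_chain_def)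
  show "cell_group False k \<cong> sym_limit k"
    unfolding cell_group_def sym_limit_def perms_sym[symmetric]
  proof (rule inductive_limit_iso, goal_cases)
    case (1 n g) then show ?case using block_inclusion_perms(1)[OF pos dvd pos] by (simp add: perms_sym)
  next
    case (2 n g) then show ?case using block_inclusion_perms(2)[OF pos dvd pos] by (simp add: perms_sym)
  next
    case (3 n g h) then show ?case using block_perm_eq_iff[OF pos] by (auto simp: perms_sym)
  next
    case (4 n g h) then show ?case by (simp add: perms_sym sym_group_mult perms_comp)
  next
    case (5 n g h) then show ?case using block_perm_comp_perms[OF pos] by (simp add: perms_sym sym_group_mult)
  qed
  show "cell_group True k \<cong> alt_limit k"
    unfolding cell_group_def alt_limit_def perms_alt[symmetric]
  proof (rule inductive_limit_iso, goal_cases)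
    case (1 n g) then show ?case using block_inclusion_perms(1)[OF pos dvd pos] by (simp add: perms_alt)
  next
    case (2 n g) then show ?case using block_inclusion_perms(2)[OF pos dvd pos] by (simp add: perms_alt)
  next
    case (3 n g h) then show ?case using block_perm_eq_iff[OF pos] by (auto simp: perms_alt)
  next
    case (4 n g h) then show ?case by (simp add: perms_alt alt_group_mult perms_comp)
  next
    case (5 n g h) then show ?case using block_perm_comp_perms[OF pos] by (simp add: perms_alt alt_group_mult)
  qed
qed

lemma block_perm_image_mono:
  assumes "0 < N" "N dvd M" "0 < M"
  shows "block_perm N ` perms ev {1..N} \<subseteq> block_perm M ` perms ev {1..M}"
  using block_inclusion_perms[OF assms] by (metis image_eqI image_subsetI)

text \<open>Serves to place finitely many elements at one common level, where they can be compared
  as permutations.\<close>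

lemma cell_group_level:
  assumes "divisibility_chain k" "g \<in> carrier (cell_group ev k)"
  obtains n where "\<And>m. n \<le> m \<Longrightarrow> g \<in> block_perm (k m) ` perms ev {1..k m}"
proof -
  obtain n where "g \<in> block_perm (k n) ` perms ev {1..k n}"
    using assms(2) by (auto simp: cell_group_def)
  moreover have "block_perm (k n) ` perms ev {1..k n} \<subseteq> block_perm (k m) ` perms ev {1..k m}"
    if "n \<le> m" for m
    by (intro block_perm_image_mono divisibility_chain_pos divisibility_chain_dvd assms(1) that)
  ultimately show thesis using that by blast
qed

lemma cell_group_simps [simp]:
  "g \<otimes>\<^bsub>cell_group ev k\<^esub> h = g \<circ> h" "\<one>\<^bsub>cell_group ev k\<^esub> = id"
  by (simp_all add: cell_group_def)

lemma cell_groupI: "p \<in> perms ev {1..k n} \<Longrightarrow> block_perm (k n) p \<in> carrier (cell_group ev k)"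
  by (auto simp: cell_group_def)

lemma cell_group_group:
  assumes k: "divisibility_chain k"
  shows "group (cell_group ev k)"
proof (rule groupI)
  note pos = divisibility_chain_pos[OF k]
  fix x y assume x: "x \<in> carrier (cell_group ev k)" and y: "y \<in> carrier (cell_group ev k)"
  obtain n where n: "\<And>m. n \<le> m \<Longrightarrow> x \<in> block_perm (k m) ` perms ev {1..k m}"
    using cell_group_level[OF k x] by blast
  obtain n' where n': "\<And>m. n' \<le> m \<Longrightarrow> y \<in> block_perm (k m) ` perms ev {1..k m}"
    using cell_group_level[OF k y] by blast
  obtain p q where p: "p \<in> perms ev {1..k (max n n')}" "x = block_perm (k (max n n')) p"
    and q: "q \<in> perms ev {1..k (max n n')}" "y = block_perm (k (max n n')) q"
    using n[of "max n n'"] n'[of "max n n'"] by auto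
  show "x \<otimes>\<^bsub>cell_group ev k\<^esub> y \<in> carrier (cell_group ev k)"
    using cell_groupI[of "p \<circ> q" ev k "max n n'", OF perms_comp[OF p(1) q(1) finite_atLeastAtMost]] block_perm_comp_perms[OF pos q(1), of p]
    unfolding p(2) q(2) by simp
  have "inv' p \<in> perms ev {1..k (max n n')}" using p perms_inv by blast
  moreover have "inv' p \<circ> p = id"
    using p(1) permutes_inv_o(2) by (auto simp: perms_def)
  ultimately show "\<exists>y\<in>carrier (cell_group ev k). y \<otimes>\<^bsub>cell_group ev k\<^esub> x = \<one>\<^bsub>cell_group ev k\<^esub>"
    using cell_groupI[of "inv' p" ev k "max n n'"] block_perm_comp_perms[OF pos p(1), of "inv' p"] p(2)
    by (auto simp: block_perm_id intro!: bexI[of _ "block_perm (k (max n n')) (inv' p)"])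
next
  have "block_perm (k 0) id \<in> carrier (cell_group ev k)"
    by (rule cell_groupI) (rule perms_id)
  then show "\<one>\<^bsub>cell_group ev k\<^esub> \<in> carrier (cell_group ev k)"
    by (simp add: block_perm_id)
qed (simp_all add: comp_assoc)

lemma cell_group_mono:
  assumes "divisibility_chain k" "divisibility_chain l" "\<And>n. \<exists>m. k n dvd l m"
  shows "carrier (cell_group ev k) \<subseteq> carrier (cell_group ev l)"
proof
  fix g assume "g \<in> carrier (cell_group ev k)"
  then obtain n where "g \<in> block_perm (k n) ` perms ev {1..k n}" by (auto simp: cell_group_def)
  moreover obtain m where "k n dvd l m" using assms(3) by blast
  ultimately have "g \<in> block_perm (l m) ` perms ev {1..l m}"
    using block_perm_image_mono[OF divisibility_chain_pos[OF assms(1)] _ divisibility_chain_pos[OF assms(2)]]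
    by blast
  then show "g \<in> carrier (cell_group ev l)" by (auto simp: cell_group_def)
qed


section \<open>The measure of the support\<close>

definition len :: "(real \<Rightarrow> real) \<Rightarrow> real" where
  "len g = measure lborel (supp g)"

lemma supp_block_perm:
  assumes "0 < N" "p \<in> perms ev {1..N}"
  shows "supp (block_perm N p) = (\<Union>i\<in>supp p. {(real i - 1) / real N ..< real i / real N})"
proof -
  have "x \<in> supp (block_perm N p) \<longleftrightarrow>
    x \<in> (\<Union>i\<in>supp p. {(real i - 1) / real N ..< real i / real N})" for x
  proof -
    have "x \<in> {(real i - 1) / real N ..< real i / real N} \<longleftrightarrow> x \<in> {0..<1} \<and> cell N x = i"
      if "i \<in> {1..N}" for i
    proof -
      have "x \<in> {(real i - 1) / real N ..< real i / real N} \<longleftrightarrow>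
          real i - 1 \<le> real N * x \<and> real N * x < real i"
        using assms(1) by (auto simp: field_simps)
      moreover have unit: "0 \<le> x \<and> x < 1" if "real i - 1 \<le> real N * x" "real N * x < real i"
      proof -
        have "1 \<le> real i" "real i \<le> real N" using \<open>i \<in> {1..N}\<close> by simp_all
        then have "0 \<le> real N * x" "real N * x < real N * 1" using that by linarith+
        then show ?thesis
          using assms(1) mult_less_cancel_left_pos[of "real N" x 1] by (simp add: zero_le_mult_iff)
      qed
      ultimately show ?thesis using cell_eq_iff[OF assms(1)] by (metis atLeastLessThan_iff)
    qed
    moreover have "supp p \<subseteq> {1..N}" using perms_supp[OF assms(2)] .
    ultimately have "x \<in> (\<Union>i\<in>supp p. {(real i - 1) / real N ..< real i / real N}) \<longleftrightarrow>
        x \<in> {0..<1} \<and> cell N x \<in> supp p" by blast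
    also have "\<dots> \<longleftrightarrow> x \<in> supp (block_perm N p)"
      using assms(1) by (auto simp: supp_def block_perm_def)
    finally show ?thesis by blast
  qed
  then show ?thesis by blast
qed

text \<open>This is the normalized Hamming length of p. Being a measure, it does not depend on the
  level at which an element is represented.\<close>

lemma len_block_perm:
  assumes "0 < N" "p \<in> perms ev {1..N}"
  shows "len (block_perm N p) = real (card (supp p)) / real N" "supp (block_perm N p) \<in> fmeasurable lborel"
proof -
  let ?I = "\<lambda>i. {(real i - 1) / real N ..< real i / real N}"
  have fin: "finite (supp p)"
    using perms_supp[OF assms(2)] finite_subset by blast
  have disj: "disjoint_family_on ?I (supp p)"
  proof (unfold disjoint_family_on_def, intro ballI impI)
    fix i j :: nat assume "i \<noteq> j"
    then have "real i + 1 \<le> real j \<or> real j + 1 \<le> real i" by linarith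
    then show "?I i \<inter> ?I j = {}"
    proof
      assume "real i + 1 \<le> real j"
      then have "real i / real N \<le> (real j - 1) / real N" by (intro divide_right_mono) auto
      then show ?thesis by auto
    next
      assume "real j + 1 \<le> real i"
      then have "real j / real N \<le> (real i - 1) / real N" by (intro divide_right_mono) auto
      then show ?thesis by auto
    qed
  qed
  have m: "?I i \<in> fmeasurable lborel" for i
    by (intro fmeasurableI) (auto simp: divide_right_mono)
  have "measure lborel (\<Union>i\<in>supp p. ?I i) = (\<Sum>i\<in>supp p. measure lborel (?I i))"
    using fin disj m by (intro measure_UNION') (auto simp: disjoint_family_on_def pairwise_def disjnt_def)
  also have "\<dots> = (\<Sum>i\<in>supp p. 1 / real N)"
    by (intro sum.cong) (auto simp: divide_right_mono diff_divide_distrib)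
  finally show "len (block_perm N p) = real (card (supp p)) / real N"
    by (simp add: len_def supp_block_perm[OF assms])
  show "supp (block_perm N p) \<in> fmeasurable lborel"
    unfolding supp_block_perm[OF assms] using fin m by (intro fmeasurable.finite_UN) auto
qed

lemma cell_group_supp_fmeasurable:
  assumes "divisibility_chain k" "g \<in> carrier (cell_group ev k)"
  shows "supp g \<in> fmeasurable lborel"
  using assms len_block_perm(2) divisibility_chain_pos by (auto simp: cell_group_def)

text \<open>A point moved by the composite is moved by one of the factors.\<close>

lemma len_comp:
  assumes "divisibility_chain k" "g \<in> carrier (cell_group ev k)" "h \<in> carrier (cell_group ev k)"
  shows "len (g \<circ> h) \<le> len g + len h"
proof -
  note m = cell_group_supp_fmeasurable[OF assms(1)]
  have "g \<circ> h \<in> carrier (cell_group ev k)"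
    using group.is_monoid[OF cell_group_group[OF assms(1)]] assms(2,3) monoid.m_closed by fastforce
  then have "len (g \<circ> h) \<le> measure lborel (supp g \<union> supp h)"
    unfolding len_def using m assms(2,3)
    by (intro measure_mono_fmeasurable fmeasurable.Un fmeasurableD[OF m] m) (auto simp: supp_def)
  also have "\<dots> \<le> len g + len h"
    unfolding len_def using m assms(2,3) by (intro measure_Un_le fmeasurableD[OF m]) auto
  finally show ?thesis .
qed

text \<open>At a common level the conjugator maps the moved points of one permutation bijectively
  onto those of the other. The relation \<open>h \<circ> g = g' \<circ> h\<close> spares the inverse
  of h.\<close>

lemma len_conj:
  assumes k: "divisibility_chain k" and g: "g \<in> carrier (cell_group ev k)" "g' \<in> carrier (cell_group ev k)"
    and h: "h \<in> carrier (cell_group ev k)" and eq: "h \<circ> g = g' \<circ> h"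
  shows "len g = len g'"
proof -
  obtain n1 where n1: "\<And>m. n1 \<le> m \<Longrightarrow> g \<in> block_perm (k m) ` perms ev {1..k m}"
    using cell_group_level[OF k g(1)] by blast
  obtain n2 where n2: "\<And>m. n2 \<le> m \<Longrightarrow> g' \<in> block_perm (k m) ` perms ev {1..k m}"
    using cell_group_level[OF k g(2)] by blast
  obtain n3 where n3: "\<And>m. n3 \<le> m \<Longrightarrow> h \<in> block_perm (k m) ` perms ev {1..k m}"
    using cell_group_level[OF k h] by blast
  define N where "N = k (max n1 (max n2 n3))"
  have N: "0 < N" using divisibility_chain_pos[OF k] by (simp add: N_def)
  obtain p where p: "p \<in> perms ev {1..N}" "g = block_perm N p" using n1[of "max n1 (max n2 n3)"] unfolding N_def[symmetric] by (auto simp: le_max_iff_disj)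
  obtain p' where p': "p' \<in> perms ev {1..N}" "g' = block_perm N p'" using n2[of "max n1 (max n2 n3)"] unfolding N_def[symmetric] by (auto simp: le_max_iff_disj)
  obtain q where q: "q \<in> perms ev {1..N}" "h = block_perm N q" using n3[of "max n1 (max n2 n3)"] unfolding N_def[symmetric] by (auto simp: le_max_iff_disj)
  have "block_perm N (q \<circ> p) = block_perm N (p' \<circ> q)"
    using eq block_perm_comp_perms[OF N] p p' q by metis
  then have "q \<circ> p = p' \<circ> q"
    using block_perm_eq_iff[OF N perms_comp[OF q(1) p(1)] perms_comp[OF p'(1) q(1)]] by simp
  then have qp: "q (p i) = p' (q i)" for i by (auto simp: fun_eq_iff)
  have "bij q" using q(1) permutes_bij by (auto simp: perms_def)
  have "q i \<in> supp p' \<longleftrightarrow> i \<in> supp p" for i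
    using bij_is_inj[OF \<open>bij q\<close>] by (simp add: supp_def qp[symmetric] inj_eq)
  then have "q ` supp p = supp p'"
    using surj_image_vimage_eq[OF bij_is_surj[OF \<open>bij q\<close>], of "supp p'"] by (simp add: vimage_def)
  then have "card (supp p) = card (supp p')"
    using \<open>bij q\<close> by (metis bij_is_inj card_image inj_on_subset subset_UNIV)
  then show ?thesis using len_block_perm(1)[OF N] p p' by metis
qed

section \<open>Lengths of elements of order 3\<close>

definition cubic_elts :: "bool \<Rightarrow> (nat \<Rightarrow> nat) \<Rightarrow> (real \<Rightarrow> real) set" where
  "cubic_elts ev k = {g \<in> carrier (cell_group ev k). g \<circ> g \<circ> g = id \<and> g \<noteq> id}"

lemma cubic_of_block_perm:
  assumes N: "0 < N" and p: "p \<in> perms ev {1..N}"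
    and g: "block_perm N p \<circ> block_perm N p \<circ> block_perm N p = id"
  shows "p \<in> cubic_on {1..N}"
proof -
  have "block_perm N (p \<circ> p \<circ> p) = block_perm N id"
    using g block_perm_comp_perms[OF N p, of p] block_perm_comp_perms[OF N p, of "p \<circ> p"]
    by (simp add: block_perm_id)
  moreover have "p \<circ> p \<circ> p \<in> perms ev {1..N}" using p perms_comp by blast
  ultimately have "p \<circ> p \<circ> p = id"
    using block_perm_eq_iff[OF N _ perms_id] by blast
  then show ?thesis
    using p by (intro permutes_cubic_on) (auto simp: perms_def fun_eq_iff)
qed

lemma len_ge_0: "0 \<le> len g"
  by (simp add: len_def)

lemma len_le_1:
  assumes "divisibility_chain k" "g \<in> carrier (cell_group ev k)"
  shows "len g \<le> 1"
proof -
  obtain n p where p: "p \<in> perms ev {1..k n}" "g = block_perm (k n) p"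
    using assms(2) by (auto simp: cell_group_def)
  have "card (supp p) \<le> card {1..k n}" using perms_supp[OF p(1)] by (intro card_mono) auto
  then show ?thesis
    using len_block_perm(1)[OF divisibility_chain_pos[OF assms(1)] p(1)] p(2)
      divisibility_chain_pos[OF assms(1), of n] by (simp add: divide_le_eq)
qed

text \<open>Each nontrivial orbit has three points, whence the factor 3; a = 0 would give the
  identity, which \<open>cubic_elts\<close> excludes.\<close>

lemma len_cubic_elts:
  assumes k: "divisibility_chain k" and g: "g \<in> cubic_elts ev k"
  obtains n a where "len g = real (3 * a) / real (k n)" "0 < a"
proof -
  obtain n p where p: "p \<in> perms ev {1..k n}" "g = block_perm (k n) p"
    using g by (auto simp: cell_group_def cubic_elts_def)
  note pos = divisibility_chain_pos[OF k, of n]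
  have "p \<in> cubic_on {1..k n}"
    using cubic_of_block_perm[OF pos p(1)] g p(2) by (simp add: cubic_elts_def)
  then obtain a where a: "card (supp p) = 3 * a" using cubic_enum by blast
  have "p \<noteq> id" using g p(2) by (auto simp: cubic_elts_def block_perm_id)
  then have "supp p \<noteq> {}" by (auto simp: supp_def fun_eq_iff)
  moreover have "finite (supp p)" using perms_supp[OF p(1)] finite_subset by blast
  ultimately have "0 < a" using a by (metis card_gt_0_iff nat_0_less_mult_iff)
  then show thesis using that a len_block_perm(1)[OF pos p(1)] p(2) by metis
qed

lemma len_cubic_elts_pos:
  assumes "divisibility_chain k" "g \<in> cubic_elts ev k"
  shows "0 < len g"
proof -
  obtain n a where "len g = real (3 * a) / real (k n)" "0 < a"
    using len_cubic_elts[OF assms] by blast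
  then show ?thesis using divisibility_chain_pos[OF assms(1), of n] by simp
qed

lemma ex_cubic_elt:
  assumes k: "divisibility_chain k" and a: "3 * a \<le> k n" "0 < a"
  obtains g where "g \<in> cubic_elts ev k" "len g = real (3 * a) / real (k n)"
proof -
  obtain f where f: "f \<in> cubic_on {1..3 * a}" "supp f = {1..3 * a}"
    using ex_cubic_on[of "{1..3 * a}" a] by auto
  then have f': "f \<in> cubic_on {1..k n}" using a by (auto simp: cubic_on_def)
  note pos = divisibility_chain_pos[OF k, of n]
  have fp: "f \<in> perms ev {1..k n}" using cubic_on_perms[OF f'] by blast
  let ?g = "block_perm (k n) f"
  have len: "len ?g = real (3 * a) / real (k n)" using len_block_perm(1)[OF pos fp] f(2) by simp
  have "f \<circ> f \<circ> f = id" using cubic_onD(1)[OF f'] by (auto simp: fun_eq_iff)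
  then have "?g \<circ> ?g \<circ> ?g = id"
    using block_perm_comp_perms[OF pos fp, of f] block_perm_comp_perms[OF pos fp, of "f \<circ> f"]
    by (simp add: block_perm_id)
  moreover have "?g \<noteq> id"
  proof
    assume "?g = id"
    then have "len ?g = 0" by (simp add: len_def supp_def)
    then show False using len a pos by simp
  qed
  ultimately show thesis using that len cell_groupI[of f ev k n, OF fp] by (simp add: cubic_elts_def)
qed

text \<open>\<open>lam\<close> stays abstract because it will be applied to the length of the image
  under an isomorphism. Everything happens at one finite level, deep enough for s to have at least
  two orbits.\<close>

lemma cell_group_length_bound:
  fixes lam :: "(real \<Rightarrow> real) \<Rightarrow> real"
  assumes k: "divisibility_chain k"
    and sub: "\<And>x y. x \<in> carrier (cell_group ev k) \<Longrightarrow> y \<in> carrier (cell_group ev k) \<Longrightarrow>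
      lam (x \<circ> y) \<le> lam x + lam y"
    and conj: "\<And>x y h. x \<in> carrier (cell_group ev k) \<Longrightarrow> y \<in> carrier (cell_group ev k) \<Longrightarrow>
      h \<in> carrier (cell_group ev k) \<Longrightarrow> h \<circ> x = y \<circ> h \<Longrightarrow> lam x = lam y"
    and g: "g \<in> cubic_elts ev k" and s: "s \<in> cubic_elts ev k" and nonneg: "0 \<le> lam s"
  shows "lam g \<le> (len g / len s + 2) * lam s"
proof -
  have gC: "g \<in> carrier (cell_group ev k)" and sC: "s \<in> carrier (cell_group ev k)"
    using g s by (auto simp: cubic_elts_def)
  obtain n1 where n1: "\<And>m. n1 \<le> m \<Longrightarrow> g \<in> block_perm (k m) ` perms ev {1..k m}"
    using cell_group_level[OF k gC] by blast
  obtain n2 where n2: "\<And>m. n2 \<le> m \<Longrightarrow> s \<in> block_perm (k m) ` perms ev {1..k m}"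
    using cell_group_level[OF k sC] by blast
  \<comment> \<open>Since n \<ge> 6 / \<open>len s\<close> and \<open>k n\<close> \<ge> n, the
    element s moves at least 6 cells at this level, so it has the two orbits that
    \<open>cubic_length_bound\<close> asks for.\<close>
  define n where "n = max (max n1 n2) (nat \<lceil>6 / len s\<rceil>)"
  define N where "N = k n"
  have N: "0 < N" using divisibility_chain_pos[OF k] by (simp add: N_def)
  have ls: "0 < len s" by (rule len_cubic_elts_pos[OF k s])
  have "6 / len s \<le> real n" by (simp add: n_def) linarith
  also have "\<dots> \<le> real N" using chain_unbounded[OF k] by (simp add: N_def)
  finally have Ns: "6 \<le> real N * len s" using ls by (simp add: divide_le_eq)
  obtain p where p: "p \<in> perms ev {1..N}" "g = block_perm N p"
    using n1[of n] unfolding N_def[symmetric] by (auto simp: n_def le_max_iff_disj)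
  obtain q where q: "q \<in> perms ev {1..N}" "s = block_perm N q"
    using n2[of n] unfolding N_def[symmetric] by (auto simp: n_def le_max_iff_disj)
  have pc: "p \<in> cubic_on {1..N}" and qc: "q \<in> cubic_on {1..N}"
    using cubic_of_block_perm[OF N] p q g s by (auto simp: cubic_elts_def)
  obtain a where a: "card (supp p) = 3 * a" using cubic_enum[OF pc] by blast
  obtain b where b: "card (supp q) = 3 * b" using cubic_enum[OF qc] by blast
  have lens: "len g = real (3 * a) / real N" "len s = real (3 * b) / real N"
    using len_block_perm(1)[OF N] p q a b by metis+
  then have "2 \<le> b" using Ns N by simp
  have cg: "block_perm N x \<in> carrier (cell_group ev k)" if "x \<in> perms ev {1..N}" for x
    using that by (auto simp: cell_group_def N_def)
  have "lam (block_perm N p) \<le> (real (a div b) + 2) * lam (block_perm N q)"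
  proof (rule cubic_length_bound[where lam = "\<lambda>x. lam (block_perm N x)" and ev = ev and S = "{1..N}"])
    fix x y assume x: "x \<in> perms ev {1..N}" and y: "y \<in> perms ev {1..N}"
    then show "lam (block_perm N (x \<circ> y)) \<le> lam (block_perm N x) + lam (block_perm N y)"
      using sub[OF cg cg] block_perm_comp_perms[OF N y] by simp
    fix h assume h: "h \<in> perms ev {1..N}" and eq: "\<And>z. h (x z) = y (h z)"
    then have "h \<circ> x = y \<circ> h" by auto
    then have "block_perm N h \<circ> block_perm N x = block_perm N y \<circ> block_perm N h"
      using block_perm_comp_perms[OF N x] block_perm_comp_perms[OF N h] by metis
    then show "lam (block_perm N x) = lam (block_perm N y)"
      using conj cg x y h by blast
  qed (use a b pc qc \<open>2 \<le> b\<close> in auto)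
  also have "\<dots> \<le> (len g / len s + 2) * lam (block_perm N q)"
  proof (rule mult_right_mono)
    have "real (a div b) \<le> real a / real b" by (rule of_nat_div_le_of_nat)
    then show "real (a div b) + 2 \<le> len g / len s + 2" using lens N by simp
  qed (use nonneg q in simp)
  finally show ?thesis using p q by simp
qed

text \<open>A limit passage in which the error \<epsilon> runs only through available values: later
  these are lengths of ever shorter elements.\<close>

lemma real_le_if_slack:
  fixes A B C :: real
  assumes "\<And>\<delta>. \<delta> > 0 \<Longrightarrow> \<exists>\<epsilon>. 0 < \<epsilon> \<and> \<epsilon> < \<delta> \<and> A \<le> B + C * \<epsilon>"
  shows "A \<le> B"
proof (rule field_le_epsilon)
  fix e :: real assume "e > 0"
  \<comment> \<open>Adding 1 keeps the divisor positive when C = 0.\<close>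
  then obtain \<epsilon> where e: "0 < \<epsilon>" "\<epsilon> < e / (\<bar>C\<bar> + 1)" "A \<le> B + C * \<epsilon>"
    using assms[of "e / (\<bar>C\<bar> + 1)"] by auto
  have "C * \<epsilon> \<le> (\<bar>C\<bar> + 1) * \<epsilon>" using e(1) by (intro mult_right_mono) auto
  also have "\<dots> \<le> e" using e(2) by (simp add: pos_less_divide_eq mult.commute less_imp_le)
  finally show "A \<le> B + e" using e(3) by linarith
qed

text \<open>A single 3-cycle at a deep level moves only 3 of the \<open>k n\<close> cells.\<close>

lemma small_cubic_elt:
  assumes k: "divisibility_chain k" and d: "0 < \<delta>"
  obtains g where "g \<in> cubic_elts ev k" "len g < \<delta>"
proof -
  define n where "n = max 3 (nat \<lceil>3 / \<delta>\<rceil> + 1)"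
  have "3 \<le> n" by (simp add: n_def)
  have "real (nat \<lceil>3 / \<delta>\<rceil> + 1) \<le> real n" unfolding n_def of_nat_le_iff by simp
  then have "3 / \<delta> < real n" using real_nat_ceiling_ge[of "3 / \<delta>"] by simp
  then have n: "3 * 1 \<le> k n" "3 / \<delta> < real (k n)" using \<open>3 \<le> n\<close> chain_unbounded[OF k, of n] by linarith+
  obtain g where "g \<in> cubic_elts ev k" "len g = real (3 * 1) / real (k n)"
    using ex_cubic_elt[OF k n(1)] by auto
  moreover have "3 / real (k n) < \<delta>" using n d by (simp add: field_simps)
  ultimately show thesis using that by simp
qed

text \<open>Packing \<open>k n div 3\<close> disjoint 3-cycles leaves at most two cells fixed, so
  the length is at least 1 - 2 / \<open>k n\<close>.\<close>

lemma large_cubic_elt: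
  assumes k: "divisibility_chain k" and d: "0 < \<delta>"
  obtains g where "g \<in> cubic_elts ev k" "1 - \<delta> < len g"
proof -
  define n where "n = max 3 (nat \<lceil>2 / \<delta>\<rceil> + 1)"
  have "3 \<le> n" by (simp add: n_def)
  have "real (nat \<lceil>2 / \<delta>\<rceil> + 1) \<le> real n" unfolding n_def of_nat_le_iff by simp
  then have "2 / \<delta> < real n" using real_nat_ceiling_ge[of "2 / \<delta>"] by simp
  then have n: "3 \<le> k n" "2 / \<delta> < real (k n)" using \<open>3 \<le> n\<close> chain_unbounded[OF k, of n] by linarith+
  define a where "a = k n div 3"
  have a: "3 * a \<le> k n" "k n \<le> 3 * a + 2" "0 < a" using n(1) by (auto simp: a_def)
  obtain g where g: "g \<in> cubic_elts ev k" "len g = real (3 * a) / real (k n)"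
    using ex_cubic_elt[OF k a(1,3)] by auto
  have "real (k n) - 2 \<le> real (3 * a)" using a(2) by linarith
  then have "(real (k n) - 2) / real (k n) \<le> len g"
    unfolding g(2) by (intro divide_right_mono) auto
  moreover have "(real (k n) - 2) / real (k n) = 1 - 2 / real (k n)"
    using n(1) by (simp add: field_simps)
  moreover have "2 / real (k n) < \<delta>" using n d by (simp add: field_simps)
  ultimately have "1 - \<delta> < len g" by linarith
  then show thesis by (rule that[OF g(1)])
qed

text \<open>Comparing the two lengths through conjugates of a very short \<open>s\<close> shows that an isomorphism
  scales the length of elements of order 3 by a constant; the constant is 1 because on both sides
  these lengths come arbitrarily close to 1.\<close>

lemma cell_group_iso_dvd:
  assumes k: "divisibility_chain k" and l: "divisibility_chain l"
    and iso: "cell_group ev k \<cong> cell_group ev l"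
  shows "\<exists>m. k n dvd l m"
proof -
  let ?A = "cell_group ev k" and ?B = "cell_group ev l"
  interpret A: group ?A by (rule cell_group_group[OF k])
  interpret B: group ?B by (rule cell_group_group[OF l])
  obtain \<Phi> where \<Phi>: "\<Phi> \<in> iso ?A ?B" using iso by (auto simp: is_iso_def)
  define \<Psi> where "\<Psi> = inv_into (carrier ?A) \<Phi>"
  have \<Psi>: "\<Psi> \<in> iso ?B ?A" unfolding \<Psi>_def by (rule A.iso_set_sym[OF \<Phi>])
  have bij: "bij_betw \<Phi> (carrier ?A) (carrier ?B)" using \<Phi> by (simp add: iso_def)
  have \<Psi>\<Phi>: "\<Psi> (\<Phi> g) = g" if "g \<in> carrier ?A" for g
    using bij_betw_inv_into_left[OF bij that] by (simp add: \<Psi>_def)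
  have \<Phi>\<Psi>: "\<Phi> (\<Psi> g) = g" if "g \<in> carrier ?B" for g
    using bij_betw_inv_into_right[OF bij that] by (simp add: \<Psi>_def)
  have \<Phi>c: "\<Phi> g \<in> carrier ?B" if "g \<in> carrier ?A" for g
    using \<Phi> that by (auto simp: iso_def hom_def)
  have \<Psi>c: "\<Psi> g \<in> carrier ?A" if "g \<in> carrier ?B" for g
    using \<Psi> that by (auto simp: iso_def hom_def)
  have \<Phi>m: "\<Phi> (g \<circ> h) = \<Phi> g \<circ> \<Phi> h" if "g \<in> carrier ?A" "h \<in> carrier ?A" for g h
    using \<Phi> that by (auto simp: iso_def hom_def)
  have \<Psi>m: "\<Psi> (g \<circ> h) = \<Psi> g \<circ> \<Psi> h" if "g \<in> carrier ?B" "h \<in> carrier ?B" for g h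
    using \<Psi> that by (auto simp: iso_def hom_def)
  have idc: "id \<in> carrier ?A" "id \<in> carrier ?B" using A.one_closed B.one_closed by simp_all
  have comp: "g \<circ> h \<in> carrier ?A" if "g \<in> carrier ?A" "h \<in> carrier ?A" for g h
    using A.m_closed[OF that] by simp
  have comp': "g \<circ> h \<in> carrier ?B" if "g \<in> carrier ?B" "h \<in> carrier ?B" for g h
    using B.m_closed[OF that] by simp
  have \<Phi>id: "\<Phi> id = id"
    using hom_one[OF _ A.group_axioms B.group_axioms, of \<Phi>] \<Phi> by (simp add: iso_def)
  have \<Psi>id: "\<Psi> id = id" using \<Psi>\<Phi>[OF idc(1)] \<Phi>id by simp
  have \<Phi>T: "\<Phi> g \<in> cubic_elts ev l" if "g \<in> cubic_elts ev k" for g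
    using that \<Phi>m[of g g] \<Phi>m[of "g \<circ> g" g] comp[of g g] \<Phi>c[of g] \<Phi>id \<Psi>id \<Psi>\<Phi>[of g]
    by (auto simp: cubic_elts_def)
  have \<Psi>T: "\<Psi> g \<in> cubic_elts ev k" if "g \<in> cubic_elts ev l" for g
    using that \<Psi>m[of g g] \<Psi>m[of "g \<circ> g" g] comp'[of g g] \<Psi>c[of g] \<Phi>id \<Psi>id \<Phi>\<Psi>[of g]
    by (auto simp: cubic_elts_def)
  have Tc: "g \<in> carrier ?A" if "g \<in> cubic_elts ev k" for g using that by (simp add: cubic_elts_def)
  \<comment> \<open>The length of the target group pulled back along the isomorphism is again
    subadditive and conjugation invariant, so the counting bound applies to it.\<close>
  define L' where "L' g = len (\<Phi> g)" for g
  have L'pos: "0 < L' g" if "g \<in> cubic_elts ev k" for g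
    using len_cubic_elts_pos[OF l \<Phi>T[OF that]] by (simp add: L'_def)
  have Lpos: "0 < len g" if "g \<in> cubic_elts ev k" for g
    using len_cubic_elts_pos[OF k that] .
  have up: "L' g \<le> (len g / len s + 2) * L' s"
    if "g \<in> cubic_elts ev k" "s \<in> cubic_elts ev k" for g s
  proof (rule cell_group_length_bound[OF k _ _ that])
    fix x y assume xy: "x \<in> carrier ?A" "y \<in> carrier ?A"
    then show "L' (x \<circ> y) \<le> L' x + L' y"
      using len_comp[OF l \<Phi>c \<Phi>c] \<Phi>m by (simp add: L'_def)
    fix h assume "h \<in> carrier ?A" "h \<circ> x = y \<circ> h"
    then show "L' x = L' y"
      unfolding L'_def using xy \<Phi>m[of h x] \<Phi>m[of y h] by (intro len_conj[OF l \<Phi>c \<Phi>c, of _ _ "\<Phi> h"] \<Phi>c) simp_all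
  qed (simp add: L'_def len_ge_0)
  \<comment> \<open>The same bound in the target group, with the roles of the two lengths
    exchanged.\<close>
  have down: "len g \<le> (L' g / L' s + 2) * len s"
    if "g \<in> cubic_elts ev k" "s \<in> cubic_elts ev k" for g s
  proof -
    have "len (\<Psi> (\<Phi> g)) \<le> (len (\<Phi> g) / len (\<Phi> s) + 2) * len (\<Psi> (\<Phi> s))"
    proof (rule cell_group_length_bound[OF l _ _ \<Phi>T[OF that(1)] \<Phi>T[OF that(2)]])
      fix x y assume xy: "x \<in> carrier ?B" "y \<in> carrier ?B"
      then show "len (\<Psi> (x \<circ> y)) \<le> len (\<Psi> x) + len (\<Psi> y)"
        using len_comp[OF k \<Psi>c \<Psi>c] \<Psi>m by simp
      fix h assume "h \<in> carrier ?B" "h \<circ> x = y \<circ> h"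
      then show "len (\<Psi> x) = len (\<Psi> y)"
        using xy \<Psi>m[of h x] \<Psi>m[of y h] by (intro len_conj[OF k \<Psi>c \<Psi>c, of _ _ "\<Psi> h"] \<Psi>c) simp_all
    qed (simp add: len_ge_0)
    then show ?thesis using \<Psi>\<Phi> Tc that by (simp add: L'_def)
  qed
  have ratio_le: "L' g * len h \<le> len g * L' h"
    if g: "g \<in> cubic_elts ev k" and h: "h \<in> cubic_elts ev k" for g h
  \<comment> \<open>Combining the two bounds through s and cancelling \<open>len s\<close> leaves an
    error of 2 \<open>len s\<close> times the sum of \<open>L' g\<close> and \<open>L' h\<close>,
    whence C.\<close>
  proof (rule real_le_if_slack[where C = "2 * L' g + 2 * L' h"])
    fix \<delta> :: real assume "\<delta> > 0"
    \<comment> \<open>The bound \<open>len h / 2\<close> makes \<open>len h - 2 * len s\<close>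
      positive, so that \<open>u\<close> may be multiplied by it.\<close>
    then have "0 < min \<delta> (len h / 2)" using Lpos h by simp
    then obtain s where s: "s \<in> cubic_elts ev k" "len s < \<delta>" "len s < len h / 2"
      using small_cubic_elt[OF k] by (metis min_less_iff_conj)
    note pos = Lpos[OF s(1)] L'pos[OF s(1)]
    have u: "L' g * len s \<le> (len g + 2 * len s) * L' s"
    proof -
      have "L' g * len s \<le> (len g / len s + 2) * L' s * len s"
        using up[OF g s(1)] pos by (intro mult_right_mono) auto
      also have "\<dots> = (len g + 2 * len s) * L' s" using pos by (simp add: field_simps)
      finally show ?thesis .
    qed
    have d: "(len h - 2 * len s) * L' s \<le> L' h * len s"
    proof -
      have "len h * L' s \<le> (L' h / L' s + 2) * len s * L' s"
        using down[OF h s(1)] pos by (intro mult_right_mono) auto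
      also have "\<dots> = (L' h + 2 * L' s) * len s" using pos by (simp add: field_simps)
      finally show ?thesis by (simp add: algebra_simps)
    qed
    have "L' g * len s * (len h - 2 * len s) \<le> (len g + 2 * len s) * L' s * (len h - 2 * len s)"
      using u s(3) by (intro mult_right_mono) auto
    also have "\<dots> \<le> (len g + 2 * len s) * (L' h * len s)"
      using d pos Lpos[OF g] by (simp add: mult.assoc mult.commute[of "L' s"])
    finally have "len s * (L' g * (len h - 2 * len s)) \<le> len s * ((len g + 2 * len s) * L' h)"
      by (simp add: algebra_simps)
    then have "L' g * (len h - 2 * len s) \<le> (len g + 2 * len s) * L' h"
      using pos by simp
    then have "L' g * len h \<le> len g * L' h + (2 * L' g + 2 * L' h) * len s"
      by (simp add: algebra_simps)
    then show "\<exists>\<epsilon>. 0 < \<epsilon> \<and> \<epsilon> < \<delta> \<and> L' g * len h \<le> len g * L' h + (2 * L' g + 2 * L' h) * \<epsilon>"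
      using s pos by blast
  qed
  then have ratio: "L' g * len h = len g * L' h"
    if "g \<in> cubic_elts ev k" "h \<in> cubic_elts ev k" for g h
    using that by (metis mult.commute order_antisym)
  have eq: "L' h = len h" if h: "h \<in> cubic_elts ev k" for h
  \<comment> \<open>No length exceeds 1 in either group. An element almost filling [0, 1) in the
    source bounds the constant of proportionality from above, one almost filling it in the target
    bounds it from below.\<close>
  proof (rule antisym; rule field_le_epsilon)
    fix e :: real assume e: "e > 0"
    obtain g where g: "g \<in> cubic_elts ev k" "1 - e < len g" using large_cubic_elt[OF k e] by blast
    have "L' g \<le> 1" using len_le_1[OF l \<Phi>c[OF Tc[OF g(1)]]] by (simp add: L'_def)
    have h1: "L' h \<le> 1" using len_le_1[OF l \<Phi>c[OF Tc[OF h]]] by (simp add: L'_def)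
    have "(1 - e) * L' h \<le> len g * L' h" using g L'pos[OF h] by (intro mult_right_mono) auto
    also have "\<dots> = L' g * len h" using ratio g h by simp
    also have "\<dots> \<le> len h" using \<open>L' g \<le> 1\<close> Lpos[OF h] by (simp add: mult_le_cancel_right1)
    finally have "L' h \<le> len h + e * L' h" by (simp add: algebra_simps)
    also have "e * L' h \<le> e" using e h1 by simp
    finally show "L' h \<le> len h + e" by simp
    obtain g' where g': "g' \<in> cubic_elts ev l" "1 - e < len g'" using large_cubic_elt[OF l e] by blast
    define g where "g = \<Psi> g'"
    have g: "g \<in> cubic_elts ev k" using \<Psi>T[OF g'(1)] by (simp add: g_def)
    have L'g: "1 - e < L' g" using g' \<Phi>\<Psi> by (simp add: L'_def g_def cubic_elts_def)
    have "len g \<le> 1" using len_le_1[OF k Tc[OF g]] .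
    have h1: "len h \<le> 1" using len_le_1[OF k Tc[OF h]] .
    have "(1 - e) * len h \<le> L' g * len h" using L'g Lpos[OF h] by (intro mult_right_mono) auto
    also have "\<dots> = len g * L' h" using ratio g h by simp
    also have "\<dots> \<le> L' h" using \<open>len g \<le> 1\<close> L'pos[OF h] by (simp add: mult_le_cancel_right1)
    finally have "len h \<le> L' h + e * len h" by (simp add: algebra_simps)
    also have "e * len h \<le> e" using e h1 by simp
    finally show "len h \<le> L' h + e" by simp
  qed
  \<comment> \<open>An index of at least 3 leaves room for a 3-cycle. Its length 3 /
    \<open>k n'\<close> must equal some 3 a / \<open>l m\<close>, so \<open>k n'\<close> divides
    \<open>l m\<close>.\<close>
  define n' where "n' = max n 3"
  have "3 * 1 \<le> k n'" using chain_unbounded[OF k, of n'] by (simp add: n'_def)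
  then obtain g where g: "g \<in> cubic_elts ev k" "len g = real (3 * 1) / real (k n')"
    using ex_cubic_elt[OF k] by (metis less_numeral_extra(1))
  obtain m a where "len (\<Phi> g) = real (3 * a) / real (l m)"
    using len_cubic_elts[OF l \<Phi>T[OF g(1)]] by metis
  then have "real (3 * a) / real (l m) = 3 / real (k n')" using eq[OF g(1)] g(2) by (simp add: L'_def)
  then have "real (a * k n') = real (l m)"
    using divisibility_chain_pos[OF k, of n'] divisibility_chain_pos[OF l, of m] by (simp add: field_simps)
  then have "l m = a * k n'" by linarith
  then have "k n' dvd l m" by simp
  moreover have "k n dvd k n'" using divisibility_chain_dvd[OF k] by (simp add: n'_def)
  ultimately show ?thesis using dvd_trans by blast
qed


section \<open>Classification by supernatural numbers\<close>

lemma cell_group_iso_iff: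
  assumes k: "divisibility_chain k" and l: "divisibility_chain l"
  shows "cell_group ev k \<cong> cell_group ev l \<longleftrightarrow>
    supernatural_prod (factor k) = supernatural_prod (factor l)"
proof
  assume iso: "cell_group ev k \<cong> cell_group ev l"
  have "cell_group ev l \<cong> cell_group ev k"
    by (rule group.iso_sym[OF cell_group_group[OF k] iso])
  then show "supernatural_prod (factor k) = supernatural_prod (factor l)"
    using supernatural_mono[OF k l cell_group_iso_dvd[OF k l iso]]
      supernatural_mono[OF l k cell_group_iso_dvd[OF l k]] by (intro ext antisym) blast+
next
  assume eq: "supernatural_prod (factor k) = supernatural_prod (factor l)"
  then have "carrier (cell_group ev k) = carrier (cell_group ev l)"
    using cell_group_mono[OF k l supernatural_eq_imp_dvd[OF k l eq]]
      cell_group_mono[OF l k supernatural_eq_imp_dvd[OF l k eq[symmetric]]] by blast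
  then have "cell_group ev k = cell_group ev l" by (simp add: cell_group_def)
  then show "cell_group ev k \<cong> cell_group ev l" using iso_refl by metis
qed

text \<open>Symmetry of isomorphism is drawn from the concrete models, whose group laws are known,
  instead of the quotients that define the limits.\<close>

lemma iso_transfer_iff:
  assumes "group A" "group B" "A \<cong> A'" "B \<cong> B'"
  shows "A' \<cong> B' \<longleftrightarrow> A \<cong> B"
proof -
  have A': "A' \<cong> A" and B': "B' \<cong> B" using assms group.iso_sym by blast+
  show ?thesis
  proof
    assume "A' \<cong> B'"
    then show "A \<cong> B" by (rule iso_trans[OF assms(3) iso_trans[OF _ B']])
  next
    assume "A \<cong> B"
    then show "A' \<cong> B'" by (rule iso_trans[OF A' iso_trans[OF _ assms(4)]])
  qed
qed

lemma limits_iso_iff: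
  assumes k: "divisibility_chain k" and l: "divisibility_chain l"
  shows "sym_limit k \<cong> sym_limit l \<longleftrightarrow> supernatural_prod (factor k) = supernatural_prod (factor l)"
    and "alt_limit k \<cong> alt_limit l \<longleftrightarrow> supernatural_prod (factor k) = supernatural_prod (factor l)"
  using cell_group_iso_iff[OF assms]
    iso_transfer_iff[OF cell_group_group[OF k] cell_group_group[OF l]
      cell_group_iso_limits(1)[OF k] cell_group_iso_limits(1)[OF l]]
    iso_transfer_iff[OF cell_group_group[OF k] cell_group_group[OF l]
      cell_group_iso_limits(2)[OF k] cell_group_iso_limits(2)[OF l]]
  by simp_all


section \<open>The cut line\<close>

lemma continuous_map_discrete_iff:
  "continuous_map X (discrete_topology S) f \<longleftrightarrow>
     f \<in> topspace X \<rightarrow> S \<and> (\<forall>s. openin X {x \<in> topspace X. f x = s})"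
proof (intro iffI conjI allI)
  assume c: "continuous_map X (discrete_topology S) f"
  then show f: "f \<in> topspace X \<rightarrow> S" by (simp add: continuous_map_def)
  fix s
  show "openin X {x \<in> topspace X. f x = s}"
  proof (cases "s \<in> S")
    case True
    then have "openin X {x \<in> topspace X. f x \<in> {s}}"
      using c by (intro openin_continuous_map_preimage) auto
    then show ?thesis by simp
  next
    case False
    then have e: "{x \<in> topspace X. f x = s} = {}" using f by auto
    show ?thesis unfolding e by (rule openin_empty)
  qed
next
  assume a: "f \<in> topspace X \<rightarrow> S \<and> (\<forall>s. openin X {x \<in> topspace X. f x = s})"
  have "openin X {x \<in> topspace X. f x \<in> U}" for U
  proof -
    have "{x \<in> topspace X. f x \<in> U} = (\<Union>s\<in>U. {x \<in> topspace X. f x = s})" by blast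
    then show ?thesis using a by (simp only:) (rule openin_Union, blast)
  qed
  then show "continuous_map X (discrete_topology S) f"
    using a by (simp add: continuous_map_def)
qed

lemma continuous_map_discrete_binop:
  assumes f: "continuous_map X (discrete_topology A) f" and g: "continuous_map X (discrete_topology B) g"
    and h: "\<And>x. x \<in> topspace X \<Longrightarrow> h (f x) (g x) \<in> C"
  shows "continuous_map X (discrete_topology C) (\<lambda>x. h (f x) (g x))"
  unfolding continuous_map_discrete_iff
proof (intro conjI allI)
  fix s
  have "{x \<in> topspace X. h (f x) (g x) = s} =
      (\<Union>p\<in>{(a, b). h a b = s}. {x \<in> topspace X. f x = fst p} \<inter> {x \<in> topspace X. g x = snd p})"
    by auto
  moreover have "openin X ({x \<in> topspace X. f x = a} \<inter> {x \<in> topspace X. g x = b})" for a b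
    using f g unfolding continuous_map_discrete_iff by blast
  ultimately show "openin X {x \<in> topspace X. h (f x) (g x) = s}"
    by (simp only:) (rule openin_Union, blast)
qed (use h in blast)

lemma continuous_map_discrete_unop:
  assumes "continuous_map X (discrete_topology A) f" "\<And>x. x \<in> topspace X \<Longrightarrow> h (f x) \<in> C"
  shows "continuous_map X (discrete_topology C) (\<lambda>x. h (f x))"
  using continuous_map_discrete_binop[OF assms(1,1), of "\<lambda>a b. h a" C] assms(2) by simp

lemma topspace_cut_topology: "topspace (cut_topology \<Gamma>) = cut_line \<Gamma>"
proof -
  let ?S = "{{y \<in> cut_line \<Gamma>. cut_less x y} | x. x \<in> cut_line \<Gamma>} \<union>
      {{y \<in> cut_line \<Gamma>. cut_less y x} | x. x \<in> cut_line \<Gamma>}"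
  have "y \<in> \<Union>?S" if y: "y \<in> cut_line \<Gamma>" for y
  proof -
    \<comment> \<open>Every y lies below a point over q(y) + 1, so the rays cover the line.\<close>
    obtain x where "x \<in> cut_line \<Gamma>" "cut_q x = cut_q y + 1"
    proof (cases "cut_q y + 1 \<in> \<Gamma>")
      case True
      then show thesis using that[of "Plus (cut_q y + 1)"] by (simp add: cut_line_def)
    next
      case False
      then show thesis using that[of "Pt (cut_q y + 1)"] by (simp add: cut_line_def)
    qed
    then have "y \<in> {y \<in> cut_line \<Gamma>. cut_less y x}" "x \<in> cut_line \<Gamma>"
      using y by (simp_all add: cut_less_def)
    then show ?thesis by blast
  qed
  then have "\<Union>?S = cut_line \<Gamma>" by blast
  then show ?thesis unfolding cut_topology_def by (simp only: topology_generated_by_topspace)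
qed

lemma openin_rays:
  assumes "x \<in> cut_line \<Gamma>"
  shows "openin (cut_topology \<Gamma>) {y \<in> cut_line \<Gamma>. cut_less x y}"
    and "openin (cut_topology \<Gamma>) {y \<in> cut_line \<Gamma>. cut_less y x}"
  unfolding cut_topology_def by (rule topology_generated_by_Basis; use assms in blast)+

lemma continuous_map_cut_topology:
  assumes "f \<in> topspace X \<rightarrow> cut_line \<Gamma>"
    and "\<And>x. x \<in> cut_line \<Gamma> \<Longrightarrow> openin X {z \<in> topspace X. cut_less x (f z)}"
    and "\<And>x. x \<in> cut_line \<Gamma> \<Longrightarrow> openin X {z \<in> topspace X. cut_less (f z) x}"
  shows "continuous_map X (cut_topology \<Gamma>) f"
proof -
  have pre: "f -` {y \<in> cut_line \<Gamma>. cut_less x y} \<inter> topspace X = {z \<in> topspace X. cut_less x (f z)}"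
    "f -` {y \<in> cut_line \<Gamma>. cut_less y x} \<inter> topspace X = {z \<in> topspace X. cut_less (f z) x}" for x
    using assms(1) by auto
  have "f ` topspace X \<subseteq> topspace (cut_topology \<Gamma>)"
    using assms(1) by (auto simp: topspace_cut_topology)
  moreover have "openin X (f -` U \<inter> topspace X)"
    if "U \<in> {{y \<in> cut_line \<Gamma>. cut_less x y} | x. x \<in> cut_line \<Gamma>} \<union>
      {{y \<in> cut_line \<Gamma>. cut_less y x} | x. x \<in> cut_line \<Gamma>}" for U
  proof -
    consider x where "x \<in> cut_line \<Gamma>" "U = {y \<in> cut_line \<Gamma>. cut_less x y}"
      | x where "x \<in> cut_line \<Gamma>" "U = {y \<in> cut_line \<Gamma>. cut_less y x}"
      using \<open>U \<in> _\<close> by blast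
    then show ?thesis
      by cases (simp_all only: pre assms(2,3))
  qed
  ultimately show ?thesis
    unfolding cut_topology_def continuous_on_generated_topo_iff topology_generated_by_topspace by blast
qed

lemma cut_less_linear: "x \<in> cut_line \<Gamma> \<Longrightarrow> y \<in> cut_line \<Gamma> \<Longrightarrow> cut_less x y \<or> x = y \<or> cut_less y x"
  by (cases x; cases y) (auto simp: cut_line_def cut_less_def, (metis linorder_cases)+)

lemma cut_less_asym: "cut_less x y \<Longrightarrow> \<not> cut_less y x"
  by (cases x; cases y) (auto simp: cut_less_def)

lemma cut_le_iff: "x \<in> cut_line \<Gamma> \<Longrightarrow> y \<in> cut_line \<Gamma> \<Longrightarrow> cut_le x y \<longleftrightarrow> \<not> cut_less y x"
  using cut_less_linear[of x \<Gamma> y] cut_less_asym[of x y] cut_less_asym[of x x]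
  unfolding cut_le_def by blast

lemma cut_shift_0 [simp]: "cut_shift 0 x = x"
  by (cases x) auto

lemma cut_shift_shift [simp]: "cut_shift d (cut_shift c x) = cut_shift (c + d) x"
  by (cases x) auto

lemma cut_shift_cancel: "cut_shift c x = cut_shift d x \<longleftrightarrow> c = d"
  by (cases x) auto

lemma cut_less_shift: "cut_less (cut_shift c x) (cut_shift c y) \<longleftrightarrow> cut_less x y"
  by (cases x; cases y) (auto simp: cut_less_def)

text \<open>The index of the interval \<open>[(m/N)\<^sub>+, ((m+1)/N)\<^sub>-]\<close> containing \<open>z\<close>.\<close>

fun lev :: "nat \<Rightarrow> cut_real \<Rightarrow> int" where
  "lev N (Pt t) = \<lfloor>real N * t\<rfloor>"
| "lev N (Minus a) = \<lceil>real N * a\<rceil> - 1"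
| "lev N (Plus a) = \<lfloor>real N * a\<rfloor>"

lemma lev_bounds: "real_of_int (lev N z) \<le> real N * cut_q z" "real N * cut_q z \<le> real_of_int (lev N z) + 1"
  by (cases z; simp; linarith)+

lemma lev_refine:
  assumes "0 < r"
  shows "lev N z = lev (N * r) z div int r"
proof (cases z)
  \<comment> \<open>At a_- the condition for level L is L < N a \<le> L + 1, the mirror image of the
    floor condition in the other two cases.\<close>
  case (Minus a)
  let ?M = "\<lceil>real (N * r) * a\<rceil> - 1"
  define L where "L = ?M div int r"
  have "?M = L * int r + ?M mod int r" "0 \<le> ?M mod int r" "?M mod int r < int r"
    using assms unfolding L_def by simp_all
  then have "L * int r \<le> ?M" "?M + 1 \<le> (L + 1) * int r"
    unfolding distrib_right by linarith+
  then have "real_of_int (L * int r) < real (N * r) * a" "real (N * r) * a \<le> real_of_int ((L + 1) * int r)"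
    by linarith+
  then have "real_of_int L * real r < (real N * a) * real r" "(real N * a) * real r \<le> (real_of_int L + 1) * real r"
    by (simp_all add: algebra_simps)
  then have "real_of_int L < real N * a" "real N * a \<le> real_of_int L + 1"
    using assms by simp_all
  then have "\<lceil>real N * a\<rceil> = L + 1" by linarith
  then show ?thesis unfolding L_def using Minus by simp
next
  case (Pt t)
  have "\<lfloor>real N * t\<rfloor> = \<lfloor>real (N * r) * t / real_of_int (int r)\<rfloor>" using assms by simp
  also have "\<dots> = \<lfloor>real (N * r) * t\<rfloor> div int r" by (rule floor_divide_real_eq_div) simp
  finally show ?thesis by (simp only: Pt lev.simps)
next
  case (Plus t)
  have "\<lfloor>real N * t\<rfloor> = \<lfloor>real (N * r) * t / real_of_int (int r)\<rfloor>" using assms by simp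
  also have "\<dots> = \<lfloor>real (N * r) * t\<rfloor> div int r" by (rule floor_divide_real_eq_div) simp
  finally show ?thesis by (simp only: Plus lev.simps)
qed

lemma lev_shift:
  assumes "real N * c = real_of_int a"
  shows "lev N (cut_shift c z) = lev N z + a"
  using assms by (cases z) (simp_all add: distrib_left)

locale gen_chain =
  fixes \<Gamma> :: "real set" and k :: "nat \<Rightarrow> nat"
  assumes gen: "generating_chain \<Gamma> k"
begin

lemma chain: "divisibility_chain k"
  using gen by (simp add: generating_chain_def)

lemmas pos = divisibility_chain_pos[OF chain]

lemma k_Suc: "k (Suc n) = k n * factor k (Suc n)"
  using chain by (simp add: divisibility_chain_def factor_def)

lemma factor_pos: "0 < factor k n"
proof (cases n)
  case 0
  then show ?thesis using pos[of 0] by (simp add: factor_def)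
next
  case (Suc m)
  then show ?thesis using pos[of n] k_Suc[of m] by (metis mult_0_right neq0_conv)
qed

lemma \<Gamma>_0: "0 \<in> \<Gamma>" and \<Gamma>_diff: "x \<in> \<Gamma> \<Longrightarrow> y \<in> \<Gamma> \<Longrightarrow> x - y \<in> \<Gamma>"
  and \<Gamma>_add: "x \<in> \<Gamma> \<Longrightarrow> y \<in> \<Gamma> \<Longrightarrow> x + y \<in> \<Gamma>" and \<Gamma>_minus: "- x \<in> \<Gamma> \<longleftrightarrow> x \<in> \<Gamma>"
  using gen group_closure.diff[of x "range (\<lambda>n. 1 / real (k n))" y]
    group_closure_add[of x "range (\<lambda>n. 1 / real (k n))" y]
    group_closure_minus_iff[of x "range (\<lambda>n. 1 / real (k n))"]
  by (auto simp: generating_chain_def)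

lemma frac_in_\<Gamma>: "real_of_int a / real (k n) \<in> \<Gamma>"
proof -
  have "1 / real (k n) \<in> \<Gamma>" using gen unfolding generating_chain_def by (metis group_closure.base insertI2 rangeI)
  then have "real m / real (k n) \<in> \<Gamma>" for m
    by (induction m) (use \<Gamma>_0 \<Gamma>_add in \<open>auto simp: add_divide_distrib\<close>)
  then have "real (nat \<bar>a\<bar>) / real (k n) \<in> \<Gamma>" by blast
  then show ?thesis
    using \<Gamma>_minus[of "real (nat \<bar>a\<bar>) / real (k n)"] by (cases "a \<ge> 0") (auto simp: abs_if)
qed

lemma \<Gamma>_1: "1 \<in> \<Gamma>"
  using frac_in_\<Gamma>[of "int (k 0)" 0] pos[of 0] by simp

lemma k_mult_frac:
  assumes "n \<le> m"
  obtains b where "real (k m) * (real_of_int a / real (k n)) = real_of_int b"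
proof -
  obtain r where "k m = k n * r" using divisibility_chain_dvd[OF chain assms] by blast
  then show thesis using that[of "int r * a"] pos[of n] by simp
qed

text \<open>Generators satisfy this by divisibility along the chain, and differences because a
  common later index exists. It makes translation by c an integer shift of all deep levels.\<close>

lemma \<Gamma>_multiples:
  assumes "c \<in> \<Gamma>"
  obtains n where "\<And>m. n \<le> m \<Longrightarrow> \<exists>a. real (k m) * c = real_of_int a"
proof -
  have "c \<in> group_closure (range (\<lambda>n. 1 / real (k n)))"
    using assms gen by (simp add: generating_chain_def)
  then have "\<exists>n. \<forall>m\<ge>n. \<exists>a. real (k m) * c = real_of_int a"
  proof (induction rule: group_closure.induct)
    case (base s)
    then consider "s = 0" | n where "s = 1 / real (k n)" by auto
    then show ?case
    proof cases
      case 1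
      then show ?thesis by (intro exI[of _ 0] allI impI exI[of _ "0::int"]) simp
    next
      case (2 n)
      then show ?thesis
        using k_mult_frac[of n _ 1] by (intro exI[of _ n] allI impI) (metis of_int_1)
    qed
  next
    case (diff s t)
    then obtain n n' where n: "\<forall>m\<ge>n. \<exists>a. real (k m) * s = real_of_int a"
      "\<forall>m\<ge>n'. \<exists>a. real (k m) * t = real_of_int a" by blast
    show ?case
    proof (intro exI[of _ "max n n'"] allI impI)
      fix m assume "max n n' \<le> m"
      then obtain a b where "real (k m) * s = real_of_int a" "real (k m) * t = real_of_int b"
        using n by (meson max.boundedE)
      then have "real (k m) * (s - t) = real_of_int (a - b)" by (simp add: right_diff_distrib)
      then show "\<exists>a. real (k m) * (s - t) = real_of_int a" by blast
    qed
  qed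
  then show thesis using that by blast
qed

lemma cut_shift_line: "c \<in> \<Gamma> \<Longrightarrow> cut_shift c x \<in> cut_line \<Gamma> \<longleftrightarrow> x \<in> cut_line \<Gamma>"
proof -
  assume c: "c \<in> \<Gamma>"
  have "t + c \<in> \<Gamma> \<longleftrightarrow> t \<in> \<Gamma>" for t
    using \<Gamma>_add[of t c] \<Gamma>_diff[of "t + c" c] c by auto
  then show ?thesis by (cases x) (auto simp: cut_line_def)
qed

text \<open>A positive gap between x and y is detected once \<open>1 / k n\<close> is at most half
  of it; the zero gap between a_- and a_+ is detected when \<open>k n\<close> times a is an integer.
  Thus integer functions encode the order.\<close>

lemma cut_less_lev:
  assumes x: "x \<in> cut_line \<Gamma>" and y: "y \<in> cut_line \<Gamma>"
  shows "cut_less x y \<longleftrightarrow> (\<exists>n. lev (k n) x < lev (k n) y)"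
proof
  assume "cut_less x y"
  then consider "cut_q x < cut_q y" | a where "x = Minus a" "y = Plus a"
    unfolding cut_less_def by blast
  then show "\<exists>n. lev (k n) x < lev (k n) y"
  proof cases
    case 1
    \<comment> \<open>Two units are needed because a level may lie a whole unit below its
      point.\<close>
    define n where "n = nat \<lceil>2 / (cut_q y - cut_q x)\<rceil>"
    have "2 / (cut_q y - cut_q x) \<le> real n" unfolding n_def by (rule real_nat_ceiling_ge)
    also have "\<dots> \<le> real (k n)" using chain_unbounded[OF chain] by simp
    finally have "2 \<le> real (k n) * cut_q y - real (k n) * cut_q x"
      using 1 by (simp add: divide_le_eq algebra_simps)
    then have "real_of_int (lev (k n) x) + 1 \<le> real_of_int (lev (k n) y)"
      using lev_bounds[of "k n" x] lev_bounds[of "k n" y] by linarith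
    then have "lev (k n) x < lev (k n) y" by linarith
    then show ?thesis by blast
  next
    case 2
    then have "a \<in> \<Gamma>" using x by (auto simp: cut_line_def)
    then obtain n b where "real (k n) * a = real_of_int b" using \<Gamma>_multiples by (metis order_refl)
    then have "lev (k n) x < lev (k n) y" using 2 by simp
    then show ?thesis by blast
  qed
next
  assume "\<exists>n. lev (k n) x < lev (k n) y"
  then obtain n where n: "lev (k n) x < lev (k n) y" by blast
  have le: "real (k n) * cut_q x \<le> real_of_int (lev (k n) x) + 1"
    "real_of_int (lev (k n) x) + 1 \<le> real_of_int (lev (k n) y)"
    "real_of_int (lev (k n) y) \<le> real (k n) * cut_q y"
    using lev_bounds[of "k n" x] lev_bounds[of "k n" y] n by linarith+
  then have "real (k n) * cut_q x \<le> real (k n) * cut_q y" by linarith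
  then have q: "cut_q x \<le> cut_q y" using pos[of n] by simp
  show "cut_less x y"
  proof (cases "cut_q x = cut_q y")
    case False
    then show ?thesis using q by (simp add: cut_less_def)
  next
    case True
    \<comment> \<open>A level exactly one unit below its point forces a minus point, a level equal
      to it excludes one; over the same a this leaves only a_- and a_+.\<close>
    then have "real (k n) * cut_q x = real_of_int (lev (k n) x) + 1"
      "real (k n) * cut_q y = real_of_int (lev (k n) y)" using le by (simp_all only: True)
    moreover obtain a where "x = Minus a"
      using calculation(1) by (cases x) (simp_all, linarith+)
    moreover have "y \<noteq> Minus b" for b
      using calculation(2) by (cases y) (simp_all, linarith+)
    ultimately show ?thesis using True x y by (auto simp: cut_less_def cut_line_def)
  qed
qed

lemma lev_inj:
  assumes "x \<in> cut_line \<Gamma>" "y \<in> cut_line \<Gamma>" "\<And>n. lev (k n) x = lev (k n) y"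
  shows "x = y"
  using cut_less_linear[OF assms(1,2)] cut_less_lev[OF assms(1,2)] cut_less_lev[OF assms(2,1)] assms(3)
  by auto

text \<open>The levels of 0_+ and 1_- are 0 and \<open>k n - 1\<close>, the extreme indices of the
  \<open>k n\<close> subintervals.\<close>

lemma unit_interval_iff:
  "z \<in> cut_unit_interval \<Gamma> \<longleftrightarrow> z \<in> cut_line \<Gamma> \<and> (\<forall>n. 0 \<le> lev (k n) z \<and> lev (k n) z < int (k n))"
proof -
  have e: "Plus 0 \<in> cut_line \<Gamma>" "Minus 1 \<in> cut_line \<Gamma>" using \<Gamma>_0 \<Gamma>_1 by (auto simp: cut_line_def)
  have "cut_le (Plus 0) z \<and> cut_le z (Minus 1) \<longleftrightarrow>
      (\<forall>n. 0 \<le> lev (k n) z \<and> lev (k n) z < int (k n))" if "z \<in> cut_line \<Gamma>"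
    using e that by (auto simp: cut_le_iff[of _ \<Gamma>] cut_less_lev not_less)
  then show ?thesis by (auto simp: cut_unit_interval_def)
qed


section \<open>Digit expansions\<close>

text \<open>Taking remainders makes \<open>digit\<close> path-valued on the whole cut line; on the
  unit interval the first remainder changes nothing, as \<open>lev (k 0) z\<close> is already below
  \<open>k 0\<close>.\<close>

definition digit :: "cut_real \<Rightarrow> nat \<Rightarrow> nat" where
  "digit z n = nat (lev (k n) z mod int (factor k n))"

text \<open>Horner evaluation of the first n + 1 digits, the inverse of reading digits off a level
  (\<open>val_digit\<close>).\<close>

primrec val :: "(nat \<Rightarrow> nat) \<Rightarrow> nat \<Rightarrow> nat" where
  "val x 0 = x 0"
| "val x (Suc n) = val x n * factor k (Suc n) + x (Suc n)"

lemma factor_0: "factor k 0 = k 0"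
  by (simp add: factor_def)

lemma path_space_topspace: "x \<in> topspace (path_space k) \<longleftrightarrow> (\<forall>n. x n < factor k n)"
  by (auto simp: path_space_def PiE_iff)

lemma digit_path: "digit z \<in> topspace (path_space k)"
  unfolding path_space_topspace digit_def using factor_pos by (simp add: nat_less_iff)

lemma lev_Suc: "lev (k n) z = lev (k (Suc n)) z div int (factor k (Suc n))"
  unfolding k_Suc using lev_refine[OF factor_pos] by blast

text \<open>Dividing a level by its factor leaves the digit as remainder and the preceding level as
  quotient, so the digits reassemble it.\<close>

lemma val_digit:
  assumes "z \<in> cut_unit_interval \<Gamma>"
  shows "int (val (digit z) n) = lev (k n) z"
proof (induction n)
  case 0
  then show ?case using assms by (simp add: digit_def factor_0 unit_interval_iff)
next
  case (Suc n)
  have "int (digit z (Suc n)) = lev (k (Suc n)) z mod int (factor k (Suc n))"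
    using factor_pos[of "Suc n"] by (simp add: digit_def)
  then show ?case
    using Suc lev_Suc[of n z] by (simp add: div_mult_mod_eq)
qed

lemma digit_inj:
  assumes "z \<in> cut_unit_interval \<Gamma>" "w \<in> cut_unit_interval \<Gamma>" "digit z = digit w"
  shows "z = w"
  using assms val_digit[OF assms(1)] val_digit[OF assms(2)]
  by (intro lev_inj) (auto simp: unit_interval_iff)

lemma val_less: "x \<in> topspace (path_space k) \<Longrightarrow> val x n < k n"
proof (induction n)
  case 0
  then show ?case unfolding path_space_topspace by (metis factor_0 val.simps(1))
next
  case (Suc n)
  then have "val x n + 1 \<le> k n" "x (Suc n) < factor k (Suc n)"
    by (simp_all add: path_space_topspace Suc_leI)
  then have "(val x n + 1) * factor k (Suc n) \<le> k (Suc n)" "x (Suc n) < factor k (Suc n)"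
    unfolding k_Suc by (simp_all only: mult_le_mono1)
  then show ?case by simp
qed

lemma val_mod:
  assumes "x \<in> topspace (path_space k)"
  shows "val x (Suc n) mod factor k (Suc n) = x (Suc n)"
proof -
  have "x (Suc n) < factor k (Suc n)" using assms by (simp add: path_space_topspace)
  then show ?thesis by simp
qed

text \<open>A sequence is the digit sequence of the supremum \<open>t\<close> of its partial sums, read as \<open>t\<^sub>+\<close> if
  the supremum is attained and as \<open>t\<^sub>-\<close> (or \<open>t\<close> if \<open>t \<notin> \<Gamma>\<close>) if it is not.\<close>

lemma digit_surj:
  assumes x: "x \<in> topspace (path_space k)"
  obtains z where "z \<in> cut_unit_interval \<Gamma>" "digit z = x"
proof -
  \<comment> \<open>The first n + 1 digits confine the point to [a n, b n], an interval of length
    \<open>1 / k n\<close>; these intervals are nested.\<close>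
  define a where "a n = real (val x n) / real (k n)" for n
  define b where "b n = real (val x n + 1) / real (k n)" for n
  have kpos: "0 < real (k n)" for n using pos by simp
  have step: "a n \<le> a (Suc n) \<and> b (Suc n) \<le> b n" for n
  proof -
    have f: "0 < real (factor k (Suc n))" using factor_pos by simp
    have e: "a n = real (val x n * factor k (Suc n)) / real (k (Suc n))"
      "b n = real ((val x n + 1) * factor k (Suc n)) / real (k (Suc n))"
      unfolding a_def b_def k_Suc of_nat_mult using f by (simp_all add: mult_divide_mult_cancel_right del: of_nat_add)
    have "x (Suc n) < factor k (Suc n)" using x by (simp add: path_space_topspace)
    then have "val x n * factor k (Suc n) \<le> val x (Suc n)" "val x (Suc n) + 1 \<le> (val x n + 1) * factor k (Suc n)"
      by simp_all
    then have "real (val x n * factor k (Suc n)) \<le> real (val x (Suc n))"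
      "real (val x (Suc n) + 1) \<le> real ((val x n + 1) * factor k (Suc n))"
      unfolding of_nat_le_iff .
    then show ?thesis
      unfolding e a_def[of "Suc n"] b_def[of "Suc n"] using kpos[of "Suc n"]
      by (simp only: divide_right_mono less_imp_le)
  qed
  have amono: "a n \<le> a m" if "n \<le> m" for n m using lift_Suc_mono_le[of a] step that by blast
  have bmono: "b m \<le> b n" if "n \<le> m" for n m using lift_Suc_antimono_le[of b] step that by blast
  have ab': "a n < b n" for n using kpos[of n] by (simp add: a_def b_def divide_strict_right_mono)
  have ab: "a n < b m" for n m
  proof -
    have "a n \<le> a (max n m)" "b (max n m) \<le> b m" using amono bmono by simp_all
    then show ?thesis using ab'[of "max n m"] by linarith
  qed
  define t where "t = (SUP n. a n)"
  have bdd: "bdd_above (range a)" using ab less_imp_le by (intro bdd_aboveI[of _ "b 0"]) blast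
  have at: "a n \<le> t" for n unfolding t_def using bdd by (intro cSUP_upper) auto
  have tb: "t \<le> b n" for n unfolding t_def using ab less_imp_le by (intro cSUP_least) auto
  have lower: "real (val x n) \<le> real (k n) * t" for n
    using at[of n] kpos[of n] by (simp add: a_def field_simps)
  have upper: "real (k n) * t \<le> real (val x n) + 1" for n
    using tb[of n] kpos[of n] by (simp add: b_def pos_le_divide_eq mult.commute)
  have aG: "a n \<in> \<Gamma>" "b n \<in> \<Gamma>" for n
    using frac_in_\<Gamma>[of "int (val x n)" n] frac_in_\<Gamma>[of "int (val x n + 1)" n]
    unfolding a_def b_def of_int_of_nat_eq by blast+
  have "\<exists>z \<in> cut_line \<Gamma>. \<forall>n. lev (k n) z = int (val x n)"
  proof (cases "\<exists>n. a n = t")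
    case True
    then obtain n where n: "a n = t" by blast
    then have tG: "t \<in> \<Gamma>" using aG by metis
    \<comment> \<open>Every upper end is strictly above every lower end, and t is a lower
      end.\<close>
    have tb': "t < b m" for m using ab[of n m] n by simp
    have "real (k m) * t < real (val x m) + 1" for m
      using tb'[of m] kpos[of m] by (simp add: b_def pos_less_divide_eq mult.commute add.commute)
    then have "lev (k m) (Plus t) = int (val x m)" for m
      using lower[of m] by (simp add: floor_eq_iff)
    then show ?thesis using tG by (intro bexI[of _ "Plus t"]) (auto simp: cut_line_def)
  next
    case False
    then have at': "a n < t" for n using at[of n] by (metis order_le_less)
    have l: "real (val x n) < real (k n) * t" for n
      using at'[of n] kpos[of n] by (simp add: a_def pos_divide_less_eq mult.commute)
    show ?thesis
    proof (cases "t \<in> \<Gamma>")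
      case True
      have "\<lceil>real (k m) * t\<rceil> = int (val x m) + 1" for m
        using l[of m] upper[of m] by (simp add: ceiling_eq_iff)
      then have "lev (k m) (Minus t) = int (val x m)" for m by simp
      then show ?thesis using True by (intro bexI[of _ "Minus t"]) (auto simp: cut_line_def)
    next
      case False
      \<comment> \<open>All interval ends lie in \<Gamma>, so a t outside \<Gamma> is never one of
        them.\<close>
      then have tb': "t < b m" for m using tb[of m] aG(2)[of m] by (metis order_le_less)
      have "real (k m) * t < real (val x m) + 1" for m
        using tb'[of m] kpos[of m] by (simp add: b_def pos_less_divide_eq mult.commute add.commute)
      then have "lev (k m) (Pt t) = int (val x m)" for m
        using lower[of m] by (simp add: floor_eq_iff)
      then show ?thesis using False by (intro bexI[of _ "Pt t"]) (auto simp: cut_line_def)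
    qed
  qed
  then obtain z where z: "z \<in> cut_line \<Gamma>" "\<And>n. lev (k n) z = int (val x n)" by blast
  have "z \<in> cut_unit_interval \<Gamma>"
    using z val_less[OF x] by (simp add: unit_interval_iff)
  moreover have "digit z n = x n" for n
  proof (cases n)
    case 0
    then show ?thesis using z(2)[of 0] x by (simp add: digit_def path_space_topspace)
  next
    case (Suc m)
    have "digit z n = val x n mod factor k n" by (simp add: digit_def z(2) nat_mod_distrib)
    then show ?thesis using Suc val_mod[OF x] by simp
  qed
  ultimately show thesis using that by blast
qed

lemma digit_bij: "bij_betw digit (cut_unit_interval \<Gamma>) (topspace (path_space k))"
  unfolding bij_betw_def
proof
  show "inj_on digit (cut_unit_interval \<Gamma>)" using digit_inj by (rule inj_onI)
  show "digit ` cut_unit_interval \<Gamma> = topspace (path_space k)"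
    using digit_path digit_surj by (metis (no_types, lifting) image_eqI image_subsetI subsetI subset_antisym)
qed

definition point :: "(nat \<Rightarrow> nat) \<Rightarrow> cut_real" where
  "point = inv_into (cut_unit_interval \<Gamma>) digit"

lemma digit_point: "x \<in> topspace (path_space k) \<Longrightarrow> digit (point x) = x"
  unfolding point_def by (rule bij_betw_inv_into_right[OF digit_bij])

lemma point_unit: "x \<in> topspace (path_space k) \<Longrightarrow> point x \<in> cut_unit_interval \<Gamma>"
  unfolding point_def using bij_betw_apply[OF bij_betw_inv_into[OF digit_bij]] by blast

lemma lev_point: "x \<in> topspace (path_space k) \<Longrightarrow> lev (k n) (point x) = int (val x n)"
  using val_digit[OF point_unit] digit_point by metis

lemma unit_line: "z \<in> cut_unit_interval \<Gamma> \<Longrightarrow> z \<in> cut_line \<Gamma>"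
  by (simp add: cut_unit_interval_def)

text \<open>The set of level m is the order interval strictly between c_- and d_+, with c = m /
  \<open>k n\<close> and d = (m + 1) / \<open>k n\<close>. Doubling the points of \<Gamma> is what
  makes this set open.\<close>

lemma lev_continuous: "continuous_map (cut_topology \<Gamma>) (discrete_topology UNIV) (lev (k n))"
  unfolding continuous_map_discrete_iff
proof (intro conjI allI)
  fix m :: int
  have kpos: "0 < real (k n)" using pos by simp
  define c d where "c = real_of_int m / real (k n)" and "d = real_of_int (m + 1) / real (k n)"
  have cd: "c \<in> \<Gamma>" "d \<in> \<Gamma>" unfolding c_def d_def by (rule frac_in_\<Gamma>)+
  have kc: "real (k n) * c = real_of_int m" "real (k n) * d = real_of_int m + 1"
    using kpos by (simp_all add: c_def d_def)
  have lt: "t < c \<longleftrightarrow> real (k n) * t < real_of_int m" "c < t \<longleftrightarrow> real_of_int m < real (k n) * t"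
    "t < d \<longleftrightarrow> real (k n) * t < real_of_int m + 1" "d < t \<longleftrightarrow> real_of_int m + 1 < real (k n) * t" for t
    using mult_less_cancel_left_pos[OF kpos, of t c] mult_less_cancel_left_pos[OF kpos, of c t]
      mult_less_cancel_left_pos[OF kpos, of t d] mult_less_cancel_left_pos[OF kpos, of d t]
    unfolding kc by simp_all
  have "lev (k n) z = m \<longleftrightarrow> cut_less (Minus c) z \<and> cut_less z (Plus d)" if z: "z \<in> cut_line \<Gamma>" for z
  proof (cases z)
    case (Pt t)
    then have "t \<noteq> c" "t \<noteq> d" using z cd by (auto simp: cut_line_def)
    then have "real (k n) * t \<noteq> real_of_int m" using kpos unfolding kc(1)[symmetric] by simp
    then show ?thesis unfolding Pt by (auto simp: cut_less_def lt floor_eq_iff)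
  next
    case (Minus t)
    have "t = d \<longleftrightarrow> real (k n) * t = real_of_int m + 1" using kpos unfolding kc(2)[symmetric] by simp
    then show ?thesis unfolding Minus by (auto simp: cut_less_def lt ceiling_eq_iff) linarith+
  next
    case (Plus t)
    have "t = c \<longleftrightarrow> real (k n) * t = real_of_int m" using kpos unfolding kc(1)[symmetric] by simp
    then show ?thesis unfolding Plus by (auto simp: cut_less_def lt floor_eq_iff)
  qed
  then have eq: "{z \<in> topspace (cut_topology \<Gamma>). lev (k n) z = m} =
      {z \<in> cut_line \<Gamma>. cut_less (Minus c) z} \<inter> {z \<in> cut_line \<Gamma>. cut_less z (Plus d)}"
    unfolding topspace_cut_topology by blast
  show "openin (cut_topology \<Gamma>) {z \<in> topspace (cut_topology \<Gamma>). lev (k n) z = m}"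
    unfolding eq using cd by (intro openin_Int openin_rays) (auto simp: cut_line_def)
qed simp

lemma digit_continuous: "continuous_map (cut_topology \<Gamma>) (path_space k) digit"
  unfolding path_space_def continuous_map_componentwise_UNIV
proof
  fix n
  show "continuous_map (cut_topology \<Gamma>) (discrete_topology {..<factor k n}) (\<lambda>z. digit z n)"
    unfolding digit_def using digit_path
    by (intro continuous_map_discrete_unop[OF lev_continuous]) (simp add: path_space_topspace digit_def)
qed

lemma val_continuous: "continuous_map (path_space k) (discrete_topology UNIV) (\<lambda>x. val x n)"
proof (induction n)
  have proj: "continuous_map (path_space k) (discrete_topology {..<factor k n}) (\<lambda>x. x n)" for n
    unfolding path_space_def by (rule continuous_map_product_projection) simp
  case 0
  then show ?case using continuous_map_discrete_unop[OF proj[of 0], of "\<lambda>a. a" UNIV] by simp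
  case (Suc n)
  then show ?case
    using continuous_map_discrete_binop[OF Suc proj[of "Suc n"], of "\<lambda>a b. a * factor k (Suc n) + b" UNIV]
    by simp
qed

text \<open>Membership in an open ray is witnessed by the level at some n, hence by finitely many
  digits, so preimages of rays are unions of cylinders.\<close>

lemma point_continuous: "continuous_map (path_space k) (cut_topology \<Gamma>) point"
proof (rule continuous_map_cut_topology)
  let ?P = "topspace (path_space k)"
  show "point \<in> ?P \<rightarrow> cut_line \<Gamma>" using point_unit unit_line by blast
  have o: "openin (path_space k) {z \<in> ?P. val z n \<in> U}" for n U
    by (rule openin_continuous_map_preimage[OF val_continuous]) simp
  fix x assume x: "x \<in> cut_line \<Gamma>"
  have "{z \<in> ?P. cut_less x (point z)} = (\<Union>n. {z \<in> ?P. val z n \<in> {v. lev (k n) x < int v}})"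
    using cut_less_lev[OF x unit_line[OF point_unit]] lev_point by auto
  then show "openin (path_space k) {z \<in> ?P. cut_less x (point z)}"
    using o by (simp only:) (rule openin_Union, blast)
  have "{z \<in> ?P. cut_less (point z) x} = (\<Union>n. {z \<in> ?P. val z n \<in> {v. int v < lev (k n) x}})"
    using cut_less_lev[OF unit_line[OF point_unit] x] lev_point by auto
  then show "openin (path_space k) {z \<in> ?P. cut_less (point z) x}"
    using o by (simp only:) (rule openin_Union, blast)
qed

end


section \<open>Topological groupoids\<close>

lemma topspace_tail_topology: "topspace (tail_topology k) = tail_rel k"
proof
  show "topspace (tail_topology k) \<subseteq> tail_rel k"
    using openin_tail_topology openin_topspace by blast
  have "openin (tail_topology k) (tail_rel k)"
    unfolding openin_tail_topology
  proof (intro conjI allI)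
    fix n
    have e: "tail_rel k \<inter> tail_rel_stage k n =
        topspace (subtopology (prod_topology (path_space k) (path_space k)) (tail_rel_stage k n))"
      by (auto simp: tail_rel_def tail_rel_stage_def)
    show "openin (subtopology (prod_topology (path_space k) (path_space k)) (tail_rel_stage k n))
        (tail_rel k \<inter> tail_rel_stage k n)"
      unfolding e by (rule openin_topspace)
  qed simp
  then show "tail_rel k \<subseteq> topspace (tail_topology k)" by (rule openin_subset)
qed

lemma topspace_stage:
  "topspace (subtopology (prod_topology (path_space k) (path_space k)) (tail_rel_stage k n)) = tail_rel_stage k n"
  by (auto simp: tail_rel_stage_def)

text \<open>The universal property of the inductive limit topology.\<close>

lemma continuous_map_from_tail:
  assumes "\<And>n. continuous_map (subtopology (prod_topology (path_space k) (path_space k))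
      (tail_rel_stage k n)) Z g"
  shows "continuous_map (tail_topology k) Z g"
  unfolding continuous_map_def topspace_tail_topology
proof (intro conjI allI impI)
  show "g \<in> tail_rel k \<rightarrow> topspace Z"
    using assms unfolding continuous_map_def topspace_stage tail_rel_def by blast
  fix U assume U: "openin Z U"
  have "{x \<in> tail_rel k. g x \<in> U} \<inter> tail_rel_stage k n = {x \<in> tail_rel_stage k n. g x \<in> U}" for n
    by (auto simp: tail_rel_def)
  then show "openin (tail_topology k) {x \<in> tail_rel k. g x \<in> U}"
    unfolding openin_tail_topology
    using openin_continuous_map_preimage[OF assms U] unfolding topspace_stage by auto
qed

text \<open>The inductive limit topology is at least as fine as the one induced by the product, so
  the image is confined to a single stage, where the two agree.\<close>

lemma continuous_map_into_tail:
  assumes "continuous_map Z (prod_topology (path_space k) (path_space k)) f"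
    and "f \<in> topspace Z \<rightarrow> tail_rel_stage k n"
  shows "continuous_map Z (tail_topology k) f"
proof -
  have f: "continuous_map Z (subtopology (prod_topology (path_space k) (path_space k)) (tail_rel_stage k n)) f"
    using assms by (simp add: continuous_map_in_subtopology)
  show ?thesis
    unfolding continuous_map_def topspace_tail_topology
  proof (intro conjI allI impI)
    show "f \<in> topspace Z \<rightarrow> tail_rel k" using assms(2) unfolding tail_rel_def by blast
    fix U assume "openin (tail_topology k) U"
    then have "openin Z {x \<in> topspace Z. f x \<in> U \<inter> tail_rel_stage k n}"
      using openin_continuous_map_preimage[OF f] unfolding openin_tail_topology by blast
    moreover have "{x \<in> topspace Z. f x \<in> U \<inter> tail_rel_stage k n} = {x \<in> topspace Z. f x \<in> U}"
      using assms(2) by blast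
    ultimately show "openin Z {x \<in> topspace Z. f x \<in> U}" by simp
  qed
qed

lemma groupoid_uhf: "groupoid (uhf_groupoid k)"
proof -
  have arr: "arrows (uhf_groupoid k) = tail_rel k"
    by (simp add: arrows_def uhf_groupoid_def topspace_tail_topology)
  have refl: "(x, x) \<in> tail_rel k" if "(x, y) \<in> tail_rel k \<or> (y, x) \<in> tail_rel k" for x y
    using that by (auto simp: tail_rel_def tail_rel_stage_def)
  have sym: "(y, x) \<in> tail_rel k" if xy: "(x, y) \<in> tail_rel k" for x y
  proof -
    obtain n where "(x, y) \<in> tail_rel_stage k n" using xy by (auto simp: tail_rel_def)
    then have "(y, x) \<in> tail_rel_stage k n" by (auto simp: tail_rel_stage_def)
    then show ?thesis by (auto simp: tail_rel_def)
  qed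
  have trans: "(x, z) \<in> tail_rel k" if "(x, y) \<in> tail_rel k" "(y, z) \<in> tail_rel k" for x y z
  proof -
    obtain n m where "(x, y) \<in> tail_rel_stage k n" "(y, z) \<in> tail_rel_stage k m"
      using \<open>(x, y) \<in> tail_rel k\<close> \<open>(y, z) \<in> tail_rel k\<close> by (auto simp: tail_rel_def)
    then have "(x, z) \<in> tail_rel_stage k (max n m)" by (auto simp: tail_rel_stage_def)
    then show ?thesis by (auto simp: tail_rel_def)
  qed
  show ?thesis
    unfolding groupoid_def composable_def arr
    by (auto simp: uhf_groupoid_def intro: refl sym trans)
qed

section \<open>Isomorphisms of topological groupoids\<close>

lemma groupoid_mult_closed:
  "groupoid G \<Longrightarrow> (g, h) \<in> composable G \<Longrightarrow> gmult G g h \<in> arrows G"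
  unfolding groupoid_def by auto

lemma topological_groupoid_isoD:
  assumes "topological_groupoid_iso G H f"
  shows "homeomorphic_map (gtop G) (gtop H) f"
    and "\<And>g h. g \<in> arrows G \<Longrightarrow> h \<in> arrows G \<Longrightarrow> (f g, f h) \<in> composable H \<longleftrightarrow> (g, h) \<in> composable G"
    and "\<And>g h. (g, h) \<in> composable G \<Longrightarrow> f (gmult G g h) = gmult H (f g) (f h)"
  using assms unfolding topological_groupoid_iso_def by auto

lemma topological_groupoid_isoI:
  assumes "homeomorphic_map (gtop G) (gtop H) f"
    and "\<And>g h. g \<in> arrows G \<Longrightarrow> h \<in> arrows G \<Longrightarrow> (f g, f h) \<in> composable H \<longleftrightarrow> (g, h) \<in> composable G"
    and "\<And>g h. (g, h) \<in> composable G \<Longrightarrow> f (gmult G g h) = gmult H (f g) (f h)"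
  shows "topological_groupoid_iso G H f"
  using assms unfolding topological_groupoid_iso_def by auto

text \<open>Continuity of multiplication is awkward to check directly for an inductive limit
  topology; it is carried over from the cut groupoid through the homeomorphism.\<close>

lemma topological_groupoid_transfer:
  assumes G: "topological_groupoid G" and H: "groupoid H" and f: "topological_groupoid_iso G H f"
    and inv: "\<And>g. g \<in> arrows G \<Longrightarrow> f (ginv G g) = ginv H (f g)"
  shows "topological_groupoid H"
proof -
  obtain f' where maps: "homeomorphic_maps (gtop G) (gtop H) f f'"
    using topological_groupoid_isoD(1)[OF f] by (auto simp: homeomorphic_map_maps)
  then have cf: "continuous_map (gtop G) (gtop H) f" and cf': "continuous_map (gtop H) (gtop G) f'"
    and ff': "\<And>h. h \<in> arrows H \<Longrightarrow> f (f' h) = h"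
    by (auto simp: homeomorphic_maps_def arrows_def)
  have f'a: "f' h \<in> arrows G" if "h \<in> arrows H" for h
    using cf' that by (auto simp: continuous_map_def arrows_def)
  have f'c: "(f' a, f' b) \<in> composable G" if "(a, b) \<in> composable H" for a b
  proof -
    have ab: "a \<in> arrows H" "b \<in> arrows H" using that by (auto simp: composable_def)
    then have "(f (f' a), f (f' b)) \<in> composable H" using that ff' by simp
    then show ?thesis using topological_groupoid_isoD(2)[OF f f'a[OF ab(1)] f'a[OF ab(2)]] by blast
  qed
  let ?CH = "subtopology (prod_topology (gtop H) (gtop H)) (composable H)"
  let ?CG = "subtopology (prod_topology (gtop G) (gtop G)) (composable G)"
  have "continuous_map ?CH (prod_topology (gtop G) (gtop G)) (\<lambda>p. (f' (fst p), f' (snd p)))"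
    unfolding continuous_map_pairwise o_def fst_conv snd_conv
    by (intro conjI continuous_map_from_subtopology continuous_map_compose[OF continuous_map_fst cf', unfolded o_def]
        continuous_map_compose[OF continuous_map_snd cf', unfolded o_def])
  then have c1: "continuous_map ?CH ?CG (\<lambda>p. (f' (fst p), f' (snd p)))"
    using f'c by (auto simp: continuous_map_in_subtopology)
  have c2: "continuous_map ?CG (gtop G) (\<lambda>(g, h). gmult G g h)"
    using G by (simp add: topological_groupoid_def)
  have "continuous_map ?CH (gtop H) (f \<circ> ((\<lambda>(g, h). gmult G g h) \<circ> (\<lambda>p. (f' (fst p), f' (snd p)))))"
    by (rule continuous_map_compose[OF continuous_map_compose[OF c1 c2] cf])
  then have "continuous_map ?CH (gtop H) (\<lambda>(g, h). gmult H g h)"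
  proof (rule continuous_map_eq)
    fix p assume "p \<in> topspace ?CH"
    then obtain a b where p: "p = (a, b)" "(a, b) \<in> composable H" by (cases p) auto
    then have ab: "a \<in> arrows H" "b \<in> arrows H" by (auto simp: composable_def)
    have "f (gmult G (f' a) (f' b)) = gmult H (f (f' a)) (f (f' b))"
      using f'c[OF p(2)] by (rule topological_groupoid_isoD(3)[OF f])
    then show "(f \<circ> ((\<lambda>(g, h). gmult G g h) \<circ> (\<lambda>p. (f' (fst p), f' (snd p))))) p = (\<lambda>(g, h). gmult H g h) p"
      using ab ff' p by simp
  qed
  moreover have "continuous_map (gtop H) (gtop H) (f \<circ> (ginv G \<circ> f'))"
  proof -
    have "continuous_map (gtop G) (gtop G) (ginv G)" using G by (simp add: topological_groupoid_def)
    then show ?thesis by (rule continuous_map_compose[OF continuous_map_compose[OF cf'] cf])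
  qed
  then have "continuous_map (gtop H) (gtop H) (ginv H)"
  proof (rule continuous_map_eq)
    fix h assume "h \<in> topspace (gtop H)"
    then have "h \<in> arrows H" by (simp add: arrows_def)
    then show "(f \<circ> (ginv G \<circ> f')) h = ginv H h" using inv[OF f'a] ff' by simp
  qed
  ultimately show ?thesis using H by (simp add: topological_groupoid_def)
qed

lemma isomorphic_topological_groupoids_sym:
  assumes "isomorphic_topological_groupoids G H"
  shows "isomorphic_topological_groupoids H G"
proof -
  obtain f where G: "topological_groupoid G" and H: "topological_groupoid H" and f: "topological_groupoid_iso G H f"
    using assms by (auto simp: isomorphic_topological_groupoids_def)
  obtain f' where maps: "homeomorphic_maps (gtop G) (gtop H) f f'"
    using topological_groupoid_isoD(1)[OF f] by (auto simp: homeomorphic_map_maps)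
  have f'f: "f' (f g) = g" if "g \<in> arrows G" for g using maps that by (auto simp: homeomorphic_maps_def arrows_def)
  have ff': "f (f' h) = h" if "h \<in> arrows H" for h using maps that by (auto simp: homeomorphic_maps_def arrows_def)
  have f'a: "f' h \<in> arrows G" if "h \<in> arrows H" for h
    using maps that by (auto simp: homeomorphic_maps_def continuous_map_def arrows_def)
  have comp: "(f' a, f' b) \<in> composable G \<longleftrightarrow> (a, b) \<in> composable H" if "a \<in> arrows H" "b \<in> arrows H" for a b
  proof -
    have "(f (f' a), f (f' b)) \<in> composable H \<longleftrightarrow> (f' a, f' b) \<in> composable G"
      using f'a[OF that(1)] f'a[OF that(2)] by (rule topological_groupoid_isoD(2)[OF f])
    then show ?thesis using ff' that by simp
  qed
  have "f' (gmult H a b) = gmult G (f' a) (f' b)" if "(a, b) \<in> composable H" for a b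
  proof -
    have ab: "a \<in> arrows H" "b \<in> arrows H" using that by (auto simp: composable_def)
    have c: "(f' a, f' b) \<in> composable G" using comp[OF ab] that by simp
    then have "f (gmult G (f' a) (f' b)) = gmult H (f (f' a)) (f (f' b))"
      by (rule topological_groupoid_isoD(3)[OF f])
    moreover have "gmult G (f' a) (f' b) \<in> arrows G"
      using groupoid_mult_closed[OF _ c] G by (simp add: topological_groupoid_def)
    ultimately show ?thesis using f'f ff' ab by metis
  qed
  moreover have "homeomorphic_map (gtop H) (gtop G) f'"
    using maps homeomorphic_maps_sym unfolding homeomorphic_map_maps by blast
  ultimately have "topological_groupoid_iso H G f'"
    using comp by (intro topological_groupoid_isoI)
  then show ?thesis using G H by (auto simp: isomorphic_topological_groupoids_def)
qed

lemma isomorphic_topological_groupoids_trans: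
  assumes "isomorphic_topological_groupoids G H" "isomorphic_topological_groupoids H K"
  shows "isomorphic_topological_groupoids G K"
proof -
  obtain f g where f: "topological_groupoid_iso G H f" and g: "topological_groupoid_iso H K g"
    using assms by (auto simp: isomorphic_topological_groupoids_def)
  have fa: "f x \<in> arrows H" if "x \<in> arrows G" for x
    using that homeomorphic_imp_surjective_map[OF topological_groupoid_isoD(1)[OF f]]
    by (auto simp: arrows_def)
  have "(g (f a), g (f b)) \<in> composable K \<longleftrightarrow> (a, b) \<in> composable G" if "a \<in> arrows G" "b \<in> arrows G" for a b
    using topological_groupoid_isoD(2)[OF f that] topological_groupoid_isoD(2)[OF g fa[OF that(1)] fa[OF that(2)]]
    by simp
  moreover have "g (f (gmult G a b)) = gmult K (g (f a)) (g (f b))" if c: "(a, b) \<in> composable G" for a b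
  proof -
    have "a \<in> arrows G" "b \<in> arrows G" using c by (auto simp: composable_def)
    then have "(f a, f b) \<in> composable H" using topological_groupoid_isoD(2)[OF f] c by blast
    then have "g (gmult H (f a) (f b)) = gmult K (g (f a)) (g (f b))"
      by (rule topological_groupoid_isoD(3)[OF g])
    moreover have "f (gmult G a b) = gmult H (f a) (f b)"
      using c by (rule topological_groupoid_isoD(3)[OF f])
    ultimately show ?thesis by simp
  qed
  moreover have "homeomorphic_map (gtop G) (gtop K) (g \<circ> f)"
    using topological_groupoid_isoD(1)[OF f] topological_groupoid_isoD(1)[OF g] homeomorphic_map_compose by blast
  ultimately have "topological_groupoid_iso G K (g \<circ> f)"
    by (intro topological_groupoid_isoI) simp_all
  then show ?thesis using assms by (auto simp: isomorphic_topological_groupoids_def)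
qed

section \<open>The cut groupoid as a topological groupoid\<close>

context gen_chain
begin

lemma cut_shift_continuous:
  assumes c: "c \<in> \<Gamma>"
  shows "continuous_map (cut_topology \<Gamma>) (cut_topology \<Gamma>) (cut_shift c)"
proof (rule continuous_map_cut_topology)
  show "cut_shift c \<in> topspace (cut_topology \<Gamma>) \<rightarrow> cut_line \<Gamma>"
    using c by (simp add: topspace_cut_topology cut_shift_line)
  fix x assume "x \<in> cut_line \<Gamma>"
  then have x': "cut_shift (- c) x \<in> cut_line \<Gamma>" using c \<Gamma>_minus cut_shift_line by simp
  have e: "cut_less x (cut_shift c z) \<longleftrightarrow> cut_less (cut_shift (- c) x) z"
    "cut_less (cut_shift c z) x \<longleftrightarrow> cut_less z (cut_shift (- c) x)" for z
    using cut_less_shift[of "- c" x "cut_shift c z"] cut_less_shift[of "- c" "cut_shift c z" x] by simp_all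
  show "openin (cut_topology \<Gamma>) {z \<in> topspace (cut_topology \<Gamma>). cut_less x (cut_shift c z)}"
    "openin (cut_topology \<Gamma>) {z \<in> topspace (cut_topology \<Gamma>). cut_less (cut_shift c z) x}"
    unfolding e topspace_cut_topology using x' by (rule openin_rays)+
qed

text \<open>\<Gamma> is discrete, so it suffices to paste over the open slices with fixed c.\<close>

lemma action_continuous:
  "continuous_map (prod_topology (discrete_topology \<Gamma>) (cut_topology \<Gamma>)) (cut_topology \<Gamma>)
     (\<lambda>p. cut_shift (fst p) (snd p))"
proof (rule pasting_lemma[where I = \<Gamma> and T = "\<lambda>c. {c} \<times> cut_line \<Gamma>" and f = "\<lambda>c p. cut_shift c (snd p)"])
  fix c assume c: "c \<in> \<Gamma>"
  show "openin (prod_topology (discrete_topology \<Gamma>) (cut_topology \<Gamma>)) ({c} \<times> cut_line \<Gamma>)"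
    using c openin_topspace[of "cut_topology \<Gamma>"]
    by (simp add: openin_prod_Times_iff topspace_cut_topology)
  show "continuous_map (subtopology (prod_topology (discrete_topology \<Gamma>) (cut_topology \<Gamma>)) ({c} \<times> cut_line \<Gamma>))
      (cut_topology \<Gamma>) (\<lambda>p. cut_shift c (snd p))"
    by (intro continuous_map_from_subtopology
        continuous_map_compose[OF continuous_map_snd cut_shift_continuous[OF c], unfolded o_def])
qed (auto simp: topspace_cut_topology)

abbreviation "cut_arrows \<equiv>
  {(c, x). c \<in> \<Gamma> \<and> x \<in> cut_unit_interval \<Gamma> \<and> cut_shift c x \<in> cut_unit_interval \<Gamma>}"

lemma gtop_cut: "gtop (cut_groupoid \<Gamma>) =
    subtopology (prod_topology (discrete_topology \<Gamma>) (cut_topology \<Gamma>)) cut_arrows"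
  by (simp add: cut_groupoid_def)

lemma arrows_cut: "arrows (cut_groupoid \<Gamma>) = cut_arrows"
  unfolding arrows_def gtop_cut using unit_line by (auto simp: topspace_cut_topology)

lemma groupoid_cut: "groupoid (cut_groupoid \<Gamma>)"
  unfolding groupoid_def composable_def arrows_cut
  by (auto simp: cut_groupoid_def \<Gamma>_0 \<Gamma>_minus add.commute add.assoc intro: \<Gamma>_add)

lemma topological_groupoid_cut: "topological_groupoid (cut_groupoid \<Gamma>)"
proof -
  let ?G = "cut_groupoid \<Gamma>" and ?P = "prod_topology (discrete_topology \<Gamma>) (cut_topology \<Gamma>)"
  have f: "continuous_map (gtop ?G) (discrete_topology \<Gamma>) fst"
    and s: "continuous_map (gtop ?G) (cut_topology \<Gamma>) snd"
    unfolding gtop_cut by (intro continuous_map_from_subtopology continuous_map_fst continuous_map_snd)+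
  have top: "topspace (gtop ?G) = cut_arrows" using arrows_cut by (simp add: arrows_def)
  have "continuous_map (gtop ?G) ?P (\<lambda>p. (- fst p, cut_shift (fst p) (snd p)))"
    unfolding continuous_map_pairwise o_def fst_conv snd_conv
  proof
    show "continuous_map (gtop ?G) (discrete_topology \<Gamma>) (\<lambda>p. - fst p)"
      by (rule continuous_map_discrete_unop[OF f]) (auto simp: top \<Gamma>_minus)
    show "continuous_map (gtop ?G) (cut_topology \<Gamma>) (\<lambda>p. cut_shift (fst p) (snd p))"
      unfolding gtop_cut by (intro continuous_map_from_subtopology action_continuous)
  qed
  then have "continuous_map (gtop ?G) (gtop ?G) (\<lambda>p. (- fst p, cut_shift (fst p) (snd p)))"
    unfolding gtop_cut[of] continuous_map_in_subtopology
    by (auto simp: top[unfolded gtop_cut] \<Gamma>_minus)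
  moreover have "ginv ?G = (\<lambda>p. (- fst p, cut_shift (fst p) (snd p)))"
    by (auto simp: cut_groupoid_def)
  ultimately have inv: "continuous_map (gtop ?G) (gtop ?G) (ginv ?G)" by simp
  let ?C = "subtopology (prod_topology (gtop ?G) (gtop ?G)) (composable ?G)"
  have ff: "continuous_map ?C (discrete_topology \<Gamma>) (\<lambda>q. fst (fst q))"
    by (intro continuous_map_from_subtopology continuous_map_compose[OF continuous_map_fst f, unfolded o_def])
  have fs: "continuous_map ?C (discrete_topology \<Gamma>) (\<lambda>q. fst (snd q))"
    by (intro continuous_map_from_subtopology continuous_map_compose[OF continuous_map_snd f, unfolded o_def])
  have ss: "continuous_map ?C (cut_topology \<Gamma>) (\<lambda>q. snd (snd q))"
    by (intro continuous_map_from_subtopology continuous_map_compose[OF continuous_map_snd s, unfolded o_def])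
  have "continuous_map ?C (discrete_topology \<Gamma>) (\<lambda>q. fst (fst q) + fst (snd q))"
    by (rule continuous_map_discrete_binop[OF ff fs]) (auto simp: top intro: \<Gamma>_add)
  then have m: "continuous_map ?C ?P (\<lambda>q. (fst (fst q) + fst (snd q), snd (snd q)))"
    unfolding continuous_map_pairwise o_def fst_conv snd_conv using ss by blast
  have e: "(\<lambda>(g, h). gmult ?G g h) = (\<lambda>q. (fst (fst q) + fst (snd q), snd (snd q)))"
    by (auto simp: cut_groupoid_def fun_eq_iff)
  have "gmult ?G g h \<in> cut_arrows" if "(g, h) \<in> composable ?G" for g h
    using groupoid_mult_closed[OF groupoid_cut that] unfolding arrows_cut .
  then have "(\<lambda>(g, h). gmult ?G g h) \<in> topspace ?C \<rightarrow> cut_arrows"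
    by (intro Pi_I) (simp only: case_prod_beta prod.collapse topspace_subtopology Int_iff)
  then have "continuous_map ?C (gtop ?G) (\<lambda>(g, h). gmult ?G g h)"
    using m unfolding e by (subst gtop_cut) (simp only: continuous_map_in_subtopology)
  then show ?thesis using inv groupoid_cut by (simp add: topological_groupoid_def)
qed

section \<open>Coding an arrow by the digits of its range and source\<close>

definition code :: "real \<times> cut_real \<Rightarrow> (nat \<Rightarrow> nat) \<times> (nat \<Rightarrow> nat)" where
  "code p = (digit (cut_shift (fst p) (snd p)), digit (snd p))"

text \<open>From level n on, c is an integer multiple of \<open>1 / k j\<close>; one level later the
  shift is a multiple of the factor, so the remainder, which is the digit, survives.\<close>

lemma digit_shift:
  assumes "\<And>m. n \<le> m \<Longrightarrow> \<exists>a. real (k m) * c = real_of_int a" "n < i"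
  shows "digit (cut_shift c x) i = digit x i"
proof -
  obtain j where j: "i = Suc j" "n \<le> j" using assms(2) by (cases i) auto
  obtain a where a: "real (k j) * c = real_of_int a" using assms(1) j by blast
  have "real (k i) * c = real_of_int (a * int (factor k i))"
    using a unfolding j k_Suc by (simp add: mult.commute mult.left_commute)
  then have "lev (k i) (cut_shift c x) = lev (k i) x + a * int (factor k i)" by (rule lev_shift)
  then show ?thesis by (simp add: digit_def)
qed

lemma code_stage:
  assumes "\<And>m. n \<le> m \<Longrightarrow> \<exists>a. real (k m) * c = real_of_int a"
  shows "code (c, x) \<in> tail_rel_stage k n"
  using digit_shift[OF assms] digit_path by (auto simp: code_def tail_rel_stage_def)

text \<open>The translation action is free, so range and source determine c.\<close>

lemma code_inj:
  assumes "p \<in> cut_arrows" "q \<in> cut_arrows" "code p = code q"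
  shows "p = q"
proof -
  obtain c x d y where pq: "p = (c, x)" "q = (d, y)" by (cases p; cases q)
  then have "x = y" using assms digit_inj by (auto simp: code_def)
  moreover have "cut_shift c x = cut_shift d y" using assms pq digit_inj by (auto simp: code_def)
  ultimately show ?thesis using pq cut_shift_cancel by simp
qed

text \<open>The stage n is a parameter so that the translation depends on finitely many digits and
  is locally constant. Where several stages apply they agree, as each inverts
  \<open>code\<close>.\<close>

definition decode :: "nat \<Rightarrow> (nat \<Rightarrow> nat) \<times> (nat \<Rightarrow> nat) \<Rightarrow> real \<times> cut_real" where
  "decode n p = (real_of_int (int (val (fst p) n) - int (val (snd p) n)) / real (k n), point (snd p))"

lemma decode:
  assumes p: "p \<in> tail_rel_stage k n"
  shows "decode n p \<in> cut_arrows" "code (decode n p) = p"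
proof -
  obtain x y where xy: "p = (x, y)" by (cases p)
  then have x: "x \<in> topspace (path_space k)" and y: "y \<in> topspace (path_space k)"
    and tail: "\<And>i. n < i \<Longrightarrow> x i = y i" using p by (auto simp: tail_rel_stage_def)
  define a where "a = int (val x n) - int (val y n)"
  define c where "c = real_of_int a / real (k n)"
  have cG: "c \<in> \<Gamma>" unfolding c_def by (rule frac_in_\<Gamma>)
  have dec: "decode n p = (c, point y)" by (simp add: decode_def xy c_def a_def)
  \<comment> \<open>Equal digits beyond n multiply the difference of the numerals by the same factor
    as \<open>k\<close>, so one c serves all later levels.\<close>
  have *: "real (k m) * c = real_of_int (int (val x m) - int (val y m))" if "n \<le> m" for m
    using that
  proof (induction rule: dec_induct)
    case base
    then show ?case using pos[of n] by (simp add: c_def a_def)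
  next
    case (step m)
    have "x (Suc m) = y (Suc m)" using tail step by simp
    moreover have "real (k (Suc m)) * c = real (k m) * c * real (factor k (Suc m))"
      unfolding k_Suc by simp
    ultimately show ?case unfolding step.IH by (simp add: left_diff_distrib)
  qed
  have lev_m: "lev (k m) (cut_shift c (point y)) = lev (k m) (point x)" if "n \<le> m" for m
    using lev_shift[OF *[OF that]] lev_point[OF x] lev_point[OF y] by simp
  \<comment> \<open>Levels before n are quotients of later ones, so agreement from n on extends to
    all levels.\<close>
  have lev_div: "lev (k m) z = lev (k (m + j)) z div int (k (m + j) div k m)" for m j z
  proof -
    obtain r where r: "k (m + j) = k m * r" using divisibility_chain_dvd[OF chain, of m "m + j"] by auto
    then have "0 < r" using pos[of "m + j"] by (cases r) auto
    then show ?thesis using lev_refine[of r "k m" z] r pos[of m] by simp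
  qed
  have "lev (k m) (cut_shift c (point y)) = lev (k m) (point x)" for m
    using lev_div[of m "cut_shift c (point y)" n] lev_div[of m "point x" n] lev_m[of "m + n"] by simp
  then have eq: "cut_shift c (point y) = point x"
    using point_unit[OF x] point_unit[OF y] cG cut_shift_line unit_line by (intro lev_inj) auto
  show "decode n p \<in> cut_arrows" unfolding dec using cG eq point_unit[OF x] point_unit[OF y] by simp
  show "code (decode n p) = p" unfolding dec code_def using eq digit_point x y xy by simp
qed

text \<open>An arrow with translation c is sent to a stage depending on c alone, and the slices of
  constant c are open, so \<open>continuous_map_into_tail\<close> applies slice by slice. The
  inverse agrees on stage n with \<open>decode n\<close>, which suffices by
  \<open>continuous_map_from_tail\<close>.\<close>

lemma code_homeomorphic:
  "homeomorphic_map (gtop (cut_groupoid \<Gamma>)) (gtop (uhf_groupoid k)) code"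
proof -
  let ?G = "gtop (cut_groupoid \<Gamma>)" and ?P = "prod_topology (path_space k) (path_space k)"
  have top: "topspace ?G = cut_arrows" using arrows_cut by (simp add: arrows_def)
  have gU: "gtop (uhf_groupoid k) = tail_topology k" by (simp add: uhf_groupoid_def)
  define g where "g = inv_into cut_arrows code"
  have inj: "inj_on code cut_arrows" using code_inj by (rule inj_onI)
  have g: "g p = decode n p" if "p \<in> tail_rel_stage k n" for n p
    using inv_into_f_f[OF inj decode(1)[OF that]] decode(2)[OF that] by (simp add: g_def)
  have act: "continuous_map ?G (cut_topology \<Gamma>) (\<lambda>p. cut_shift (fst p) (snd p))"
    and snd: "continuous_map ?G (cut_topology \<Gamma>) snd"
    unfolding gtop_cut by (intro continuous_map_from_subtopology action_continuous continuous_map_snd)+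
  have codeP: "continuous_map ?G ?P code"
    unfolding continuous_map_pairwise code_def o_def fst_conv snd_conv
    using continuous_map_compose[OF act digit_continuous] continuous_map_compose[OF snd digit_continuous]
    by (simp add: o_def)
  have fst: "continuous_map ?G (discrete_topology \<Gamma>) fst"
    unfolding gtop_cut by (intro continuous_map_from_subtopology continuous_map_fst)
  have "continuous_map ?G (tail_topology k) code"
  proof (rule pasting_lemma[where I = \<Gamma> and T = "\<lambda>c. {p \<in> topspace ?G. fst p = c}" and f = "\<lambda>c. code"])
    fix c assume c: "c \<in> \<Gamma>"
    show "openin ?G {p \<in> topspace ?G. fst p = c}"
      using fst by (simp add: continuous_map_discrete_iff)
    obtain n where n: "\<And>m. n \<le> m \<Longrightarrow> \<exists>a. real (k m) * c = real_of_int a" using \<Gamma>_multiples[OF c] by blast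
    show "continuous_map (subtopology ?G {p \<in> topspace ?G. fst p = c}) (tail_topology k) code"
    proof (rule continuous_map_into_tail)
      show "continuous_map (subtopology ?G {p \<in> topspace ?G. fst p = c}) ?P code"
        by (rule continuous_map_from_subtopology[OF codeP])
      show "code \<in> topspace (subtopology ?G {p \<in> topspace ?G. fst p = c}) \<rightarrow> tail_rel_stage k n"
        using code_stage[OF n] by auto
    qed
  qed (auto simp: top)
  moreover have "continuous_map (tail_topology k) ?G g"
  proof (rule continuous_map_from_tail)
    fix n
    let ?S = "subtopology ?P (tail_rel_stage k n)"
    have vf: "continuous_map ?S (discrete_topology UNIV) (\<lambda>p. val (fst p) n)"
      by (intro continuous_map_from_subtopology continuous_map_compose[OF continuous_map_fst val_continuous, unfolded o_def])
    have vs: "continuous_map ?S (discrete_topology UNIV) (\<lambda>p. val (snd p) n)"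
      by (intro continuous_map_from_subtopology continuous_map_compose[OF continuous_map_snd val_continuous, unfolded o_def])
    have "continuous_map ?S (discrete_topology \<Gamma>)
        (\<lambda>p. real_of_int (int (val (fst p) n) - int (val (snd p) n)) / real (k n))"
      by (rule continuous_map_discrete_binop[OF vf vs, of "\<lambda>a b. real_of_int (int a - int b) / real (k n)"])
        (rule frac_in_\<Gamma>)
    moreover have "continuous_map ?S (cut_topology \<Gamma>) (\<lambda>p. point (snd p))"
      by (intro continuous_map_from_subtopology continuous_map_compose[OF continuous_map_snd point_continuous, unfolded o_def])
    ultimately have "continuous_map ?S (prod_topology (discrete_topology \<Gamma>) (cut_topology \<Gamma>)) (decode n)"
      unfolding continuous_map_pairwise decode_def o_def fst_conv snd_conv by blast
    moreover have "decode n \<in> topspace ?S \<rightarrow> cut_arrows"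
      unfolding topspace_stage by (rule Pi_I) (rule decode(1))
    ultimately have "continuous_map ?S ?G (decode n)"
      unfolding gtop_cut by (simp only: continuous_map_in_subtopology)
    then show "continuous_map ?S ?G g"
      by (rule continuous_map_eq) (use g topspace_stage in auto)
  qed
  moreover have "g (code p) = p" if "p \<in> cut_arrows" for p
    unfolding g_def using inj that by (rule inv_into_f_f)
  moreover have "code (g p) = p" if "p \<in> tail_rel k" for p
  proof -
    obtain n where n: "p \<in> tail_rel_stage k n" using \<open>p \<in> tail_rel k\<close> unfolding tail_rel_def by blast
    show ?thesis unfolding g[OF n] by (rule decode(2)[OF n])
  qed
  ultimately have "homeomorphic_maps ?G (tail_topology k) code g"
    unfolding homeomorphic_maps_def top topspace_tail_topology by blast
  then show ?thesis unfolding gU homeomorphic_map_maps by blast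
qed

lemma cut_groupoid_iso_uhf: "isomorphic_topological_groupoids (cut_groupoid \<Gamma>) (uhf_groupoid k)"
proof -
  let ?G = "cut_groupoid \<Gamma>" and ?H = "uhf_groupoid k"
  have arrH: "arrows ?H = tail_rel k" by (simp add: arrows_def uhf_groupoid_def topspace_tail_topology)
  have code_arr: "code p \<in> arrows ?H" if "p \<in> cut_arrows" for p
    using that homeomorphic_imp_surjective_map[OF code_homeomorphic] arrows_cut by (auto simp: arrows_def)
  have comp: "(code p, code q) \<in> composable ?H \<longleftrightarrow> (p, q) \<in> composable ?G"
    if pq: "p \<in> cut_arrows" "q \<in> cut_arrows" for p q
  proof -
    obtain d y c x where e: "p = (d, y)" "q = (c, x)" by (cases p; cases q)
    have "digit y = digit (cut_shift c x) \<longleftrightarrow> y = cut_shift c x" using digit_inj pq e by auto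
    moreover have "(code p, code q) \<in> composable ?H \<longleftrightarrow> digit y = digit (cut_shift c x)"
      using code_arr[OF pq(1)] code_arr[OF pq(2)]
      by (auto simp: composable_def uhf_groupoid_def code_def e)
    moreover have "(p, q) \<in> composable ?G \<longleftrightarrow> y = cut_shift c x"
      using pq unfolding composable_def arrows_cut by (auto simp: cut_groupoid_def e)
    ultimately show ?thesis by simp
  qed
  have mult: "code (gmult ?G p q) = gmult ?H (code p) (code q)" if pq: "(p, q) \<in> composable ?G" for p q
  proof -
    obtain d y c x where e: "p = (d, y)" "q = (c, x)" by (cases p; cases q)
    have "y = cut_shift c x" using pq by (auto simp: composable_def cut_groupoid_def e)
    then show ?thesis by (simp add: cut_groupoid_def uhf_groupoid_def code_def e add.commute)
  qed
  have iso: "topological_groupoid_iso ?G ?H code"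
    using comp mult unfolding arrows_cut[symmetric] by (intro topological_groupoid_isoI code_homeomorphic)
  have "code (ginv ?G p) = ginv ?H (code p)" for p
    by (cases p) (simp add: cut_groupoid_def uhf_groupoid_def code_def)
  then have "topological_groupoid ?H"
    using topological_groupoid_transfer[OF topological_groupoid_cut groupoid_uhf iso] by blast
  then show ?thesis
    using topological_groupoid_cut iso unfolding isomorphic_topological_groupoids_def by blast
qed

end


theorem corollary3p16:
  fixes \<Gamma> :: "real set" and k :: "nat \<Rightarrow> nat"
  assumes "\<Gamma> \<subseteq> \<rat>"
    and "0 \<in> \<Gamma>" and "\<And>x y. x \<in> \<Gamma> \<Longrightarrow> y \<in> \<Gamma> \<Longrightarrow> x - y \<in> \<Gamma>"
    and "closure \<Gamma> = UNIV"
    and "1 \<in> \<Gamma>"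
    and "generating_chain \<Gamma> k"
  shows "isomorphic_topological_groupoids (cut_groupoid \<Gamma>) (uhf_groupoid k) \<and>
    (\<forall>l. generating_chain \<Gamma> l \<longrightarrow>
       isomorphic_topological_groupoids (uhf_groupoid k) (uhf_groupoid l)) \<and>
    (\<forall>l. divisibility_chain l \<longrightarrow>
       (sym_limit k \<cong> sym_limit l \<longleftrightarrow>
          supernatural_prod (factor k) = supernatural_prod (factor l)) \<and>
       (alt_limit k \<cong> alt_limit l \<longleftrightarrow>
          supernatural_prod (factor k) = supernatural_prod (factor l)))"
proof (intro conjI allI impI)
  have k: "divisibility_chain k" using assms(6) by (simp add: generating_chain_def)
  have iso: "isomorphic_topological_groupoids (cut_groupoid \<Gamma>) (uhf_groupoid l)"
    if "generating_chain \<Gamma> l" for l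
    using gen_chain.cut_groupoid_iso_uhf[OF gen_chain.intro[OF that]] .
  show "isomorphic_topological_groupoids (cut_groupoid \<Gamma>) (uhf_groupoid k)"
    by (rule iso[OF assms(6)])
  fix l
  \<comment> \<open>Both UHF groupoids are compared with the cut groupoid, which does not see the
    generating chain.\<close>
  show "isomorphic_topological_groupoids (uhf_groupoid k) (uhf_groupoid l)" if "generating_chain \<Gamma> l"
    using isomorphic_topological_groupoids_trans[OF
        isomorphic_topological_groupoids_sym[OF iso[OF assms(6)]] iso[OF that]] .
  assume "divisibility_chain l"
  then show "sym_limit k \<cong> sym_limit l \<longleftrightarrow> supernatural_prod (factor k) = supernatural_prod (factor l)"
    "alt_limit k \<cong> alt_limit l \<longleftrightarrow> supernatural_prod (factor k) = supernatural_prod (factor l)"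
    by (rule limits_iso_iff[OF k])+
qed

end
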